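(* For all integers $k\ge 1$ and $n\ge 2$, $$\frac{1}{2\sqrt{4k+2}}\, n^{-1/2} \;\leq\; \left(\frac{\mathrm{Vol}\, \widetilde{C}}{\mathrm{Vol}\, B_M}\right)^{1/D_M} \;\leq\; 4\left(\frac{2k^2}{4k^2+n-2}\right)^{1/2},$$ where $\widetilde{C}=\widetilde{C}_{n,2k}$ is the translated section of the cone of nonnegative forms of degree $2k$ in $n$ variables, and $B_M$, $D_M$ are the $L^2$ unit ball and the dimension of the space $M_{n,2k}$ of forms of integral zero on the sphere.
   Context: $P_{n,2k}$ is the real vector space of real homogeneous polynomials (forms) of degree $2k$ in $n$ variables. $S^{n-1}$ is the unit sphere in $\mathbb{R}^n$ and $\sigma$ is the rotation invariant probability measure on it. $P_{n,2k}$ carries the inner product $\langle f,g\rangle=\int_{S^{n-1}} fg\,d\sigma$. $M=M_{n,2k}=\{f\in P_{n,2k} : \int_{S^{n-1}} f\,d\sigma=0\}$, $D_M=\dim M_{n,2k}$, and $B_M$ is the unit ball of $M_{n,2k}$ in the inner product $\langle\,,\rangle$; $\mathrm{Vol}$ is Lebesgue measure on $M_{n,2k}$ for this inner product. Let $r^{2k}=(x_1^2+\dots+x_n^2)^k$. The cone of nonnegative forms is $C=\{f\in P_{n,2k} : f(x)\ge 0 \text{ for all } x\in\mathbb{R}^n\}$, and $\widetilde{C}=\{f\in M_{n,2k} : f+r^{2k}\in C\}$. *)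

theory Defs
  imports "HOL-Analysis.Analysis" "HOL-Library.Function_Algebras"
begin

section \<open>Real-valued functions as a real vector space\<close>

instantiation "fun" :: (type, real_vector) real_vector
begin

definition scaleR_fun_def: "c *\<^sub>R f = (\<lambda>x. c *\<^sub>R f x)"

instance
  by standard (simp_all add: scaleR_fun_def fun_eq_iff scaleR_right_distrib scaleR_left_distrib)

end

lemma scaleR_fun_apply [simp]: "(c *\<^sub>R f) x = c *\<^sub>R f x"
  by (simp add: scaleR_fun_def)

lemma sum_fun_apply: "(\<Sum>i\<in>I. f i) x = (\<Sum>i\<in>I. f i x)"
  by (induction I rule: infinite_finite_induct) auto


section \<open>The sphere\<close>

text \<open>
  The rotation invariant probability measure on the unit sphere, as a Borel measure on the ambient
  space: the image of the uniform distribution on the unit ball under radial projection.  That it is a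
  probability measure, is concentrated on the sphere and is invariant under all orthogonal
  transformations (which determines it uniquely) is shown in \<open>emeasure_sphere_measure_UNIV\<close>,
  \<open>AE_sphere_measure\<close> and \<open>sphere_measure_rotation_invariant\<close>.
\<close>

definition sphere_measure :: "(real ^ 'n) measure" where
  "sphere_measure = distr (uniform_measure lborel (ball 0 1)) borel (\<lambda>x. x /\<^sub>R norm x)"

lemma radial_measurable [measurable]: "(\<lambda>x. x /\<^sub>R norm x) \<in> borel_measurable (borel :: (real ^ 'n) measure)"
  by measurable

lemma unit_ball_emeasure: "emeasure lborel (ball (0 :: real ^ 'n) 1) \<noteq> 0"
  "emeasure lborel (ball (0 :: real ^ 'n) 1) \<noteq> \<infinity>"
proof -
  have "measure lborel (ball (0 :: real ^ 'n) 1) > 0"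
    using content_ball_pos[of 1 "0 :: real ^ 'n"] by (simp add: measure_completion)
  then show "emeasure lborel (ball (0 :: real ^ 'n) 1) \<noteq> 0"
    "emeasure lborel (ball (0 :: real ^ 'n) 1) \<noteq> \<infinity>"
    by (auto simp: measure_def)
qed

lemma space_sphere_measure [simp]: "space sphere_measure = UNIV"
  and sets_sphere_measure [simp, measurable_cong]: "sets sphere_measure = sets borel"
  by (simp_all add: sphere_measure_def)

lemma emeasure_sphere_measure_UNIV: "emeasure (sphere_measure :: (real ^ 'n) measure) UNIV = 1"
proof -
  have "emeasure (uniform_measure lborel (ball (0 :: real ^ 'n) 1)) (space lborel) = 1"
    by (subst emeasure_uniform_measure)
      (use unit_ball_emeasure in \<open>auto intro!: ennreal_divide_self simp: top.not_eq_extremum\<close>)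
  then show ?thesis
    by (simp add: sphere_measure_def emeasure_distr)
qed

lemma finite_measure_sphere_measure: "finite_measure (sphere_measure :: (real ^ 'n) measure)"
  by (rule finite_measureI) (simp add: emeasure_sphere_measure_UNIV)

lemma AE_sphere_measure_iff:
  assumes [measurable]: "Measurable.pred borel P"
  shows "(AE x in (sphere_measure :: (real ^ 'n) measure). P x) \<longleftrightarrow>
    (AE x in lborel. x \<in> ball 0 1 \<longrightarrow> P (x /\<^sub>R norm x))"
  unfolding sphere_measure_def
  using unit_ball_emeasure[where 'n = 'n]
  by (subst AE_distr_iff) (simp_all add: AE_uniform_measure less_top)

lemma AE_sphere_measure: "AE x in (sphere_measure :: (real ^ 'n) measure). x \<in> sphere 0 1"
proof -
  have "AE x in lborel. x \<noteq> (0 :: real ^ 'n)"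
    by (rule AE_lborel_singleton)
  then show ?thesis
    by (subst AE_sphere_measure_iff) (auto elim!: eventually_mono)
qed

lemma nn_integral_lborel_translate:
  fixes f :: "'a :: euclidean_space \<Rightarrow> ennreal"
  assumes [measurable]: "f \<in> borel_measurable borel"
  shows "(\<integral>\<^sup>+x. f (c + x) \<partial>lborel) = (\<integral>\<^sup>+x. f x \<partial>lborel)"
proof -
  have "(\<integral>\<^sup>+x. f x \<partial>lborel) = (\<integral>\<^sup>+x. f x \<partial>distr lborel borel ((+) c))"
    by (simp add: lborel_distr_plus)
  then show ?thesis
    by (simp add: nn_integral_distr)
qed

lemma distr_lborel_orthogonal:
  fixes T :: "real ^ 'n \<Rightarrow> real ^ 'n"
  assumes T: "orthogonal_transformation T"
  shows "distr lborel borel T = lborel"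
proof (rule measure_eqI)
  fix B :: "(real ^ 'n) set"
  assume "B \<in> sets (distr lborel borel T)"
  then have B [measurable]: "B \<in> sets borel" by simp
  have lin: "linear T"
    using T by (rule orthogonal_transformation_linear)
  have [measurable]: "T \<in> borel_measurable borel"
    using lin by (intro borel_measurable_continuous_onI linear_continuous_on)
      (simp add: linear_conv_bounded_linear)
  define S where "S = inv T"
  have TS: "T (S x) = x" for x
    using T by (simp add: S_def orthogonal_transformation_surj surj_f_inv_f)
  define A where "A = ball (0 :: real ^ 'n) 1"
  have [measurable]: "A \<in> sets borel"
    by (simp add: A_def)
  have ball: "(\<integral>\<^sup>+y. indicator A (x - T y) \<partial>lborel) = emeasure lborel A" for x
  proof -
    have "x - T y = T (S x - y)" for y
      using lin by (simp add: TS linear_diff)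
    then have "indicator A (x - T y) = (indicator (ball (S x) 1) y :: ennreal)" for y
      using T by (simp add: A_def orthogonal_transformation_norm indicator_def dist_norm)
    then have "(\<integral>\<^sup>+y. indicator A (x - T y) \<partial>lborel) = (\<integral>\<^sup>+y. indicator (ball (S x) 1) y \<partial>lborel)"
      by simp
    also have "\<dots> = (\<integral>\<^sup>+y. indicator (ball (S x) 1) (S x + y) \<partial>lborel)"
      by (rule nn_integral_lborel_translate[symmetric]) (intro borel_measurable_indicator, simp)
    also have "\<dots> = (\<integral>\<^sup>+y. indicator A y \<partial>lborel)"
      by (simp add: A_def indicator_def dist_norm)
    finally show ?thesis
      by simp
  qed
  have "emeasure lborel A * emeasure lborel (T -` B) =
      (\<integral>\<^sup>+x. indicator A x * (\<integral>\<^sup>+y. indicator B (T y) \<partial>lborel) \<partial>lborel)"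
  proof -
    have "(\<integral>\<^sup>+y. indicator B (T y) \<partial>lborel) = (\<integral>\<^sup>+y. indicator (T -` B) y \<partial>lborel)"
      by (simp add: indicator_def)
    also have "\<dots> = emeasure lborel (T -` B)"
      using measurable_sets[of T borel borel B] by simp
    finally show ?thesis
      by (simp only:) (subst nn_integral_multc, auto)
  qed
  also have "\<dots> = (\<integral>\<^sup>+x. indicator A x * (\<integral>\<^sup>+y. indicator B (x + T y) \<partial>lborel) \<partial>lborel)"
  proof (rule nn_integral_cong, rule arg_cong2[where f = "(*)", OF refl])
    fix x
    have "(\<integral>\<^sup>+y. indicator B (T (S x + y)) \<partial>lborel) = (\<integral>\<^sup>+y. indicator B (T y) \<partial>lborel)"
      by (rule nn_integral_lborel_translate) simp
    then show "(\<integral>\<^sup>+y. indicator B (T y) \<partial>lborel) = (\<integral>\<^sup>+y. indicator B (x + T y) \<partial>lborel)"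
      using lin by (simp add: linear_add TS)
  qed
  also have "\<dots> = (\<integral>\<^sup>+x. \<integral>\<^sup>+y. indicator A x * indicator B (x + T y) \<partial>lborel \<partial>lborel)"
    by (simp add: nn_integral_cmult)
  also have "\<dots> = (\<integral>\<^sup>+y. \<integral>\<^sup>+x. indicator A x * indicator B (x + T y) \<partial>lborel \<partial>lborel)"
    by (rule lborel_pair.Fubini'[symmetric]) measurable
  also have "\<dots> = (\<integral>\<^sup>+y. \<integral>\<^sup>+x. indicator A (x - T y) * indicator B x \<partial>lborel \<partial>lborel)"
  proof (rule nn_integral_cong)
    fix y
    have "(\<integral>\<^sup>+x. indicator A (T y + x - T y) * indicator B (T y + x) \<partial>lborel) = (\<integral>\<^sup>+x. indicator A (x - T y) * indicator B x \<partial>lborel)"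
      by (rule nn_integral_lborel_translate) simp
    then show "(\<integral>\<^sup>+x. indicator A x * indicator B (x + T y) \<partial>lborel) = (\<integral>\<^sup>+x. indicator A (x - T y) * indicator B x \<partial>lborel)"
      by (simp add: add.commute)
  qed
  also have "\<dots> = (\<integral>\<^sup>+x. \<integral>\<^sup>+y. indicator A (x - T y) * indicator B x \<partial>lborel \<partial>lborel)"
    by (rule lborel_pair.Fubini') measurable
  also have "\<dots> = emeasure lborel A * emeasure lborel B"
    by (simp add: nn_integral_multc nn_integral_cmult ball)
  finally have "emeasure lborel (T -` B) = emeasure lborel B"
    using unit_ball_emeasure[where 'n = 'n] by (simp add: A_def ennreal_mult_cancel_left)
  then show "emeasure (distr lborel borel T) B = emeasure lborel B"
    by (simp add: emeasure_distr)
qed simp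

lemma sphere_measure_rotation_invariant:
  fixes T :: "real ^ 'n \<Rightarrow> real ^ 'n"
  assumes T: "orthogonal_transformation T"
  shows "distr sphere_measure borel T = sphere_measure"
proof (rule measure_eqI)
  fix A :: "(real ^ 'n) set"
  assume "A \<in> sets (distr sphere_measure borel T)"
  then have [measurable]: "A \<in> sets borel" by simp
  have [measurable]: "T \<in> borel_measurable borel"
    using T by (intro borel_measurable_continuous_onI linear_continuous_on)
      (simp add: linear_conv_bounded_linear[symmetric] orthogonal_transformation_linear)
  define R where "R = (\<lambda>x :: real ^ 'n. x /\<^sub>R norm x)"
  have [measurable]: "R \<in> borel_measurable borel"
    unfolding R_def by measurable
  have RT: "T (R x) = R (T x)" for x
    using T by (simp add: R_def orthogonal_transformation_norm linear_cmul orthogonal_transformation_linear)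
  have sm: "emeasure sphere_measure B =
      emeasure lborel (ball 0 1 \<inter> R -` B) / emeasure lborel (ball (0 :: real ^ 'n) 1)"
    if [measurable]: "B \<in> sets borel" for B
  proof -
    have "R -` B \<in> sets borel"
      using measurable_sets[of R borel borel B] by simp
    then show ?thesis
      by (simp add: sphere_measure_def R_def[symmetric] emeasure_distr)
  qed
  have TA: "T -` A \<in> sets borel"
    using measurable_sets[of T borel borel A] by simp
  have RA: "ball 0 1 \<inter> R -` A \<in> sets borel"
    using measurable_sets[of R borel borel A] by auto
  have "emeasure (distr sphere_measure borel T) A = emeasure sphere_measure (T -` A)"
    by (simp add: emeasure_distr)
  also have "\<dots> = emeasure lborel (ball 0 1 \<inter> R -` (T -` A)) / emeasure lborel (ball (0 :: real ^ 'n) 1)"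
    by (rule sm[OF TA])
  also have "ball 0 1 \<inter> R -` (T -` A) = T -` (ball 0 1 \<inter> R -` A)"
    using T by (auto simp: RT orthogonal_transformation_norm)
  also have "emeasure lborel \<dots> = emeasure (distr lborel borel T) (ball 0 1 \<inter> R -` A)"
    using RA by (simp add: emeasure_distr)
  also have "\<dots> = emeasure lborel (ball 0 1 \<inter> R -` A)"
    by (simp add: distr_lborel_orthogonal[OF T])
  also have "\<dots> / emeasure lborel (ball (0 :: real ^ 'n) 1) = emeasure sphere_measure A"
    by (simp add: sm)
  finally show "emeasure (distr sphere_measure borel T) A = emeasure sphere_measure A" .
qed simp


section \<open>Forms\<close>

definition monomial :: "('n \<Rightarrow> nat) \<Rightarrow> real ^ 'n \<Rightarrow> real" where
  "monomial \<alpha> x = (\<Prod>i\<in>UNIV. x $ i ^ \<alpha> i)"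

text \<open>Forms are identified with the functions they induce, which is harmless over the reals.\<close>

definition forms :: "nat \<Rightarrow> (real ^ 'n \<Rightarrow> real) set" where
  "forms d = span (monomial ` {\<alpha>. (\<Sum>i\<in>UNIV. \<alpha> i) = d})"

definition l2_inner :: "(real ^ 'n \<Rightarrow> real) \<Rightarrow> (real ^ 'n \<Rightarrow> real) \<Rightarrow> real" where
  "l2_inner f g = (\<integral>x. f x * g x \<partial>sphere_measure)"

definition zero_mean_forms :: "nat \<Rightarrow> (real ^ 'n \<Rightarrow> real) set" where
  "zero_mean_forms k = {f \<in> forms (2 * k). (\<integral>x. f x \<partial>sphere_measure) = 0}"

definition zero_mean_ball :: "nat \<Rightarrow> (real ^ 'n \<Rightarrow> real) set" where
  "zero_mean_ball k = {f \<in> zero_mean_forms k. l2_inner f f \<le> 1}"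

definition nonneg_forms :: "nat \<Rightarrow> (real ^ 'n \<Rightarrow> real) set" where
  "nonneg_forms k = {f \<in> forms (2 * k). \<forall>x. f x \<ge> 0}"

definition radial_form :: "nat \<Rightarrow> real ^ 'n \<Rightarrow> real" where
  "radial_form k x = (\<Sum>i\<in>UNIV. (x $ i)\<^sup>2) ^ k"

definition nonneg_section :: "nat \<Rightarrow> (real ^ 'n \<Rightarrow> real) set" where
  "nonneg_section k = {f \<in> zero_mean_forms k. f + radial_form k \<in> nonneg_forms k}"


section \<open>Volume\<close>

definition l2_orthonormal_basis :: "(real ^ 'n \<Rightarrow> real) set \<Rightarrow> (nat \<Rightarrow> real ^ 'n \<Rightarrow> real) \<Rightarrow> bool" where
  "l2_orthonormal_basis V b \<longleftrightarrow>
    (\<forall>i<dim V. \<forall>j<dim V. l2_inner (b i) (b j) = of_bool (i = j)) \<and>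
    span (b ` {..<dim V}) = V"

text \<open>
  Lebesgue measure on a space \<open>V\<close> of forms: the Lebesgue measure of the set of coordinate vectors
  with respect to an orthonormal basis.  By orthogonal invariance of Lebesgue measure, the choice
  of the basis does not matter; existence is \<open>l2_orthonormal_basis_exists\<close> below.  Only Borel sets
  \<open>A\<close> are relevant here, so completing the product measure is unnecessary.
\<close>

definition l2_volume :: "(real ^ 'n \<Rightarrow> real) set \<Rightarrow> (real ^ 'n \<Rightarrow> real) set \<Rightarrow> real" where
  "l2_volume V A =
    (let b = (SOME b. l2_orthonormal_basis V b);
         L = (\<Pi>\<^sub>M i\<in>{..<dim V}. lborel)
     in measure L {c \<in> space L. (\<Sum>i<dim V. c i *\<^sub>R b i) \<in> A})"


section \<open>Existence of orthonormal bases\<close>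

lemma subspace_forms: "subspace (forms d)"
  by (simp add: forms_def)

lemma form_continuous: "f \<in> forms d \<Longrightarrow> continuous_on S f"
  unfolding forms_def
proof (induction rule: span_induct_alt)
  case base
  then show ?case by (simp add: zero_fun_def)
next
  case (step c x y)
  then show ?case
    by (auto simp: plus_fun_def scaleR_fun_def monomial_def intro!: continuous_intros)
qed

lemma form_homogeneous: "f \<in> forms d \<Longrightarrow> f (c *\<^sub>R x) = c ^ d * f x"
  unfolding forms_def
  by (induction rule: span_induct_alt)
    (auto simp: algebra_simps monomial_def power_mult_distrib prod.distrib power_sum)

lemma finite_monomials: "finite {\<alpha> :: 'n :: finite \<Rightarrow> nat. (\<Sum>i\<in>UNIV. \<alpha> i) = d}"
proof (rule finite_subset)
  show "{\<alpha> :: 'n \<Rightarrow> nat. (\<Sum>i\<in>UNIV. \<alpha> i) = d} \<subseteq> Pi\<^sub>E UNIV (\<lambda>_. {..d})"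
    by (auto intro!: member_le_sum)
  show "finite (Pi\<^sub>E (UNIV :: 'n set) (\<lambda>_. {..d}))"
    by (intro finite_PiE) auto
qed

lemma integrable_sphere_measure:
  fixes f :: "real ^ 'n \<Rightarrow> real"
  assumes "continuous_on UNIV f"
  shows "integrable sphere_measure f"
proof -
  interpret finite_measure "sphere_measure :: (real ^ 'n) measure"
    by (rule finite_measure_sphere_measure)
  have "bounded (f ` sphere 0 1)"
    using assms by (intro compact_imp_bounded compact_continuous_image) (auto intro: continuous_on_subset)
  then obtain B where "\<forall>x\<in>sphere 0 1. norm (f x) \<le> B"
    by (auto simp: bounded_iff)
  moreover have "f \<in> borel_measurable sphere_measure"
    using borel_measurable_continuous_onI[OF assms] by simp
  ultimately show ?thesis
    using AE_sphere_measure by (intro integrable_const_bound[of _ B]) (auto elim!: eventually_mono)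
qed

lemma l2_inner_commute: "l2_inner f g = l2_inner g f"
  by (simp add: l2_inner_def mult.commute)

lemma l2_inner_add_left:
  assumes "f \<in> forms d" "g \<in> forms d" "h \<in> forms d"
  shows "l2_inner (f + g) h = l2_inner f h + l2_inner g h"
  unfolding l2_inner_def using assms
  by (simp add: distrib_right integrable_sphere_measure continuous_on_mult form_continuous)

lemma l2_inner_scaleR_left: "l2_inner (c *\<^sub>R f) h = c * l2_inner f h"
  by (simp add: l2_inner_def mult.assoc)

lemma l2_inner_sum_left:
  assumes "\<And>i. i \<in> I \<Longrightarrow> f i \<in> forms d" "h \<in> forms d"
  shows "l2_inner (\<Sum>i\<in>I. c i *\<^sub>R f i) h = (\<Sum>i\<in>I. c i * l2_inner (f i) h)"
  using assms
proof (induction I rule: infinite_finite_induct)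
  case (insert i I)
  have "l2_inner (\<Sum>i\<in>insert i I. c i *\<^sub>R f i) h = l2_inner (c i *\<^sub>R f i + (\<Sum>i\<in>I. c i *\<^sub>R f i)) h"
    using insert.hyps by (subst sum.insert) auto
  also have "\<dots> = l2_inner (c i *\<^sub>R f i) h + l2_inner (\<Sum>i\<in>I. c i *\<^sub>R f i) h"
    using insert.prems
    by (intro l2_inner_add_left[where d = d] subspace_sum subspace_scale subspace_forms) auto
  also have "\<dots> = c i * l2_inner (f i) h + (\<Sum>i\<in>I. c i * l2_inner (f i) h)"
    using insert.IH[OF insert.prems(1)[OF insertI2] insert.prems(2)] by (simp only: l2_inner_scaleR_left)
  also have "\<dots> = (\<Sum>i\<in>insert i I. c i * l2_inner (f i) h)"
    using insert.hyps by simp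
  finally show ?case .
qed (simp_all add: l2_inner_def)

lemma l2_inner_nonneg: "l2_inner f f \<ge> 0"
  by (simp add: l2_inner_def)

lemma l2_inner_eq_0:
  fixes f :: "real ^ 'n \<Rightarrow> real"
  assumes f: "f \<in> forms d" and 0: "l2_inner f f = 0"
  shows "f = 0"
proof -
  have [measurable]: "f \<in> borel_measurable borel"
    using f by (intro borel_measurable_continuous_onI form_continuous)
  have "AE x in sphere_measure. f x * f x = 0"
    using 0 f unfolding l2_inner_def
    by (subst (asm) integral_nonneg_eq_0_iff_AE)
      (auto intro!: integrable_sphere_measure continuous_on_mult intro: form_continuous)
  then have 1: "AE x in lborel. x \<in> ball 0 1 \<longrightarrow> f (x /\<^sub>R norm x) * f (x /\<^sub>R norm x) = 0"
    by (subst (asm) AE_sphere_measure_iff) simp_all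
  have hom: "f x = norm x ^ d * f (x /\<^sub>R norm x)" if "x \<noteq> 0" for x
    using form_homogeneous[OF f, of "norm x" "x /\<^sub>R norm x"] that by simp
  have 2: "AE x in lborel. x \<noteq> (0 :: real ^ 'n)"
    by (rule AE_lborel_singleton)
  have ae: "AE x in lborel. x \<in> ball 0 1 \<longrightarrow> f x = 0"
    using 1 2
  proof eventually_elim
    case (elim x)
    then show ?case
      by (subst hom) simp_all
  qed
  have "ball 0 1 \<inter> {x. f x \<noteq> 0} = {}"
  proof (rule ccontr)
    assume ne: "ball 0 1 \<inter> {x. f x \<noteq> 0} \<noteq> {}"
    have "open {x. f x \<noteq> 0}"
      using form_continuous[OF f, of UNIV] by (intro open_Collect_neq) auto
    then have "open (ball 0 1 \<inter> {x. f x \<noteq> 0})"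
      by (intro open_Int open_ball)
    moreover have "negligible (ball 0 1 \<inter> {x. f x \<noteq> 0})"
    proof -
      have "ball 0 1 \<inter> {x. f x \<noteq> 0} \<in> sets lborel"
        using calculation by simp
      moreover have "AE x in lborel. x \<notin> ball 0 1 \<inter> {x. f x \<noteq> 0}"
        using ae by eventually_elim simp
      ultimately have "ball 0 1 \<inter> {x. f x \<noteq> 0} \<in> null_sets lborel"
        by (subst AE_iff_null_sets)
      then show ?thesis
        by (simp only: negligible_iff_null_sets null_sets_completionI)
    qed
    ultimately show False
      using ne open_not_negligible by blast
  qed
  then have ball: "f x = 0" if "norm x < 1" for x
    using that by auto
  show "f = 0"
  proof
    fix x :: "real ^ 'n"
    have "norm ((1 / (1 + norm x)) *\<^sub>R x) < 1"
    proof -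
      have "1 + norm x > 0"
        by (rule add_pos_nonneg) simp_all
      then show ?thesis
        by (simp add: divide_less_eq)
    qed
    then have "(1 / (1 + norm x)) ^ d * f x = 0"
      using ball form_homogeneous[OF f] by metis
    moreover have "1 + norm x \<noteq> 0"
      using norm_ge_zero[of x] by linarith
    ultimately show "f x = 0 x"
      by simp
  qed
qed

lemma orthonormal_independent:
  fixes b :: "nat \<Rightarrow> real ^ 'n \<Rightarrow> real"
  assumes b: "\<And>i. i < m \<Longrightarrow> b i \<in> forms d"
    and on: "\<And>i j. i < m \<Longrightarrow> j < m \<Longrightarrow> l2_inner (b i) (b j) = of_bool (i = j)"
  shows "independent (b ` {..<m})" "inj_on b {..<m}"
proof -
  show inj: "inj_on b {..<m}"
  proof (rule inj_onI)
    fix i j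
    assume "i \<in> {..<m}" "j \<in> {..<m}" "b i = b j"
    then show "i = j"
      using on[of i i] on[of i j] by (auto split: if_splits)
  qed
  show "independent (b ` {..<m})"
  proof (rule independent_if_scalars_zero)
    fix c x
    assume s: "(\<Sum>x\<in>b ` {..<m}. c x *\<^sub>R x) = 0" and x: "x \<in> b ` {..<m}"
    then obtain j where j: "j < m" "x = b j"
      by auto
    have "0 = l2_inner (\<Sum>i<m. c (b i) *\<^sub>R b i) (b j)"
      using s inj by (simp add: sum.reindex l2_inner_def)
    also have "\<dots> = (\<Sum>i<m. c (b i) * l2_inner (b i) (b j))"
      using b j by (intro l2_inner_sum_left[where d = d]) auto
    also have "\<dots> = (\<Sum>i<m. if i = j then c (b i) else 0)"
      using on j by (intro sum.cong) auto
    also have "\<dots> = c (b j)"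
      using j by (subst sum.delta) auto
    finally have "c (b j) = 0" by simp
    then show "c x = 0"
      by (simp add: j)
  qed simp
qed

lemma l2_orthonormal_basis_exists:
  fixes V :: "(real ^ 'n \<Rightarrow> real) set"
  assumes V: "subspace V" "V \<subseteq> forms d"
  shows "\<exists>b. l2_orthonormal_basis V b"
proof -
  define Q where "Q m b \<longleftrightarrow> (\<forall>i<m. b i \<in> V) \<and>
    (\<forall>i<m. \<forall>j<m. l2_inner (b i) (b j) = of_bool (i = j))" for m and b :: "nat \<Rightarrow> real ^ 'n \<Rightarrow> real"
  obtain B where B: "B \<subseteq> V" "independent B" "V \<subseteq> span B" "card B = dim V"
    by (rule basis_exists)
  have "finite B"
  proof -
    have "B \<subseteq> span (monomial ` {\<alpha>. (\<Sum>i\<in>UNIV. \<alpha> i) = d})"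
      using B(1) V(2) by (auto simp: forms_def)
    then show ?thesis
      using independent_span_bound[OF _ B(2)] finite_monomials by blast
  qed
  have bound: "m \<le> dim V" if "Q m b" for m b
  proof -
    have ind: "independent (b ` {..<m})" "inj_on b {..<m}"
      using that V(2) unfolding Q_def by (intro orthonormal_independent[where d = d]; blast)+
    have "b ` {..<m} \<subseteq> span B"
      using that B(3) by (auto simp: Q_def)
    then have "card (b ` {..<m}) \<le> card B"
      using independent_span_bound[OF \<open>finite B\<close> ind(1)] by blast
    then show ?thesis
      using ind(2) B(4) by (simp add: card_image)
  qed
  have step: "\<exists>b'. Q (Suc m) b'" if Q: "Q m b" and ne: "span (b ` {..<m}) \<noteq> V" for m b
  proof -
    have bV: "b i \<in> V" if "i < m" for i
      using Q that by (auto simp: Q_def)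
    have on: "l2_inner (b i) (b j) = of_bool (i = j)" if "i < m" "j < m" for i j
      using Q that by (auto simp: Q_def)
    have "span (b ` {..<m}) \<subseteq> V"
      using bV V(1) by (intro span_minimal) auto
    then obtain v where v: "v \<in> V" "v \<notin> span (b ` {..<m})"
      using ne by blast
    define w where "w = v + (\<Sum>i<m. (- l2_inner v (b i)) *\<^sub>R b i)"
    have wV: "w \<in> V"
      unfolding w_def using v bV V(1) by (intro subspace_add subspace_sum subspace_scale) auto
    have w0: "w \<noteq> 0"
    proof
      assume "w = 0"
      then have "v = - (\<Sum>i<m. (- l2_inner v (b i)) *\<^sub>R b i)"
        by (simp add: w_def eq_neg_iff_add_eq_0)
      also have "\<dots> \<in> span (b ` {..<m})"
        by (intro span_neg span_sum span_scale span_base) auto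
      finally show False
        using v by simp
    qed
    have worth: "l2_inner w (b j) = 0" if j: "j < m" for j
    proof -
      have "l2_inner w (b j) = l2_inner v (b j) + l2_inner (\<Sum>i<m. (- l2_inner v (b i)) *\<^sub>R b i) (b j)"
        unfolding w_def using v bV V j
        by (intro l2_inner_add_left[where d = d] subspace_sum subspace_scale subspace_forms) auto
      also have "l2_inner (\<Sum>i<m. (- l2_inner v (b i)) *\<^sub>R b i) (b j) =
          (\<Sum>i<m. (- l2_inner v (b i)) * l2_inner (b i) (b j))"
        using bV V j by (intro l2_inner_sum_left[where d = d]) auto
      also have "\<dots> = (\<Sum>i<m. if i = j then - l2_inner v (b i) else 0)"
        using on j by (intro sum.cong) auto
      finally show ?thesis
        using j by simp
    qed
    have pos: "l2_inner w w > 0"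
      using l2_inner_eq_0[of w d] l2_inner_nonneg[of w] w0 wV V(2) by (auto simp: less_le)
    define u where "u = (1 / sqrt (l2_inner w w)) *\<^sub>R w"
    have uu: "l2_inner u u = 1"
      using pos by (simp add: u_def l2_inner_scaleR_left l2_inner_commute[of w "_ *\<^sub>R _"])
    have ub: "l2_inner u (b j) = 0" "l2_inner (b j) u = 0" if "j < m" for j
      using worth[OF that] by (simp_all add: u_def l2_inner_scaleR_left l2_inner_commute[of "b j"])
    have "u \<in> V"
      using wV V(1) by (simp add: u_def subspace_scale)
    then have "Q (Suc m) (b(m := u))"
      using bV on uu ub by (auto simp: Q_def less_Suc_eq)
    then show ?thesis
      by blast
  qed
  have Q0: "Q 0 b" for b
    by (simp add: Q_def)
  define m where "m = (GREATEST m. \<exists>b. Q m b)"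
  have "\<exists>b. Q m b"
    unfolding m_def using Q0 bound by (intro GreatestI_nat[of "\<lambda>m. \<exists>b. Q m b" 0 "dim V"]) blast+
  then obtain b where b: "Q m b" ..
  have max: "m' \<le> m" if "Q m' b'" for m' b'
    unfolding m_def using that bound by (intro Greatest_le_nat[of "\<lambda>m. \<exists>b. Q m b" _ "dim V"]) blast+
  have span: "span (b ` {..<m}) = V"
    using step[OF b] max by force
  have "dim V \<le> card (b ` {..<m})"
    using span by (intro dim_le_card) auto
  also have "\<dots> \<le> m"
    using card_image_le[of "{..<m}" b] by simp
  finally have "m = dim V"
    using bound[OF b] by simp
  with b span have "l2_orthonormal_basis V b"
    by (simp add: l2_orthonormal_basis_def Q_def)
  then show ?thesis
    by blast
qed

lemma subspace_zero_mean_forms: "subspace (zero_mean_forms k :: (real ^ 'n \<Rightarrow> real) set)"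
proof (rule subspaceI)
  show "0 \<in> zero_mean_forms k"
    using subspace_0[OF subspace_forms] by (simp add: zero_mean_forms_def zero_fun_def)
next
  fix f g :: "real ^ 'n \<Rightarrow> real"
  assume "f \<in> zero_mean_forms k" "g \<in> zero_mean_forms k"
  moreover have "integrable sphere_measure h" if "h \<in> forms (2 * k)" for h :: "real ^ 'n \<Rightarrow> real"
    using that by (intro integrable_sphere_measure form_continuous)
  ultimately show "f + g \<in> zero_mean_forms k"
    using subspace_add[OF subspace_forms, of f "2 * k" g] by (simp add: zero_mean_forms_def plus_fun_def)
next
  fix c and f :: "real ^ 'n \<Rightarrow> real"
  assume "f \<in> zero_mean_forms k"
  then show "c *\<^sub>R f \<in> zero_mean_forms k"
    using subspace_scale[OF subspace_forms, of f "2 * k" c] by (simp add: zero_mean_forms_def scaleR_fun_def)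
qed

corollary zero_mean_forms_orthonormal_basis: "\<exists>b. l2_orthonormal_basis (zero_mean_forms k) b"
  by (rule l2_orthonormal_basis_exists[OF subspace_zero_mean_forms, of _ "2 * k"])
    (auto simp: zero_mean_forms_def)

end

theory Submission
  imports Defs "HOL-Computational_Algebra.Polynomial" "HOL-Probability.Distributions"
begin

text \<open>
  Write \<open>K\<close> for the section \<open>nonneg_section k\<close>, \<open>M\<close> for its ambient space and \<open>n\<close> for the number of variables.

  Upper bound.  The function \<open>y \<mapsto> vol (K \<inter> (y - K))\<close> is supported in \<open>2K\<close>, has integral \<open>(vol K)\<^sup>2\<close>, is
  log-concave by the Prekopa-Leindler inequality and invariant under rotations.  Since no nonzero element of
  \<open>M\<close> is invariant, it is maximal at \<open>0\<close>, so \<open>vol K \<le> 2\<^bsup>dim M\<^esup> vol (K \<inter> -K)\<close>.  An element of \<open>K \<inter> -K\<close> is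
  bounded by 1 on the sphere, so its gradient is bounded by \<open>2k\<close> there (Szego's inequality along great circles),
  and the Poincare inequality for even functions bounds its L2 norm.

  Lower bound.  By concentration of the values \<open>f x\<close> for \<open>f\<close> uniform in the unit ball of \<open>M\<close>, the mean of
  \<open>\<integral> f\<^bsup>2n\<^esup> d\<sigma>\<close> over the ball is at most \<open>2 n! 2\<^bsup>n\<^esup>\<close>.  As \<open>f\<^bsup>n\<^esup>\<close> is a form of degree \<open>2kn\<close>, its supremum is
  controlled by its L2 norm and the dimension of the space of these forms, and Markov's inequality shows that a
  suitable multiple of most of the unit ball lies in \<open>K\<close>.
\<close>

section \<open>The algebra of forms\<close>

text \<open>Three points shape the argument. The sphere measure is known only as an image measure,
  so all integration by parts rests on its invariance under rotations of coordinate planes. The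
  upper constant: by Euler's identity the radial derivative of \<open>f\<close> is
  \<open>2k f\<close>, and Szego bounds the radial and tangential parts together by
  \<open>4k^2\<close>. The Poincare constant is \<open>4k^2 + 2n\<close>, where \<open>2n\<close> is
  the least positive eigenvalue of the spherical Laplacian on even functions. This gives
  \<open>2 sqrt (2k^2 / (2k^2 + n))\<close>, which is below the claimed bound. The lower constant:
  the exponent \<open>n\<close> is chosen so that the \<open>n!\<close> of the moment bound cancels
  against the dimension of the forms of degree \<open>2kn\<close>, at most
  \<open>((2k+1)n)^n / ((2k+1) n!)\<close>. With the scaling \<open>t^(-2) = 4(2k+1)n\<close> the
  exceptional part of the ball has proportion at most \<open>2^(1-n) / (2k+1)\<close>, hence at most
  1/6. The claimed bound is \<open>t / sqrt 2\<close>, and the factor \<open>sqrt 2\<close> pays for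
  the lost 5/6.\<close>

lemma form_add: "f \<in> forms d \<Longrightarrow> g \<in> forms d \<Longrightarrow> (\<lambda>x. f x + g x) \<in> forms d"
  using subspace_add[OF subspace_forms] by (auto simp: plus_fun_def)

lemma form_cmult: "f \<in> forms d \<Longrightarrow> (\<lambda>x. c * f x) \<in> forms d"
  using subspace_scale[OF subspace_forms, of f d c] by (simp add: scaleR_fun_def)

lemma form_diff: "f \<in> forms d \<Longrightarrow> g \<in> forms d \<Longrightarrow> (\<lambda>x. f x - g x) \<in> forms d"
  using form_add[of f d "\<lambda>x. - 1 * g x"] form_cmult[of g d "- 1"] by simp

lemma form_zero: "(\<lambda>x. 0) \<in> forms d"
  using subspace_0[OF subspace_forms] by (simp add: zero_fun_def)

lemma form_sum: "(\<And>i. i \<in> I \<Longrightarrow> f i \<in> forms d) \<Longrightarrow> (\<lambda>x. \<Sum>i\<in>I. f i x) \<in> forms d"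
  by (induction I rule: infinite_finite_induct) (auto intro: form_zero form_add)

text \<open>Sums and multiples are separate cases, phrased with pointwise lambda terms, so that they
  match closure properties stated for \<open>\<lambda>x. f x + g x\<close> and
  \<open>\<lambda>x. c * f x\<close>.\<close>

lemma form_induct [consumes 1, case_names monomial zero add cmult]:
  assumes "f \<in> forms d"
    and "\<And>\<alpha>. (\<Sum>i\<in>UNIV. \<alpha> i) = d \<Longrightarrow> P (monomial \<alpha>)"
    and "P (\<lambda>x. 0)"
    and "\<And>f g. f \<in> forms d \<Longrightarrow> g \<in> forms d \<Longrightarrow> P f \<Longrightarrow> P g \<Longrightarrow> P (\<lambda>x. f x + g x)"
    and "\<And>c f. f \<in> forms d \<Longrightarrow> P f \<Longrightarrow> P (\<lambda>x. c * f x)"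
  shows "P f"
proof -
  have mon: "monomial \<alpha> \<in> forms d" if "(\<Sum>i\<in>UNIV. \<alpha> i) = d" for \<alpha> :: "'a \<Rightarrow> nat"
    using that by (auto simp: forms_def intro: span_base)
  have "f \<in> forms d \<and> P f"
    using assms(1) unfolding forms_def
  proof (induction rule: span_induct_alt)
    case base
    then show ?case
      using assms(3) form_zero by (simp add: zero_fun_def forms_def)
  next
    case (step c m g)
    then obtain \<alpha> where \<alpha>: "m = monomial \<alpha>" "(\<Sum>i\<in>UNIV. \<alpha> i) = d"
      by auto
    have "(\<lambda>x. c * m x) \<in> forms d" "P (\<lambda>x. c * m x)"
      using \<alpha> mon assms(2,5) by (auto intro: form_cmult)
    moreover have "g \<in> forms d" "P g"
      using step by (auto simp: forms_def)
    ultimately have "P (\<lambda>x. c * m x + g x)" "(\<lambda>x. c * m x + g x) \<in> forms d"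
      using assms(4) by (auto intro: form_add)
    then show ?case
      by (simp add: plus_fun_def scaleR_fun_def forms_def)
  qed
  then show ?thesis ..
qed

lemma form_monomial: "(\<Sum>i\<in>UNIV. \<alpha> i) = d \<Longrightarrow> monomial \<alpha> \<in> forms d"
  by (auto simp: forms_def intro: span_base)

lemma form_mult:
  assumes f: "f \<in> forms d" and g: "g \<in> forms e"
  shows "(\<lambda>x. f x * g x) \<in> forms (d + e)"
  using f
proof (induction rule: form_induct)
  case (monomial \<alpha>)
  show ?case
    using g
  proof (induction rule: form_induct)
    case (monomial \<beta>)
    have "(\<lambda>x. monomial \<alpha> x * monomial \<beta> x) = monomial (\<lambda>i. \<alpha> i + \<beta> i)"
      by (simp add: monomial_def power_add prod.distrib fun_eq_iff)
    then show ?case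
      using monomial \<open>sum \<alpha> UNIV = d\<close> by (simp add: form_monomial sum.distrib)
  next
    case (cmult c g)
    then show ?case
      using form_cmult[OF cmult(2), of c] by (simp add: mult_ac)
  qed (auto simp: distrib_left intro: form_zero form_add)
next
  case (cmult c f)
  then show ?case
    using form_cmult[OF cmult(2), of c] by (simp add: mult_ac)
qed (auto simp: distrib_right intro: form_zero form_add)

lemma form_one: "(\<lambda>x :: real ^ 'n. 1) \<in> forms 0"
proof -
  have "(\<lambda>x :: real ^ 'n. 1 :: real) = monomial (\<lambda>_. 0)"
    by (simp add: monomial_def fun_eq_iff)
  then show ?thesis
    by (simp only:) (rule form_monomial, simp)
qed

lemma form_power: "f \<in> forms d \<Longrightarrow> (\<lambda>x. f x ^ m) \<in> forms (d * m)"
proof (induction m)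
  case (Suc m)
  then show ?case
    using form_mult[of f d "\<lambda>x. f x ^ m" "d * m"] by simp
qed (simp add: form_one)

lemma form_prod:
  "finite I \<Longrightarrow> (\<And>i. i \<in> I \<Longrightarrow> f i \<in> forms (d i)) \<Longrightarrow> (\<lambda>x. \<Prod>i\<in>I. f i x) \<in> forms (\<Sum>i\<in>I. d i)"
  by (induction I rule: finite_induct) (auto intro: form_one form_mult)

lemma form_coordinate: "(\<lambda>x :: real ^ 'n. x $ i) \<in> forms 1"
proof -
  have "(\<lambda>x :: real ^ 'n. x $ i) = monomial (\<lambda>j. of_bool (j = i))"
  proof
    fix x :: "real ^ 'n"
    have "monomial (\<lambda>j. of_bool (j = i)) x = (\<Prod>j\<in>UNIV. if j = i then x $ j else 1)"
      unfolding monomial_def by (rule prod.cong) auto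
    then show "x $ i = monomial (\<lambda>j. of_bool (j = i)) x"
      by simp
  qed
  then show ?thesis
    by (simp only:) (rule form_monomial, simp add: of_bool_def)
qed

lemma form_norm_power: "(\<lambda>x :: real ^ 'n. norm x ^ (2 * k)) \<in> forms (2 * k)"
proof -
  have "(\<lambda>x :: real ^ 'n. \<Sum>i\<in>UNIV. (x $ i)\<^sup>2) \<in> forms 2"
    using form_power[OF form_coordinate, of _ 2] by (intro form_sum) auto
  then have "(\<lambda>x :: real ^ 'n. (\<Sum>i\<in>UNIV. (x $ i)\<^sup>2) ^ k) \<in> forms (2 * k)"
    by (rule form_power)
  also have "(\<lambda>x :: real ^ 'n. (\<Sum>i\<in>UNIV. (x $ i)\<^sup>2) ^ k) = (\<lambda>x. norm x ^ (2 * k))"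
    by (simp add: norm_vec_def L2_set_def power_mult sum_nonneg)
  finally show ?thesis .
qed

lemma form_norm_squared_mult:
  assumes "g \<in> forms d"
  shows "(\<lambda>x :: real ^ 'n. (norm x)\<^sup>2 * g x) \<in> forms (Suc (Suc d))"
  using form_mult[OF form_norm_power[of 1] assms] by simp

lemma form_compose_linear:
  fixes T :: "real ^ 'n \<Rightarrow> real ^ 'm"
  assumes T: "linear T" and f: "f \<in> forms d"
  shows "(\<lambda>x. f (T x)) \<in> forms d"
  using f
proof (induction rule: form_induct)
  case (monomial \<alpha>)
  have coord: "(\<lambda>x. T x $ i) \<in> forms 1" for i
  proof -
    have "T x $ i = (\<Sum>j\<in>UNIV. matrix T $ i $ j * x $ j)" for x
      using fun_cong[OF matrix_vector_mul(2)[OF T], of x]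
      by (simp add: matrix_vector_mult_def vec_eq_iff del: matrix_vector_mul)
    then show ?thesis
      by (simp only:) (intro form_sum form_cmult form_coordinate)
  qed
  have "(\<lambda>x. \<Prod>i\<in>UNIV. (T x $ i) ^ \<alpha> i) \<in> forms (\<Sum>i\<in>UNIV. 1 * \<alpha> i)"
    by (intro form_prod form_power coord) simp
  then show ?case
    using monomial by (simp add: monomial_def)
qed (auto intro: form_zero form_add form_cmult)

text \<open>Restriction to a line is what makes the one-variable Szego inequality applicable to
  forms, see \<open>gradient_bound\<close>.\<close>

lemma form_line_poly:
  fixes f :: "real ^ 'n \<Rightarrow> real"
  assumes "f \<in> forms d"
  shows "\<exists>p. degree p \<le> d \<and> (\<forall>t. poly p t = f (x + t *\<^sub>R v))"
  using assms
proof (induction rule: form_induct)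
  case (monomial \<alpha>)
  define p where "p = (\<Prod>i\<in>UNIV. [:x $ i, v $ i:] ^ \<alpha> i)"
  have "degree p \<le> (\<Sum>i\<in>UNIV. degree ([:x $ i, v $ i:] ^ \<alpha> i))"
    unfolding p_def using degree_prod_sum_le[of UNIV "\<lambda>i. [:x $ i, v $ i:] ^ \<alpha> i"] by (simp add: o_def)
  also have "\<dots> \<le> (\<Sum>i\<in>UNIV. 1 * \<alpha> i)"
    by (intro sum_mono order_trans[OF degree_power_le] mult_right_mono) auto
  finally have "degree p \<le> d"
    using monomial by simp
  moreover have "poly p t = monomial \<alpha> (x + t *\<^sub>R v)" for t
    by (simp add: p_def monomial_def poly_prod)
  ultimately show ?case by blast
next
  case zero
  show ?case by (rule exI[of _ 0]) simp
next
  case (add f g)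
  then obtain p q where "degree p \<le> d" "\<And>t. poly p t = f (x + t *\<^sub>R v)"
    "degree q \<le> d" "\<And>t. poly q t = g (x + t *\<^sub>R v)" by blast
  then show ?case
    by (intro exI[of _ "p + q"]) (simp add: degree_add_le)
next
  case (cmult c f)
  then obtain p where "degree p \<le> d" "\<And>t. poly p t = f (x + t *\<^sub>R v)" by blast
  then show ?case
    by (intro exI[of _ "smult c p"]) (auto intro: order_trans[OF degree_smult_le])
qed

section \<open>Derivatives of forms\<close>

definition partial_deriv :: "'n \<Rightarrow> (real ^ 'n \<Rightarrow> real) \<Rightarrow> real ^ 'n \<Rightarrow> real" where
  "partial_deriv i f x = deriv (\<lambda>t. f (x + t *\<^sub>R axis i 1)) 0"

definition laplacian :: "(real ^ 'n \<Rightarrow> real) \<Rightarrow> real ^ 'n \<Rightarrow> real" where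
  "laplacian f x = (\<Sum>i\<in>UNIV. partial_deriv i (partial_deriv i f) x)"

text \<open>The gradient is produced existentially, together with the chain rule along every
  differentiable curve. Applying the rule to coordinate lines afterwards identifies \<open>G\<close>
  with \<open>partial_deriv\<close>; proving both at once avoids a separate differentiability theory
  for forms.\<close>

lemma form_chain_rule_aux:
  fixes f :: "real ^ 'n \<Rightarrow> real"
  assumes "f \<in> forms d"
  shows "\<exists>G. (\<forall>i. G i \<in> forms (d - 1)) \<and>
    (\<forall>\<gamma> \<gamma>' t. (\<forall>i. ((\<lambda>s. \<gamma> s $ i) has_field_derivative \<gamma>' i) (at t)) \<longrightarrow>
      ((\<lambda>s. f (\<gamma> s)) has_field_derivative (\<Sum>i\<in>UNIV. \<gamma>' i * G i (\<gamma> t))) (at t))"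
  using assms
proof (induction rule: form_induct)
  case (monomial \<alpha>)
  \<comment> \<open>If \<open>\<alpha> i = 0\<close>, truncated subtraction leaves a monomial of the
    wrong degree \<open>d\<close>, but the factor \<open>real (\<alpha> i)\<close> removes
    it.\<close>
  define G where "G i x = real (\<alpha> i) * monomial (\<alpha>(i := \<alpha> i - 1)) x" for i and x :: "real ^ 'n"
  have "G i \<in> forms (d - 1)" for i
  proof (cases "\<alpha> i = 0")
    case True
    then show ?thesis
      by (simp add: G_def[abs_def] form_zero)
  next
    case False
    have "(\<Sum>j\<in>UNIV. (\<alpha>(i := \<alpha> i - 1)) j) = (\<alpha> i - 1) + (\<Sum>j\<in>UNIV - {i}. \<alpha> j)"
      by (subst sum.remove[of UNIV i]) auto
    moreover have "d = \<alpha> i + (\<Sum>j\<in>UNIV - {i}. \<alpha> j)"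
      using monomial by (subst (asm) sum.remove[of UNIV i]) auto
    ultimately show ?thesis
      using False unfolding G_def[abs_def] by (intro form_cmult form_monomial) simp
  qed
  moreover have "((\<lambda>s. monomial \<alpha> (\<gamma> s)) has_field_derivative (\<Sum>i\<in>UNIV. \<gamma>' i * G i (\<gamma> t))) (at t)"
    if \<gamma>: "\<And>i. ((\<lambda>s. \<gamma> s $ i) has_field_derivative \<gamma>' i) (at t)" for \<gamma> \<gamma>' t
  proof -
    have "((\<lambda>s. \<Prod>i\<in>UNIV. (\<gamma> s $ i) ^ \<alpha> i) has_field_derivative
        (\<Sum>i\<in>UNIV. (real (\<alpha> i) * (\<gamma> t $ i) ^ (\<alpha> i - 1) * \<gamma>' i) * (\<Prod>j\<in>UNIV - {i}. (\<gamma> t $ j) ^ \<alpha> j))) (at t)"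
      by (rule has_field_derivative_prod) (auto intro!: derivative_eq_intros \<gamma>)
    moreover have "(real (\<alpha> i) * (\<gamma> t $ i) ^ (\<alpha> i - 1) * \<gamma>' i) * (\<Prod>j\<in>UNIV - {i}. (\<gamma> t $ j) ^ \<alpha> j)
        = \<gamma>' i * G i (\<gamma> t)" for i
    proof -
      have "monomial (\<alpha>(i := \<alpha> i - 1)) (\<gamma> t) =
          (\<gamma> t $ i) ^ (\<alpha> i - 1) * (\<Prod>j\<in>UNIV - {i}. (\<gamma> t $ j) ^ \<alpha> j)"
        unfolding monomial_def by (subst prod.remove[of UNIV i]) (auto intro!: prod.cong)
      then show ?thesis
        by (simp add: G_def mult_ac)
    qed
    ultimately show ?thesis
      unfolding monomial_def by (simp only:)
  qed
  ultimately show ?case by blast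
next
  case zero
  show ?case
    by (rule exI[of _ "\<lambda>_ _. 0"]) (simp add: form_zero)
next
  case (add f g)
  obtain F where F: "\<forall>i. F i \<in> forms (d - 1)"
    "\<forall>\<gamma> \<gamma>' t. (\<forall>i. ((\<lambda>s. \<gamma> s $ i) has_field_derivative \<gamma>' i) (at t)) \<longrightarrow>
      ((\<lambda>s. f (\<gamma> s)) has_field_derivative (\<Sum>i\<in>UNIV. \<gamma>' i * F i (\<gamma> t))) (at t)"
    using add(3) by (elim exE conjE) (rule that)
  obtain G where G: "\<forall>i. G i \<in> forms (d - 1)"
    "\<forall>\<gamma> \<gamma>' t. (\<forall>i. ((\<lambda>s. \<gamma> s $ i) has_field_derivative \<gamma>' i) (at t)) \<longrightarrow>
      ((\<lambda>s. g (\<gamma> s)) has_field_derivative (\<Sum>i\<in>UNIV. \<gamma>' i * G i (\<gamma> t))) (at t)"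
    using add(4) by (elim exE conjE) (rule that)
  show ?case
  proof (intro exI[of _ "\<lambda>i x. F i x + G i x"] conjI allI impI)
    fix \<gamma> :: "real \<Rightarrow> real ^ 'n" and \<gamma>' :: "'n \<Rightarrow> real" and t
    assume *: "\<forall>i. ((\<lambda>s. \<gamma> s $ i) has_field_derivative \<gamma>' i) (at t)"
    show "((\<lambda>s. f (\<gamma> s) + g (\<gamma> s)) has_field_derivative
        (\<Sum>i\<in>UNIV. \<gamma>' i * (F i (\<gamma> t) + G i (\<gamma> t)))) (at t)"
      using DERIV_add[OF F(2)[rule_format, of \<gamma> \<gamma>' t] G(2)[rule_format, of \<gamma> \<gamma>' t]] * by (simp add: distrib_left sum.distrib)
  qed (use F(1) G(1) in \<open>auto intro: form_add\<close>)
next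
  case (cmult c f)
  obtain F where F: "\<forall>i. F i \<in> forms (d - 1)"
    "\<forall>\<gamma> \<gamma>' t. (\<forall>i. ((\<lambda>s. \<gamma> s $ i) has_field_derivative \<gamma>' i) (at t)) \<longrightarrow>
      ((\<lambda>s. f (\<gamma> s)) has_field_derivative (\<Sum>i\<in>UNIV. \<gamma>' i * F i (\<gamma> t))) (at t)"
    using cmult(2) by (elim exE conjE) (rule that)
  show ?case
  proof (intro exI[of _ "\<lambda>i x. c * F i x"] conjI allI impI)
    fix \<gamma> :: "real \<Rightarrow> real ^ 'n" and \<gamma>' :: "'n \<Rightarrow> real" and t
    assume *: "\<forall>i. ((\<lambda>s. \<gamma> s $ i) has_field_derivative \<gamma>' i) (at t)"
    show "((\<lambda>s. c * f (\<gamma> s)) has_field_derivative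
        (\<Sum>i\<in>UNIV. \<gamma>' i * (c * F i (\<gamma> t)))) (at t)"
      using DERIV_cmult[OF F(2)[rule_format, of \<gamma> \<gamma>' t], of c] * by (simp add: sum_distrib_left mult_ac)
  qed (use F(1) in \<open>auto intro: form_cmult\<close>)
qed

lemma axis_line_has_derivative:
  "((\<lambda>s. (x + s *\<^sub>R v) $ i) has_field_derivative v $ i) (at t)" for x v :: "real ^ 'n"
  by (auto intro!: derivative_eq_intros)

lemma form_partial_deriv_and_chain_rule:
  fixes f :: "real ^ 'n \<Rightarrow> real"
  assumes f: "f \<in> forms d"
  shows form_partial_deriv: "partial_deriv i f \<in> forms (d - 1)"
    and form_chain_rule: "(\<And>i. ((\<lambda>s. \<gamma> s $ i) has_field_derivative \<gamma>' i) (at t)) \<Longrightarrow>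
      ((\<lambda>s. f (\<gamma> s)) has_field_derivative (\<Sum>i\<in>UNIV. \<gamma>' i * partial_deriv i f (\<gamma> t))) (at t)"
proof -
  obtain G where G: "\<And>i. G i \<in> forms (d - 1)"
    "\<And>\<gamma> \<gamma>' t. (\<And>i. ((\<lambda>s. \<gamma> s $ i) has_field_derivative \<gamma>' i) (at t)) \<Longrightarrow>
      ((\<lambda>s. f (\<gamma> s)) has_field_derivative (\<Sum>i\<in>UNIV. \<gamma>' i * G i (\<gamma> t))) (at t)"
    using form_chain_rule_aux[OF f] by blast
  have "partial_deriv i f x = G i x" for i x
  proof -
    have "((\<lambda>s. f (x + s *\<^sub>R axis i 1)) has_field_derivative
        (\<Sum>j\<in>UNIV. axis i 1 $ j * G j (x + 0 *\<^sub>R axis i 1))) (at 0)"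
      by (rule G(2)) (rule axis_line_has_derivative)
    also have "(\<Sum>j\<in>UNIV. axis i 1 $ j * G j (x + 0 *\<^sub>R axis i 1)) = (\<Sum>j\<in>UNIV. if j = i then G j x else 0)"
      by (rule sum.cong) (auto simp: axis_def)
    finally show ?thesis
      by (simp add: partial_deriv_def DERIV_imp_deriv)
  qed
  then have eq: "partial_deriv i f = G i" for i
    by (simp add: fun_eq_iff)
  show "partial_deriv i f \<in> forms (d - 1)"
    unfolding eq by (rule G(1))
  show "((\<lambda>s. f (\<gamma> s)) has_field_derivative (\<Sum>i\<in>UNIV. \<gamma>' i * partial_deriv i f (\<gamma> t))) (at t)"
    if "\<And>i. ((\<lambda>s. \<gamma> s $ i) has_field_derivative \<gamma>' i) (at t)"
    unfolding eq by (rule G(2)) (rule that)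
qed

lemma form_directional_derivative:
  fixes f :: "real ^ 'n \<Rightarrow> real"
  assumes f: "f \<in> forms d"
  shows "((\<lambda>s. f (x + s *\<^sub>R v)) has_field_derivative (\<Sum>i\<in>UNIV. v $ i * partial_deriv i f x)) (at 0)"
  using form_chain_rule[OF f axis_line_has_derivative, of x v 0] by simp

lemma has_partial_deriv:
  assumes "f \<in> forms d"
  shows "((\<lambda>s. f (x + s *\<^sub>R axis i 1)) has_field_derivative partial_deriv i f x) (at 0)"
proof -
  have "(\<Sum>j\<in>UNIV. axis i 1 $ j * partial_deriv j f x) = (\<Sum>j\<in>UNIV. if j = i then partial_deriv j f x else 0)"
    by (rule sum.cong) (auto simp: axis_def)
  then show ?thesis
    using form_directional_derivative[OF assms, of x "axis i 1"] by simp
qed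

lemma partial_deriv_eqI:
  "((\<lambda>s. f (x + s *\<^sub>R axis i 1)) has_field_derivative D) (at 0) \<Longrightarrow> partial_deriv i f x = D"
  by (simp add: partial_deriv_def DERIV_imp_deriv)

lemma partial_deriv_add:
  "f \<in> forms d \<Longrightarrow> g \<in> forms e \<Longrightarrow>
    partial_deriv i (\<lambda>x. f x + g x) = (\<lambda>x. partial_deriv i f x + partial_deriv i g x)"
  by (rule ext, rule partial_deriv_eqI) (intro DERIV_add has_partial_deriv)

lemma partial_deriv_cmult:
  "f \<in> forms d \<Longrightarrow> partial_deriv i (\<lambda>x. c * f x) = (\<lambda>x. c * partial_deriv i f x)"
  by (rule ext, rule partial_deriv_eqI) (intro DERIV_cmult has_partial_deriv)

lemma partial_deriv_mult:
  assumes "f \<in> forms d" "g \<in> forms e"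
  shows "partial_deriv i (\<lambda>x. f x * g x) = (\<lambda>x. partial_deriv i f x * g x + f x * partial_deriv i g x)"
proof (rule ext, rule partial_deriv_eqI)
  fix x
  show "((\<lambda>s. f (x + s *\<^sub>R axis i 1) * g (x + s *\<^sub>R axis i 1)) has_field_derivative
      partial_deriv i f x * g x + f x * partial_deriv i g x) (at 0)"
    using DERIV_mult[OF has_partial_deriv[OF assms(1), of x i] has_partial_deriv[OF assms(2), of x i]]
    by (simp add: mult.commute add.commute)
qed

lemma partial_deriv_coordinate: "partial_deriv i (\<lambda>x. x $ j) = (\<lambda>x. of_bool (i = j))"
  by (rule ext, rule partial_deriv_eqI) (auto intro!: derivative_eq_intros simp: axis_def)

lemma partial_deriv_norm_squared: "partial_deriv i (\<lambda>x :: real ^ 'n. (norm x)\<^sup>2) = (\<lambda>x. 2 * x $ i)"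
proof (rule ext, rule partial_deriv_eqI)
  fix x :: "real ^ 'n"
  have "(norm (x + s *\<^sub>R axis i 1))\<^sup>2 = (norm x)\<^sup>2 + 2 * s * x $ i + s\<^sup>2" for s
    unfolding power2_norm_eq_inner by (simp add: inner_simps inner_axis inner_commute[of "axis i 1"] power2_eq_square inner_axis_axis algebra_simps)
  then show "((\<lambda>s. (norm (x + s *\<^sub>R axis i 1))\<^sup>2) has_field_derivative 2 * x $ i) (at 0)"
    by (auto intro!: derivative_eq_intros)
qed

lemma euler_identity:
  fixes f :: "real ^ 'n \<Rightarrow> real"
  assumes f: "f \<in> forms d"
  shows "(\<Sum>i\<in>UNIV. x $ i * partial_deriv i f x) = d * f x"
proof -
  have "((\<lambda>s. f (s *\<^sub>R x)) has_field_derivative (\<Sum>i\<in>UNIV. x $ i * partial_deriv i f (1 *\<^sub>R x))) (at 1)"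
    by (rule form_chain_rule[OF f]) (auto intro!: derivative_eq_intros)
  moreover have "((\<lambda>s. f (s *\<^sub>R x)) has_field_derivative d * f x) (at 1)"
    unfolding form_homogeneous[OF f] by (auto intro!: derivative_eq_intros)
  ultimately show ?thesis
    using DERIV_unique by force
qed

lemma form_laplacian:
  assumes "f \<in> forms d"
  shows "laplacian f \<in> forms (d - 2)"
proof -
  have "(\<lambda>x. \<Sum>i\<in>UNIV. partial_deriv i (partial_deriv i f) x) \<in> forms (d - 1 - 1)"
    by (intro form_sum form_partial_deriv assms)
  then show ?thesis
    by (simp add: laplacian_def[abs_def] numeral_2_eq_2)
qed

text \<open>The cross terms of the product rule are \<open>4 (x \<bullet> grad g)\<close>, and
  Euler's identity makes them \<open>4 d g\<close>. Thus the Laplacian and multiplication by the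
  squared norm commute up to a scalar, which drives the induction on the degree in
  \<open>laplacian_upper_bound\<close>.\<close>

lemma laplacian_norm_squared_mult:
  fixes g :: "real ^ 'n \<Rightarrow> real"
  assumes g: "g \<in> forms d"
  shows "laplacian (\<lambda>x. (norm x)\<^sup>2 * g x) x =
    (2 * real CARD('n) + 4 * real d) * g x + (norm x)\<^sup>2 * laplacian g x"
proof -
  have n2: "(\<lambda>x :: real ^ 'n. (norm x)\<^sup>2) \<in> forms 2"
    using form_norm_power[of 1] by simp
  have "partial_deriv i (\<lambda>x. (norm x)\<^sup>2 * g x) = (\<lambda>x. 2 * (x $ i * g x) + (norm x)\<^sup>2 * partial_deriv i g x)" for i
    by (simp add: partial_deriv_mult[OF n2 g] partial_deriv_norm_squared mult.assoc)
  moreover have "partial_deriv i (\<lambda>x. 2 * (x $ i * g x) + (norm x)\<^sup>2 * partial_deriv i g x) x =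
      2 * (g x + x $ i * partial_deriv i g x) + (2 * x $ i * partial_deriv i g x
        + (norm x)\<^sup>2 * partial_deriv i (partial_deriv i g) x)" for i
  proof -
    have "(\<lambda>x. 2 * (x $ i * g x)) \<in> forms (1 + d)" "(\<lambda>x. (norm x)\<^sup>2 * partial_deriv i g x) \<in> forms (2 + (d - 1))"
      by (rule form_cmult[OF form_mult[OF form_coordinate g]] form_mult[OF n2 form_partial_deriv[OF g]])+
    then show ?thesis
      by (simp add: partial_deriv_add partial_deriv_cmult[OF form_mult[OF form_coordinate g]]
          partial_deriv_mult[OF form_coordinate g] partial_deriv_mult[OF n2 form_partial_deriv[OF g]]
          partial_deriv_norm_squared partial_deriv_coordinate)
  qed
  ultimately have "laplacian (\<lambda>x. (norm x)\<^sup>2 * g x) x =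
      (\<Sum>i\<in>UNIV. 2 * g x + 4 * (x $ i * partial_deriv i g x) + (norm x)\<^sup>2 * partial_deriv i (partial_deriv i g) x)"
    by (simp add: laplacian_def algebra_simps)
  also have "\<dots> = (\<Sum>i\<in>(UNIV :: 'n set). 2 * g x) + 4 * (\<Sum>i\<in>UNIV. x $ i * partial_deriv i g x)
      + (norm x)\<^sup>2 * laplacian g x"
    by (simp add: sum.distrib laplacian_def sum_distrib_left)
  also have "\<dots> = (2 * real CARD('n) + 4 * real d) * g x + (norm x)\<^sup>2 * laplacian g x"
    unfolding euler_identity[OF g] by (simp add: algebra_simps)
  finally show ?thesis .
qed

lemma form_degree_0: "f \<in> forms 0 \<Longrightarrow> f x = f y"
  using form_homogeneous[of f 0 0 x] form_homogeneous[of f 0 0 y] by simp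

section \<open>The Szego inequality\<close>

text \<open>\<open>R\<close> and \<open>I\<close> are the real and imaginary parts of
  \<open>exp (i \<alpha>) (1 + i t)^m\<close>; at \<open>t = tan \<theta>\<close> one has
  \<open>1 + i t = exp (i \<theta>) / cos \<theta>\<close>. The induction multiplies by one more
  factor \<open>1 + i t\<close>.\<close>

lemma comparison_poly_exists:
  "\<exists>R I :: real poly. degree R \<le> m \<and> degree I \<le> m \<and>
    poly R 0 = cos \<alpha> \<and> poly I 0 = sin \<alpha> \<and> poly (pderiv R) 0 = - real m * sin \<alpha> \<and>
    (\<forall>\<theta>. cos \<theta> \<noteq> 0 \<longrightarrow> poly R (tan \<theta>) * cos \<theta> ^ m = cos (real m * \<theta> + \<alpha>) \<and>
      poly I (tan \<theta>) * cos \<theta> ^ m = sin (real m * \<theta> + \<alpha>))"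
proof (induction m)
  case 0
  show ?case
    by (rule exI[of _ "[:cos \<alpha>:]"], rule exI[of _ "[:sin \<alpha>:]"]) simp
next
  case (Suc m)
  then obtain R I :: "real poly" where RI: "degree R \<le> m" "degree I \<le> m"
    "poly R 0 = cos \<alpha>" "poly I 0 = sin \<alpha>" "poly (pderiv R) 0 = - real m * sin \<alpha>"
    "\<And>\<theta>. cos \<theta> \<noteq> 0 \<Longrightarrow> poly R (tan \<theta>) * cos \<theta> ^ m = cos (real m * \<theta> + \<alpha>)"
    "\<And>\<theta>. cos \<theta> \<noteq> 0 \<Longrightarrow> poly I (tan \<theta>) * cos \<theta> ^ m = sin (real m * \<theta> + \<alpha>)"
    by blast
  have deg: "degree (pCons 0 p) \<le> Suc m" if "degree p \<le> m" for p :: "real poly"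
    using that degree_pCons_le[of 0 p] by linarith
  have trig: "poly (R - pCons 0 I) (tan \<theta>) * cos \<theta> ^ Suc m = cos (real (Suc m) * \<theta> + \<alpha>)"
    "poly (I + pCons 0 R) (tan \<theta>) * cos \<theta> ^ Suc m = sin (real (Suc m) * \<theta> + \<alpha>)"
    if c: "cos \<theta> \<noteq> 0" for \<theta>
  proof -
    have t: "tan \<theta> * cos \<theta> = sin \<theta>"
      using c by (simp add: tan_def)
    have e: "real (Suc m) * \<theta> + \<alpha> = \<theta> + (real m * \<theta> + \<alpha>)"
      by (simp add: algebra_simps)
    have "poly (R - pCons 0 I) (tan \<theta>) * cos \<theta> ^ Suc m =
        cos \<theta> * (poly R (tan \<theta>) * cos \<theta> ^ m) - (tan \<theta> * cos \<theta>) * (poly I (tan \<theta>) * cos \<theta> ^ m)"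
      by (simp add: algebra_simps)
    then show "poly (R - pCons 0 I) (tan \<theta>) * cos \<theta> ^ Suc m = cos (real (Suc m) * \<theta> + \<alpha>)"
      unfolding t RI(6,7)[OF c] e cos_add[of \<theta>] .
    have "poly (I + pCons 0 R) (tan \<theta>) * cos \<theta> ^ Suc m =
        cos \<theta> * (poly I (tan \<theta>) * cos \<theta> ^ m) + (tan \<theta> * cos \<theta>) * (poly R (tan \<theta>) * cos \<theta> ^ m)"
      by (simp add: algebra_simps)
    then show "poly (I + pCons 0 R) (tan \<theta>) * cos \<theta> ^ Suc m = sin (real (Suc m) * \<theta> + \<alpha>)"
      unfolding t RI(6,7)[OF c] e sin_add[of \<theta>] by simp
  qed
  show ?case
    by (rule exI[of _ "R - pCons 0 I"], rule exI[of _ "I + pCons 0 R"], intro conjI allI impI)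
      (use RI(1-5) deg trig in \<open>auto simp: pderiv_diff pderiv_pCons algebra_simps
        intro!: degree_diff_le degree_add_le\<close>)
qed

text \<open>The intermediate value theorem puts a root into each of the \<open>m - 1\<close> gaps
  between consecutive points.\<close>

lemma degree_lower_bound_sign_changes:
  fixes p :: "real poly"
  assumes inc: "\<And>i. Suc i < m \<Longrightarrow> t i < t (Suc i)"
    and alt: "\<And>i. i < m \<Longrightarrow> (-1) ^ i * poly p (t i) > 0"
    and "m > 0"
  shows "m \<le> Suc (degree p)"
proof -
  have "\<exists>r. t i < r \<and> r < t (Suc i) \<and> poly p r = 0" if i: "Suc i < m" for i
  proof (cases "even i")
    case True
    then show ?thesis
      using alt[of i] alt[of "Suc i"] i inc[OF i] poly_IVT_neg[of "t i" "t (Suc i)" p] by auto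
  next
    case False
    then show ?thesis
      using alt[of i] alt[of "Suc i"] i inc[OF i] poly_IVT_pos[of "t i" "t (Suc i)" p] by auto
  qed
  then obtain r where r: "\<And>i. Suc i < m \<Longrightarrow> t i < r i \<and> r i < t (Suc i) \<and> poly p (r i) = 0"
    by metis
  have t_le: "t i \<le> t j" if "i \<le> j" "j < m" for i j
    using that(1) that(2)
  proof (induction rule: dec_induct)
    case (step l)
    then show ?case
      using inc[of l] by simp
  qed simp
  have "r i < r j" if "i < j" "Suc j < m" for i j
    using r[of i] r[of j] t_le[of "Suc i" j] that by fastforce
  then have inj: "inj_on r {..<m - 1}"
    by (intro linorder_inj_onI') (auto, fastforce)
  have "p \<noteq> 0"
    using alt[of 0] \<open>m > 0\<close> by auto
  then have "card (r ` {..<m - 1}) \<le> card {x. poly p x = 0}"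
    using r by (intro card_mono poly_roots_finite) auto
  also have "\<dots> \<le> degree p"
    by (rule card_poly_roots_bound) fact
  finally show ?thesis
    using inj by (simp add: card_image)
qed

text \<open>If the inequality fails, a multiple \<open>l q\<close> with \<open>l < 1\<close> agrees
  at 0 in value and derivative with a comparison polynomial \<open>R\<close>, so
  \<open>G = R - l q\<close> has a double zero there. At \<open>2k\<close> points \<open>R\<close>
  equals \<open>(1 + t^2)^k\<close> with alternating sign while \<open>l q\<close> is strictly
  smaller in absolute value. Hence \<open>G / t^2\<close> changes sign \<open>2k - 1\<close> times,
  although its degree is at most \<open>2k - 2\<close>.\<close>

lemma szego_inequality_aux:
  fixes q :: "real poly"
  assumes k: "k > 0" and deg: "degree q \<le> 2 * k"
    and bound: "\<And>t. \<bar>poly q t\<bar> \<le> (1 + t\<^sup>2) ^ k"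
    and neg: "poly (pderiv q) 0 \<le> 0"
  shows "(poly (pderiv q) 0)\<^sup>2 + 4 * (real k)\<^sup>2 * (poly q 0)\<^sup>2 \<le> 4 * (real k)\<^sup>2"
proof (rule ccontr)
  define E where "E = (poly (pderiv q) 0)\<^sup>2 + 4 * (real k)\<^sup>2 * (poly q 0)\<^sup>2"
  assume "\<not> ?thesis"
  then have E: "E > (2 * real k)\<^sup>2"
    by (simp add: E_def power_mult_distrib)
  then have E0: "E > 0"
    by (rule le_less_trans[OF zero_le_power2])
  \<comment> \<open>Scaling by \<open>l\<close> puts the point \<open>(q 0, q' 0 / (2k))\<close>
    onto the unit circle, where it can be written as \<open>(cos \<alpha>, - sin \<alpha>)\<close>;
    the sign assumption on the derivative allows \<open>\<alpha>\<close> between 0 and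
    \<open>pi\<close>.\<close>
  define l where "l = 2 * real k / sqrt E"
  have sE: "2 * real k < sqrt E"
    using E by (rule real_less_rsqrt)
  have l: "0 < l" "l < 1"
    using sE k E0 by (auto simp: l_def divide_less_eq)
  have lE: "l\<^sup>2 * E = 4 * (real k)\<^sup>2"
    using E0 by (simp add: l_def power_divide power_mult_distrib)
  define a where "a = l * poly q 0"
  define b where "b = l * poly (pderiv q) 0 / (2 * real k)"
  have ab: "a\<^sup>2 + b\<^sup>2 = 1"
  proof -
    have "4 * (real k)\<^sup>2 * (a\<^sup>2 + b\<^sup>2) = l\<^sup>2 * E"
      using k by (simp add: a_def b_def E_def field_simps)
    then show ?thesis
      using k by (simp add: lE)
  qed
  have q0: "\<bar>poly q 0\<bar> \<le> 1"
    using bound[of 0] by simp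
  have a1: "\<bar>a\<bar> < 1"
  proof -
    have "\<bar>a\<bar> = l * \<bar>poly q 0\<bar>"
      using l by (simp add: a_def abs_mult)
    also have "\<dots> \<le> l * 1"
      using q0 l by (intro mult_left_mono) auto
    finally show ?thesis
      using l by simp
  qed
  define \<alpha> where "\<alpha> = arccos a"
  have \<alpha>: "0 < \<alpha>" "\<alpha> < pi" "cos \<alpha> = a"
    using a1 arccos_lt_bounded[of a] by (auto simp: \<alpha>_def)
  have "b \<le> 0"
    using neg l by (simp add: b_def mult_nonneg_nonpos divide_nonpos_nonneg)
  have "sin \<alpha> = - b"
  proof -
    have "sin \<alpha> > 0"
      using \<alpha> by (intro sin_gt_zero)
    moreover have "(sin \<alpha>)\<^sup>2 = (- b)\<^sup>2"
      using sin_cos_squared_add[of \<alpha>] ab \<alpha>(3) by simp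
    ultimately show ?thesis
      using \<open>b \<le> 0\<close> by (simp add: power2_eq_iff)
  qed
  obtain R :: "real poly" where R: "degree R \<le> 2 * k" "poly R 0 = cos \<alpha>"
    "poly (pderiv R) 0 = - real (2 * k) * sin \<alpha>"
    "\<And>\<theta>. cos \<theta> \<noteq> 0 \<Longrightarrow> poly R (tan \<theta>) * cos \<theta> ^ (2 * k) = cos (real (2 * k) * \<theta> + \<alpha>)"
    using comparison_poly_exists[of "2 * k" \<alpha>] by blast
  define G where "G = R - smult l q"
  have degG: "degree G \<le> 2 * k"
    unfolding G_def using R(1) deg by (intro degree_diff_le) auto
  have G0: "poly G 0 = 0" "poly (pderiv G) 0 = 0"
    using R(2,3) \<alpha>(3) \<open>sin \<alpha> = - b\<close> k
    by (simp_all add: G_def a_def b_def pderiv_diff pderiv_smult)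
  obtain G2 where G2: "G = pCons 0 (pCons 0 G2)"
  proof -
    obtain c p where p: "G = pCons c p"
      by (cases G)
    obtain c' p' where p': "p = pCons c' p'"
      by (cases p)
    show ?thesis
      using G0 that unfolding p p' by (simp add: pderiv_pCons)
  qed
  have polyG: "poly G t = t\<^sup>2 * poly G2 t" for t
    by (simp add: G2 power2_eq_square)
  \<comment> \<open>These solve \<open>2k \<theta> + \<alpha> = (i + 1 - k) pi\<close>, the extremal
    angles of the comparison function. Since \<open>0 < \<alpha> < pi\<close>, the indices below
    \<open>2k\<close> all give angles in the open interval from \<open>- pi / 2\<close> to
    \<open>pi / 2\<close>, where \<open>tan\<close> is monotone.\<close>
  define \<theta> where "\<theta> i = (real (i + 1) * pi - real k * pi - \<alpha>) / (2 * real k)" for i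
  have \<theta>: "- (pi / 2) < \<theta> i" "\<theta> i < pi / 2" if "i < 2 * k" for i
  proof -
    have "real (i + 1) * pi \<le> real (2 * k) * pi"
      using that by (intro mult_right_mono) auto
    then show "\<theta> i < pi / 2"
      using k \<alpha> by (simp add: \<theta>_def field_simps)
    have "0 \<le> real i * pi"
      by simp
    then have "- (real k * pi) < real (i + 1) * pi - real k * pi - \<alpha>"
      using \<alpha> by (simp only: of_nat_add distrib_right)
    then show "- (pi / 2) < \<theta> i"
      using k by (simp add: \<theta>_def field_simps)
  qed
  have \<theta>_mono: "\<theta> i < \<theta> (Suc i)" for i
    using k by (simp add: \<theta>_def field_simps)
  have sign: "(-1) ^ (i + 1 + k) * poly G (tan (\<theta> i)) > 0" if i: "i < 2 * k" for i
  proof -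
    define c where "c = cos (\<theta> i)"
    have c: "c > 0"
      using \<theta>[OF i] by (simp add: c_def cos_gt_zero_pi)
    have "real (2 * k) * \<theta> i + \<alpha> = real (i + 1) * pi - real k * pi"
      using k by (simp add: \<theta>_def)
    then have "cos (real (2 * k) * \<theta> i + \<alpha>) = (-1) ^ (i + 1 + k)"
      by (simp only: cos_diff cos_npi sin_npi power_add)
    then have Rc: "poly R (tan (\<theta> i)) * c ^ (2 * k) = (-1) ^ (i + 1 + k)"
      using R(4)[of "\<theta> i"] c by (simp add: c_def)
    have "1 + (tan (\<theta> i))\<^sup>2 = inverse c ^ 2"
      using c tan_sec[of "\<theta> i"] by (simp add: c_def)
    then have "(1 + (tan (\<theta> i))\<^sup>2) ^ k * c ^ (2 * k) = 1"
      using c by (simp add: power_mult[symmetric] power_inverse)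
    moreover have "\<bar>poly q (tan (\<theta> i))\<bar> * c ^ (2 * k) \<le> (1 + (tan (\<theta> i))\<^sup>2) ^ k * c ^ (2 * k)"
      using bound c by (intro mult_right_mono) auto
    ultimately have "l * (\<bar>poly q (tan (\<theta> i))\<bar> * c ^ (2 * k)) \<le> l * 1"
      using l by (intro mult_left_mono) auto
    then have "l * (\<bar>poly q (tan (\<theta> i))\<bar> * c ^ (2 * k)) < 1"
      using l(2) by linarith
    then have "\<bar>(-1) ^ (i + 1 + k) * (l * poly q (tan (\<theta> i)) * c ^ (2 * k))\<bar> < 1"
      using l c by (simp add: abs_mult mult.assoc)
    then have "0 < 1 - (-1) ^ (i + 1 + k) * (l * poly q (tan (\<theta> i)) * c ^ (2 * k))"
      by linarith
    also have "\<dots> = (-1) ^ (i + 1 + k) * (poly R (tan (\<theta> i)) * c ^ (2 * k))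
        - (-1) ^ (i + 1 + k) * (l * poly q (tan (\<theta> i)) * c ^ (2 * k))"
      unfolding Rc by (simp flip: power_add power_mult_distrib)
    also have "\<dots> = ((-1) ^ (i + 1 + k) * poly G (tan (\<theta> i))) * c ^ (2 * k)"
      by (simp add: G_def algebra_simps)
    finally show ?thesis
      using c by (rule_tac zero_less_mult_pos2[of _ "c ^ (2 * k)"]) simp_all
  qed
  have "2 * k \<le> Suc (degree (smult ((-1) ^ (k + 1)) G2))"
  proof (rule degree_lower_bound_sign_changes[where t = "\<lambda>i. tan (\<theta> i)"])
    show "tan (\<theta> i) < tan (\<theta> (Suc i))" if "Suc i < 2 * k" for i
      using \<theta>[of i] \<theta>[of "Suc i"] \<theta>_mono[of i] that by (intro tan_monotone) auto
    show "(-1) ^ i * poly (smult ((-1) ^ (k + 1)) G2) (tan (\<theta> i)) > 0" if "i < 2 * k" for i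
    proof -
      have "(tan (\<theta> i))\<^sup>2 * ((-1) ^ i * poly (smult ((-1) ^ (k + 1)) G2) (tan (\<theta> i))) > 0"
        using sign[OF that] by (simp add: polyG power_add mult_ac)
      moreover have "(tan (\<theta> i))\<^sup>2 > 0"
        using sign[OF that] by (auto simp: polyG)
      ultimately show ?thesis
        by (rule zero_less_mult_pos)
    qed
  qed (use k in simp)
  moreover have "G2 \<noteq> 0"
    using sign[of 0] k by (auto simp: polyG)
  then have "degree G = Suc (Suc (degree G2))"
    by (simp add: G2)
  ultimately show False
    using degG by simp
qed

text \<open>This is Szego's inequality \<open>F'^2 + (2k)^2 F^2 \<le> (2k)^2\<close> at 0 for the
  trigonometric polynomial \<open>F \<theta> = q (tan \<theta>) (cos \<theta>)^(2k)\<close>, which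
  the hypothesis bounds by 1. Replacing \<open>q\<close> by \<open>- q\<close> fixes the sign of the
  derivative.\<close>

lemma szego_inequality:
  fixes q :: "real poly"
  assumes k: "k > 0" and deg: "degree q \<le> 2 * k"
    and bound: "\<And>t. \<bar>poly q t\<bar> \<le> (1 + t\<^sup>2) ^ k"
  shows "(poly (pderiv q) 0)\<^sup>2 + 4 * (real k)\<^sup>2 * (poly q 0)\<^sup>2 \<le> 4 * (real k)\<^sup>2"
proof (cases "poly (pderiv q) 0 \<le> 0")
  case True
  then show ?thesis
    using szego_inequality_aux assms by blast
next
  case False
  then show ?thesis
    using szego_inequality_aux[of k "- q"] assms by (simp add: pderiv_minus)
qed

section \<open>The Prekopa-Leindler inequality\<close>

text \<open>Every value \<open>y\<close> is the length of the set of \<open>t > 0\<close> below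
  \<open>y\<close>; integrate over \<open>M\<close> and exchange the integrals.\<close>

lemma nn_integral_layer_cake:
  assumes "sigma_finite_measure M" and [measurable]: "f \<in> borel_measurable M"
  shows "(\<integral>\<^sup>+x. f x \<partial>M) =
    (\<integral>\<^sup>+t. indicator {0<..} t * emeasure M {x \<in> space M. ennreal t < f x} \<partial>lborel)"
proof -
  interpret sigma_finite_measure M by fact
  interpret pair_sigma_finite M "lborel :: real measure" ..
  have pt: "y = (\<integral>\<^sup>+t. indicator {0<..} t * indicator {t. ennreal t < y} t \<partial>lborel)" for y
  proof (cases y)
    case (real r)
    have "(\<integral>\<^sup>+t. indicator {0<..} t * indicator {t. ennreal t < y} t \<partial>lborel) =
        (\<integral>\<^sup>+t. indicator {0<..<r} t \<partial>lborel)"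
      using real by (intro nn_integral_cong) (auto simp: indicator_def ennreal_less_iff)
    then show ?thesis
      using real by simp
  next
    case top
    have "(\<integral>\<^sup>+t. indicator {0<..} t * indicator {t. ennreal t < y} t \<partial>lborel) =
        emeasure lborel {0::real<..}"
      using top by (simp add: nn_integral_indicator[symmetric] del: nn_integral_indicator)
    moreover have "ennreal (real n) \<le> emeasure lborel {0::real<..}" for n
    proof -
      have "ennreal (real n) = emeasure lborel {0<..<real n}"
        by simp
      also have "\<dots> \<le> emeasure lborel {0::real<..}"
        by (rule emeasure_mono) auto
      finally show ?thesis .
    qed
    then have "emeasure lborel {0::real<..} = top"
      by (metis ennreal_of_nat_eq_real_of_nat ennreal_Ex_less_of_nat less_top not_le)
    ultimately show ?thesis
      using top by simp
  qed
  have "(\<integral>\<^sup>+x. f x \<partial>M) = (\<integral>\<^sup>+x. \<integral>\<^sup>+t. indicator {0<..} t * indicator {t. ennreal t < f x} t \<partial>lborel \<partial>M)"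
    by (rule nn_integral_cong) (rule pt)
  also have "\<dots> = (\<integral>\<^sup>+t. \<integral>\<^sup>+x. indicator {0<..} t * indicator {t. ennreal t < f x} t \<partial>M \<partial>lborel)"
    by (rule Fubini'[symmetric]) (simp add: indicator_def)
  also have "\<dots> = (\<integral>\<^sup>+t. indicator {0<..} t * emeasure M {x \<in> space M. ennreal t < f x} \<partial>lborel)"
  proof (rule nn_integral_cong)
    fix t :: real
    have "(\<integral>\<^sup>+x. indicator {0<..} t * indicator {t. ennreal t < f x} t \<partial>M) =
        indicator {0<..} t * (\<integral>\<^sup>+x. indicator {x \<in> space M. ennreal t < f x} x \<partial>M)"
      by (subst nn_integral_cmult[symmetric]) (auto intro!: nn_integral_cong simp: indicator_def)
    then show "(\<integral>\<^sup>+x. indicator {0<..} t * indicator {t. ennreal t < f x} t \<partial>M) =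
        indicator {0<..} t * emeasure M {x \<in> space M. ennreal t < f x}"
      by simp
  qed
  finally show ?thesis .
qed

text \<open>With \<open>a\<close> the largest point of \<open>A\<close> and \<open>b\<close> the
  least point of \<open>B\<close>, the translates \<open>A + b\<close> and \<open>a + B\<close> meet
  at most in \<open>a + b\<close>, and half of each lies in \<open>C\<close>. So their measures add
  up.\<close>

lemma brunn_minkowski_real_compact:
  fixes A B C :: "real set"
  assumes A: "compact A" "A \<noteq> {}" and B: "compact B" "B \<noteq> {}" and C: "C \<in> sets borel"
    and mid: "\<And>x y. x \<in> A \<Longrightarrow> y \<in> B \<Longrightarrow> (x + y) / 2 \<in> C"
  shows "emeasure lborel A + emeasure lborel B \<le> 2 * emeasure lborel C"
proof -
  have [measurable]: "A \<in> sets borel" "B \<in> sets borel"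
    using A B by (auto intro: borel_compact)
  obtain a where a: "a \<in> A" "\<And>x. x \<in> A \<Longrightarrow> x \<le> a"
    using compact_attains_sup[OF A] by blast
  obtain b where b: "b \<in> B" "\<And>y. y \<in> B \<Longrightarrow> b \<le> y"
    using compact_attains_inf[OF B] by blast
  have half: "emeasure lborel X = 2 * emeasure lborel {z. - c + 2 * z \<in> X}"
    if [measurable]: "X \<in> sets borel" for X and c :: real
  proof -
    have "{z. - c + 2 * z \<in> X} \<in> sets lborel"
      by measurable
    then have "(\<integral>\<^sup>+z. indicator {z. - c + 2 * z \<in> X} z \<partial>lborel) = emeasure lborel {z. - c + 2 * z \<in> X}"
      by (rule nn_integral_indicator)
    moreover have "indicator {z. - c + 2 * z \<in> X} z = (indicator X (- c + 2 * z) :: ennreal)" for z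
      by (simp add: indicator_def)
    ultimately have "(\<integral>\<^sup>+z. indicator X (- c + 2 * z) \<partial>lborel) = emeasure lborel {z. - c + 2 * z \<in> X}"
      by (simp only:)
    then show ?thesis
      using nn_integral_real_affine[of "indicator X" 2 "- c"] by simp
  qed
  define A' where "A' = {z. - b + 2 * z \<in> A}"
  define B' where "B' = {z. - a + 2 * z \<in> B}"
  have [measurable]: "A' \<in> sets borel" "B' \<in> sets borel"
    unfolding A'_def B'_def by measurable
  have "A' \<inter> B' \<subseteq> {(a + b) / 2}"
  proof
    fix z
    assume "z \<in> A' \<inter> B'"
    then have "- b + 2 * z \<le> a" "b \<le> - a + 2 * z"
      using a(2) b(2) by (auto simp: A'_def B'_def)
    then show "z \<in> {(a + b) / 2}"
      by simp
  qed
  then have "emeasure lborel (A' \<inter> B') \<le> emeasure lborel {(a + b) / 2}"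
    by (intro emeasure_mono) auto
  then have "emeasure lborel A' + emeasure lborel B' = emeasure lborel (A' \<union> B')"
    by (subst emeasure_Un_Int) auto
  also have "\<dots> \<le> emeasure lborel C"
  proof (rule emeasure_mono)
    show "A' \<union> B' \<subseteq> C"
      using mid[of _ b] mid[of a] a(1) b(1) by (force simp: A'_def B'_def)
  qed (use C in simp)
  finally have "2 * (emeasure lborel A' + emeasure lborel B') \<le> 2 * emeasure lborel C"
    by (rule mult_left_mono) simp
  moreover have "emeasure lborel A = 2 * emeasure lborel A'" "emeasure lborel B = 2 * emeasure lborel B'"
    unfolding A'_def B'_def by (rule half; measurable)+
  ultimately show ?thesis
    by (simp only: distrib_left)
qed

lemma brunn_minkowski_real:
  fixes A B C :: "real set"
  assumes A: "A \<in> sets borel" "A \<noteq> {}" and B: "B \<in> sets borel" "B \<noteq> {}" and C: "C \<in> sets borel"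
    and mid: "\<And>x y. x \<in> A \<Longrightarrow> y \<in> B \<Longrightarrow> (x + y) / 2 \<in> C"
  shows "emeasure lborel A + emeasure lborel B \<le> 2 * emeasure lborel C"
proof -
  have closed: "emeasure lborel T + emeasure lborel U \<le> 2 * emeasure lborel C"
    if T: "closed T" "T \<subseteq> A" "T \<noteq> {}" and U: "closed U" "U \<subseteq> B" "U \<noteq> {}" for T U
  proof -
    have lim: "(\<lambda>m. emeasure lborel (X \<inter> {- real m..real m})) \<longlonglongrightarrow> emeasure lborel X"
      if "closed X" for X
    proof -
      have "(\<Union>m. X \<inter> {- real m..real m}) = X"
      proof (intro equalityI subsetI)
        fix x
        assume "x \<in> X"
        moreover obtain m where "\<bar>x\<bar> \<le> real m"
          using real_arch_simple by blast
        ultimately have "x \<in> X \<inter> {- real m..real m}"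
          by auto
        then show "x \<in> (\<Union>m. X \<inter> {- real m..real m})"
          by blast
      qed auto
      moreover have "range (\<lambda>m. X \<inter> {- real m..real m}) \<subseteq> sets lborel" "incseq (\<lambda>m. X \<inter> {- real m..real m})"
        using that by (auto simp: incseq_def)
      ultimately show ?thesis
        using Lim_emeasure_incseq[of "\<lambda>m. X \<inter> {- real m..real m}" lborel] by (simp only:)
    qed
    obtain x y where xy: "x \<in> T" "y \<in> U"
      using T U by blast
    obtain m0 where m0: "\<bar>x\<bar> + \<bar>y\<bar> \<le> real m0"
      using real_arch_simple by blast
    have "emeasure lborel (T \<inter> {- real m..real m}) + emeasure lborel (U \<inter> {- real m..real m})
        \<le> 2 * emeasure lborel C" if "m \<ge> m0" for m
    proof (rule brunn_minkowski_real_compact)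
      have "\<bar>x\<bar> + \<bar>y\<bar> \<le> real m"
        using m0 that by simp
      then have "x \<in> T \<inter> {- real m..real m}" "y \<in> U \<inter> {- real m..real m}"
        using xy by auto
      then show "T \<inter> {- real m..real m} \<noteq> {}" "U \<inter> {- real m..real m} \<noteq> {}"
        by blast+
    qed (use T U C mid in \<open>auto intro: closed_Int_compact\<close>)
    then show ?thesis
      by (intro LIMSEQ_le_const2[OF tendsto_add[OF lim[OF T(1)] lim[OF U(1)]]]) blast
  qed
  have inner: "\<exists>T. closed T \<and> T \<subseteq> X \<and> T \<noteq> {} \<and> emeasure lborel X \<le> emeasure lborel T + ennreal e"
    if X: "X \<in> sets borel" "X \<noteq> {}" and e: "e > 0" for X :: "real set" and e :: real
  proof -
    obtain x where x: "x \<in> X"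
      using X by blast
    obtain T where T: "closed T" "T \<subseteq> X" "emeasure lebesgue (X - T) < ennreal e"
      by (rule sets_lebesgue_inner_closed[OF _ e, of X]) (use X in simp)
    \<comment> \<open>The closed set \<open>T\<close> may be empty, for instance if \<open>X\<close>
      is a null set; adding one point of \<open>X\<close> keeps it closed and makes it
      nonempty.\<close>
    have "emeasure lborel X \<le> emeasure lborel (insert x T \<union> (X - T))"
      using X T by (intro emeasure_mono) auto
    also have "\<dots> \<le> emeasure lborel (insert x T) + emeasure lborel (X - T)"
      using X T by (intro emeasure_subadditive) auto
    also have "\<dots> \<le> emeasure lborel (insert x T) + ennreal e"
      using T X by (intro add_left_mono) (auto simp: less_imp_le)
    finally show ?thesis
      using x T by (intro exI[of _ "insert x T"]) auto
  qed
  show ?thesis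
  proof (rule ennreal_le_epsilon)
    fix e :: real
    assume "e > 0"
    obtain T U where T: "closed T" "T \<subseteq> A" "T \<noteq> {}" "emeasure lborel A \<le> emeasure lborel T + ennreal (e / 2)"
      and U: "closed U" "U \<subseteq> B" "U \<noteq> {}" "emeasure lborel B \<le> emeasure lborel U + ennreal (e / 2)"
      using inner[OF A, of "e / 2"] inner[OF B, of "e / 2"] \<open>e > 0\<close> by auto
    have "emeasure lborel A + emeasure lborel B \<le>
        (emeasure lborel T + ennreal (e / 2)) + (emeasure lborel U + ennreal (e / 2))"
      using T U by (intro add_mono) auto
    also have "\<dots> = (emeasure lborel T + emeasure lborel U) + ennreal e"
      using \<open>e > 0\<close> by (simp add: ac_simps flip: ennreal_plus)
    also have "\<dots> \<le> 2 * emeasure lborel C + ennreal e"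
      using closed[OF T(1-3) U(1-3)] by (intro add_right_mono)
    finally show "emeasure lborel A + emeasure lborel B \<le> 2 * emeasure lborel C + ennreal e" .
  qed
qed

text \<open>Because both suprema are 1, for \<open>0 < t < 1\<close> the superlevel sets of
  \<open>f\<close> and \<open>g\<close> at \<open>t\<close> are nonempty and their midpoints lie in
  that of \<open>h\<close>. The one-dimensional Brunn-Minkowski inequality can then be integrated
  over the levels. The conclusion is additive.\<close>

lemma prekopa_leindler_normalized:
  fixes f g :: "real \<Rightarrow> real" and h :: "real \<Rightarrow> ennreal"
  assumes [measurable]: "f \<in> borel_measurable borel" "g \<in> borel_measurable borel" "h \<in> borel_measurable borel"
    and f: "\<And>x. 0 \<le> f x" "\<And>x. f x \<le> 1" "\<And>t. t < 1 \<Longrightarrow> \<exists>x. t < f x"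
    and g: "\<And>x. 0 \<le> g x" "\<And>x. g x \<le> 1" "\<And>t. t < 1 \<Longrightarrow> \<exists>x. t < g x"
    and mid: "\<And>x y. ennreal (f x * g y) \<le> h ((x + y) / 2) ^ 2"
  shows "(\<integral>\<^sup>+x. f x \<partial>lborel) + (\<integral>\<^sup>+x. g x \<partial>lborel) \<le> 2 * (\<integral>\<^sup>+x. h x \<partial>lborel)"
proof -
  define I where "I = (indicator {0<..<1} :: real \<Rightarrow> ennreal)"
  have I [measurable]: "I \<in> borel_measurable borel"
    by (simp add: I_def)
  have cake: "(\<integral>\<^sup>+x. ennreal (u x) \<partial>lborel) = (\<integral>\<^sup>+t. I t * emeasure lborel {x. t < u x} \<partial>lborel)"
    if [measurable]: "u \<in> borel_measurable borel" and u: "\<And>x. 0 \<le> u x" "\<And>x. u x \<le> 1" for u :: "real \<Rightarrow> real"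
  proof -
    have "(\<integral>\<^sup>+x. ennreal (u x) \<partial>lborel) =
        (\<integral>\<^sup>+t. indicator {0<..} t * emeasure lborel {x \<in> space lborel. ennreal t < ennreal (u x)} \<partial>lborel)"
      by (rule nn_integral_layer_cake) (simp_all add: sigma_finite_lborel)
    also have "\<dots> = (\<integral>\<^sup>+t. I t * emeasure lborel {x. t < u x} \<partial>lborel)"
    proof (rule nn_integral_cong)
      fix t :: real
      have "{x. t < u x} = {}" if "t \<ge> 1"
        using that u(2) by (force simp: not_less intro: order_trans)
      then show "indicator {0<..} t * emeasure lborel {x \<in> space lborel. ennreal t < ennreal (u x)} =
          I t * emeasure lborel {x. t < u x}"
        using u by (cases "t \<ge> 1") (auto simp: I_def indicator_def ennreal_less_iff)
    qed
    finally show ?thesis .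
  qed
  have meas: "(\<lambda>t. emeasure lborel {x. t < u x}) \<in> borel_measurable borel"
    if [measurable]: "u \<in> borel_measurable borel" for u :: "real \<Rightarrow> real"
  proof -
    have "(\<lambda>t. emeasure lborel {x \<in> space lborel. t < u x}) \<in> borel_measurable borel"
      by (rule lborel.measurable_emeasure) measurable
    then show ?thesis by simp
  qed
  have meas': "(\<lambda>t. emeasure lborel {x. ennreal t < h x}) \<in> borel_measurable borel"
  proof -
    have "(\<lambda>t. emeasure lborel {x \<in> space lborel. ennreal t < h x}) \<in> borel_measurable borel"
      by (rule lborel.measurable_emeasure) measurable
    then show ?thesis by simp
  qed
  have "(\<integral>\<^sup>+x. f x \<partial>lborel) + (\<integral>\<^sup>+x. g x \<partial>lborel) =
      (\<integral>\<^sup>+t. I t * (emeasure lborel {x. t < f x} + emeasure lborel {x. t < g x}) \<partial>lborel)"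
    using f g meas[of f] meas[of g]
    by (simp add: cake nn_integral_add distrib_left)
  also have "\<dots> \<le> (\<integral>\<^sup>+t. 2 * (indicator {0<..} t * emeasure lborel {x \<in> space lborel. ennreal t < h x}) \<partial>lborel)"
  proof (rule nn_integral_mono)
    fix t :: real
    show "I t * (emeasure lborel {x. t < f x} + emeasure lborel {x. t < g x}) \<le>
        2 * (indicator {0<..} t * emeasure lborel {x \<in> space lborel. ennreal t < h x})"
    proof (cases "0 < t \<and> t < 1")
      case True
      have "emeasure lborel {x. t < f x} + emeasure lborel {x. t < g x} \<le> 2 * emeasure lborel {x. ennreal t < h x}"
      proof (rule brunn_minkowski_real)
        fix x y
        assume xy: "x \<in> {x. t < f x}" "y \<in> {x. t < g x}"
        show "(x + y) / 2 \<in> {x. ennreal t < h x}"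
        proof (rule ccontr)
          assume "\<not> ?thesis"
          then have "h ((x + y) / 2) ^ 2 \<le> ennreal t ^ 2"
            by (intro power_mono) auto
          then have "ennreal (f x * g y) \<le> ennreal (t ^ 2)"
            using True by (intro order_trans[OF mid[of x y]]) (simp add: ennreal_power)
          then have "f x * g y \<le> t * t"
            by (simp add: power2_eq_square)
          moreover have "t * t < f x * g y"
            using xy True by (intro mult_strict_mono) auto
          ultimately show False
            by simp
        qed
      qed (use True f(3)[of t] g(3)[of t] in auto)
      then show ?thesis
        using True by (simp add: I_def)
    qed (auto simp: I_def)
  qed
  also have "\<dots> = 2 * (\<integral>\<^sup>+t. indicator {0<..} t * emeasure lborel {x \<in> space lborel. ennreal t < h x} \<partial>lborel)"
    using meas' by (intro nn_integral_cmult) simp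
  also have "\<dots> = 2 * (\<integral>\<^sup>+x. h x \<partial>lborel)"
    by (subst nn_integral_layer_cake[of lborel h]) (simp_all add: sigma_finite_lborel)
  finally show ?thesis .
qed

text \<open>Dividing \<open>f\<close> and \<open>g\<close> by their suprema \<open>a\<close>,
  \<open>b\<close> and \<open>h\<close> by \<open>sqrt (a b)\<close> reduces to the normalized case;
  the arithmetic-geometric mean inequality turns the resulting sum into the product.\<close>

lemma prekopa_leindler_bounded:
  fixes f g :: "real \<Rightarrow> real" and h :: "real \<Rightarrow> ennreal"
  assumes [measurable]: "f \<in> borel_measurable borel" "g \<in> borel_measurable borel" "h \<in> borel_measurable borel"
    and f: "\<And>x. 0 \<le> f x" "bdd_above (range f)"
    and g: "\<And>x. 0 \<le> g x" "bdd_above (range g)"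
    and mid: "\<And>x y. ennreal (f x * g y) \<le> h ((x + y) / 2) ^ 2"
  shows "(\<integral>\<^sup>+x. f x \<partial>lborel) * (\<integral>\<^sup>+x. g x \<partial>lborel) \<le> (\<integral>\<^sup>+x. h x \<partial>lborel) ^ 2"
proof (cases "(\<forall>x. f x = 0) \<or> (\<forall>x. g x = 0)")
  case True
  then show ?thesis by auto
next
  case False
  define a where "a = Sup (range f)"
  define b where "b = Sup (range g)"
  have le: "f x \<le> a" "g x \<le> b" for x
    using f g by (auto simp: a_def b_def intro: cSup_upper)
  obtain x y where "f x \<noteq> 0" "g y \<noteq> 0"
    using False by blast
  then have "f x > 0" "g y > 0"
    using f(1)[of x] g(1)[of y] by auto
  then have ab: "a > 0" "b > 0"
    using le(1)[of x] le(2)[of y] by linarith+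
  define s where "s = sqrt (a * b)"
  have s: "s > 0" "s * s = a * b"
    using ab by (auto simp: s_def)
  have ex: "\<exists>x. t < u x / c" if "t < 1" "c = Sup (range u)" "c > 0" for t c and u :: "real \<Rightarrow> real"
  proof -
    have "t * c < Sup (range u)"
      using that by simp
    then obtain x where "t * c < u x"
      using less_cSupE[of "t * c" "range u"] by blast
    then show ?thesis
      using that(3) by (auto simp: less_divide_eq)
  qed
  have norm: "(\<integral>\<^sup>+x. f x / a \<partial>lborel) + (\<integral>\<^sup>+x. g x / b \<partial>lborel) \<le>
      2 * (\<integral>\<^sup>+x. h x * ennreal (1 / s) \<partial>lborel)"
  proof (rule prekopa_leindler_normalized)
    fix x y
    have "ennreal (f x / a * (g y / b)) = ennreal (f x * g y) * ennreal (1 / s) ^ 2"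
      using f g s ab by (simp add: ennreal_power ennreal_mult[symmetric] power2_eq_square)
    also have "\<dots> \<le> h ((x + y) / 2) ^ 2 * ennreal (1 / s) ^ 2"
      using mid by (intro mult_right_mono) auto
    finally show "ennreal (f x / a * (g y / b)) \<le> (h ((x + y) / 2) * ennreal (1 / s)) ^ 2"
      by (simp add: power_mult_distrib)
  qed (use f g ab le ex[of _ a f] ex[of _ b g] in \<open>auto simp: a_def b_def\<close>)
  define F where "F = (\<integral>\<^sup>+x. f x \<partial>lborel)"
  define G where "G = (\<integral>\<^sup>+x. g x \<partial>lborel)"
  define H where "H = (\<integral>\<^sup>+x. h x \<partial>lborel)"
  have scale: "(\<integral>\<^sup>+x. ennreal (u x / c) \<partial>lborel) = ennreal (1 / c) * (\<integral>\<^sup>+x. u x \<partial>lborel)"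
    if [measurable]: "u \<in> borel_measurable borel" and "c > 0" "\<And>x. 0 \<le> u x" for u :: "real \<Rightarrow> real" and c
    using that by (subst nn_integral_cmult[symmetric]) (auto simp: ennreal_mult[symmetric] intro!: nn_integral_cong)
  have ineq: "ennreal (1 / a) * F + ennreal (1 / b) * G \<le> 2 * (H * ennreal (1 / s))"
    using norm f g ab scale[of f a] scale[of g b] by (simp add: F_def G_def H_def nn_integral_multc)
  show ?thesis
  proof (cases "H = top")
    case True
    then show ?thesis
      by (simp add: H_def ennreal_top_eq_mult_iff power2_eq_square)
  next
    case False
    then have fin: "ennreal (1 / a) * F + ennreal (1 / b) * G < top"
      by (intro le_less_trans[OF ineq]) (auto simp: ennreal_mult_less_top less_top)
    then have "F < top" "G < top"
      using ab by (auto simp: ennreal_mult_less_top)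
    then obtain u v w where uvw: "F = ennreal u" "u \<ge> 0" "G = ennreal v" "v \<ge> 0" "H = ennreal w" "w \<ge> 0"
      using False by (metis ennreal_cases less_top)
    have "u / a + v / b \<le> 2 * (w / s)"
      using ineq ab s uvw
      by (simp add: ennreal_mult[symmetric] ennreal_plus[symmetric] del: ennreal_plus
          flip: ennreal_numeral)
    then have "(u / a + v / b) * (a * b) \<le> 2 * (w / s) * (a * b)"
      using ab by (intro mult_right_mono) auto
    moreover have "(u / a + v / b) * (a * b) = u * b + v * a"
      using ab by (simp add: field_simps)
    moreover have "2 * (w / s) * (a * b) = 2 * w * s"
      unfolding s(2)[symmetric] using s(1) by simp
    ultimately have "u * b + v * a \<le> 2 * w * s"
      by simp
    then have "(u * b + v * a)\<^sup>2 \<le> (2 * w * s)\<^sup>2"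
      using uvw ab s by (intro power_mono) auto
    moreover have "4 * (u * v) * (a * b) \<le> (u * b + v * a)\<^sup>2"
      using zero_le_power2[of "u * b - v * a"] by (simp add: power2_eq_square algebra_simps)
    moreover have "(2 * w * s)\<^sup>2 = 4 * (w * w) * (a * b)"
      unfolding s(2)[symmetric] by (simp add: power2_eq_square)
    ultimately have "4 * (u * v) * (a * b) \<le> 4 * (w * w) * (a * b)"
      by linarith
    then have "u * v \<le> w * w"
      using ab by (simp add: mult_le_cancel_right)
    then show ?thesis
      using uvw unfolding F_def[symmetric] G_def[symmetric] H_def[symmetric]
      by (simp add: ennreal_mult[symmetric] ennreal_power power2_eq_square)
  qed
qed

text \<open>Truncating \<open>f\<close> and \<open>g\<close> from above preserves the hypothesis on
  \<open>h\<close>, and monotone convergence removes the truncation of each factor in turn.\<close>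

lemma prekopa_leindler_real:
  fixes f g h :: "real \<Rightarrow> ennreal"
  assumes [measurable]: "f \<in> borel_measurable borel" "g \<in> borel_measurable borel" "h \<in> borel_measurable borel"
    and mid: "\<And>x y. f x * g y \<le> h ((x + y) / 2) ^ 2"
  shows "(\<integral>\<^sup>+x. f x \<partial>lborel) * (\<integral>\<^sup>+x. g x \<partial>lborel) \<le> (\<integral>\<^sup>+x. h x \<partial>lborel) ^ 2"
proof -
  define tr where "tr m y = min y (of_nat m)" for m :: nat and y :: ennreal
  have tr_meas [measurable]: "tr m \<in> borel_measurable borel" for m
    unfolding tr_def by measurable
  have tr_real: "ennreal (enn2real (tr m y)) = tr m y" for m y
    by (simp add: tr_def min_less_iff_disj of_nat_less_top)
  have tr_le: "enn2real (tr m y) \<le> real m" for m y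
    by (rule enn2real_leI) (simp_all add: tr_def flip: ennreal_of_nat_eq_real_of_nat)
  have part: "(\<integral>\<^sup>+x. tr m (f x) \<partial>lborel) * (\<integral>\<^sup>+x. tr l (g x) \<partial>lborel) \<le> (\<integral>\<^sup>+x. h x \<partial>lborel) ^ 2" for m l
  proof -
    have "(\<integral>\<^sup>+x. ennreal (enn2real (tr m (f x))) \<partial>lborel) * (\<integral>\<^sup>+x. ennreal (enn2real (tr l (g x))) \<partial>lborel)
        \<le> (\<integral>\<^sup>+x. h x \<partial>lborel) ^ 2"
    proof (rule prekopa_leindler_bounded)
      fix x y
      have "ennreal (enn2real (tr m (f x)) * enn2real (tr l (g y))) = tr m (f x) * tr l (g y)"
        by (simp add: ennreal_mult tr_real)
      also have "\<dots> \<le> f x * g y"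
        by (intro mult_mono) (auto simp: tr_def)
      finally show "ennreal (enn2real (tr m (f x)) * enn2real (tr l (g y))) \<le> h ((x + y) / 2) ^ 2"
        using mid[of x y] by simp
    qed (auto intro!: bdd_aboveI2 tr_le)
    then show ?thesis
      by (simp only: tr_real)
  qed
  have sup: "(SUP m. \<integral>\<^sup>+x. tr m (u x) \<partial>lborel) = (\<integral>\<^sup>+x. u x \<partial>lborel)"
    if [measurable]: "u \<in> borel_measurable borel" for u :: "real \<Rightarrow> ennreal"
  proof -
    have "(SUP m. tr m y) = y" for y
    proof (rule antisym)
      show "(SUP m. tr m y) \<le> y"
        by (rule SUP_least) (simp add: tr_def)
      have "(SUP m. min y (of_nat m)) = min y (SUP m. of_nat m)"
        by (simp add: inf_SUP flip: inf_min)
      then show "y \<le> (SUP m. tr m y)"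
        by (simp add: tr_def ennreal_SUP_of_nat_eq_top)
    qed
    then have "(\<integral>\<^sup>+x. u x \<partial>lborel) = (\<integral>\<^sup>+x. (SUP m. tr m (u x)) \<partial>lborel)"
      by simp
    also have "\<dots> = (SUP m. \<integral>\<^sup>+x. tr m (u x) \<partial>lborel)"
      by (rule nn_integral_monotone_convergence_SUP)
        (auto simp: incseq_def le_fun_def tr_def intro: min.coboundedI2)
    finally show ?thesis ..
  qed
  have "(\<integral>\<^sup>+x. tr m (f x) \<partial>lborel) * (\<integral>\<^sup>+x. g x \<partial>lborel) \<le> (\<integral>\<^sup>+x. h x \<partial>lborel) ^ 2" for m
    unfolding sup[of g, symmetric, simplified] SUP_mult_left_ennreal by (intro SUP_least part)
  then show ?thesis
    unfolding sup[of f, symmetric, simplified] mult.commute[of "Sup _"] SUP_mult_left_ennreal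
    by (intro SUP_least) (simp add: mult.commute)
qed

text \<open>By the induction hypothesis, the integrals over the fibres of one coordinate satisfy the
  hypothesis of the real case as functions of that coordinate.\<close>

lemma prekopa_leindler_PiM:
  fixes f g h :: "('i \<Rightarrow> real) \<Rightarrow> ennreal"
  assumes "finite I"
    and "f \<in> borel_measurable (PiM I (\<lambda>_. lborel))" "g \<in> borel_measurable (PiM I (\<lambda>_. lborel))"
      "h \<in> borel_measurable (PiM I (\<lambda>_. lborel))"
    and "\<And>x y. x \<in> space (PiM I (\<lambda>_. lborel)) \<Longrightarrow> y \<in> space (PiM I (\<lambda>_. lborel)) \<Longrightarrow>
      f x * g y \<le> h (\<lambda>i\<in>I. (x i + y i) / 2) ^ 2"
  shows "(\<integral>\<^sup>+x. f x \<partial>PiM I (\<lambda>_. lborel)) * (\<integral>\<^sup>+x. g x \<partial>PiM I (\<lambda>_. lborel)) \<le>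
    (\<integral>\<^sup>+x. h x \<partial>PiM I (\<lambda>_. lborel)) ^ 2"
  using assms
proof (induction I arbitrary: f g h rule: finite_induct)
  case empty
  interpret product_sigma_finite "\<lambda>_. lborel :: real measure" ..
  show ?case
    using empty(4)[of "\<lambda>_. undefined" "\<lambda>_. undefined"] by (simp add: nn_integral_empty space_PiM restrict_def)
next
  case (insert i I)
  interpret product_sigma_finite "\<lambda>_. lborel :: real measure" ..
  interpret I: sigma_finite_measure "PiM I (\<lambda>_. lborel :: real measure)"
    by (rule sigma_finite) fact
  note [measurable] = insert.prems(1-3)
  have upd: "(\<lambda>x. u (x(i := t))) \<in> borel_measurable (PiM I (\<lambda>_. lborel))"
    if [measurable]: "u \<in> borel_measurable (PiM (insert i I) (\<lambda>_. lborel))" for u :: "('i \<Rightarrow> real) \<Rightarrow> ennreal" and t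
    by measurable
  have int: "(\<lambda>t. \<integral>\<^sup>+x. u (x(i := t)) \<partial>PiM I (\<lambda>_. lborel)) \<in> borel_measurable borel"
    if [measurable]: "u \<in> borel_measurable (PiM (insert i I) (\<lambda>_. lborel))" for u :: "('i \<Rightarrow> real) \<Rightarrow> ennreal"
  proof -
    have "(\<lambda>t. \<integral>\<^sup>+x. u (x(i := t)) \<partial>PiM I (\<lambda>_. lborel)) \<in> borel_measurable lborel"
      by measurable
    then show ?thesis by simp
  qed
  show ?case
    unfolding product_nn_integral_insert_rev[OF insert.hyps insert.prems(1)]
      product_nn_integral_insert_rev[OF insert.hyps insert.prems(2)]
      product_nn_integral_insert_rev[OF insert.hyps insert.prems(3)]
  proof (rule prekopa_leindler_real)
    fix s t :: real
    show "(\<integral>\<^sup>+x. f (x(i := s)) \<partial>PiM I (\<lambda>_. lborel)) * (\<integral>\<^sup>+x. g (x(i := t)) \<partial>PiM I (\<lambda>_. lborel)) \<le>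
        (\<integral>\<^sup>+x. h (x(i := (s + t) / 2)) \<partial>PiM I (\<lambda>_. lborel)) ^ 2"
    proof (rule insert.IH)
      fix x y
      assume xy: "x \<in> space (PiM I (\<lambda>_. lborel :: real measure))" "y \<in> space (PiM I (\<lambda>_. lborel :: real measure))"
      then have "x(i := s) \<in> space (PiM (insert i I) (\<lambda>_. lborel))"
        "y(i := t) \<in> space (PiM (insert i I) (\<lambda>_. lborel))"
        by (auto simp: space_PiM PiE_def extensional_def)
      from insert.prems(4)[OF this]
      have "f (x(i := s)) * g (y(i := t)) \<le> h (\<lambda>j\<in>insert i I. ((x(i := s)) j + (y(i := t)) j) / 2) ^ 2" .
      also have "(\<lambda>j\<in>insert i I. ((x(i := s)) j + (y(i := t)) j) / 2) =
          (\<lambda>j\<in>I. (x j + y j) / 2)(i := (s + t) / 2)"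
        using insert.hyps by (auto simp: restrict_def fun_eq_iff)
      finally show "f (x(i := s)) * g (y(i := t)) \<le> h ((\<lambda>j\<in>I. (x j + y j) / 2)(i := (s + t) / 2)) ^ 2" .
    qed (rule upd insert.prems(1-3))+
  qed (rule int insert.prems(1-3))+
qed

section \<open>Integration over the sphere\<close>

lemma sphere_integral_mono:
  fixes f g :: "real ^ 'n \<Rightarrow> real"
  assumes "continuous_on UNIV f" "continuous_on UNIV g" "\<And>x. norm x = 1 \<Longrightarrow> f x \<le> g x"
  shows "(\<integral>x. f x \<partial>sphere_measure) \<le> (\<integral>x. g x \<partial>sphere_measure)"
  using assms AE_sphere_measure
  by (intro integral_mono_AE integrable_sphere_measure) (auto elim!: eventually_mono)

lemma sphere_integral_cong:
  fixes f g :: "real ^ 'n \<Rightarrow> real"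
  assumes "continuous_on UNIV f" "continuous_on UNIV g" "\<And>x. norm x = 1 \<Longrightarrow> f x = g x"
  shows "(\<integral>x. f x \<partial>sphere_measure) = (\<integral>x. g x \<partial>sphere_measure)"
  using assms by (intro antisym sphere_integral_mono) auto

lemma sphere_integral_const: "(\<integral>x. c \<partial>(sphere_measure :: (real ^ 'n) measure)) = (c :: real)"
  by (simp add: measure_def emeasure_sphere_measure_UNIV)

lemma sphere_integral_rotation:
  fixes f :: "real ^ 'n \<Rightarrow> real" and T :: "real ^ 'n \<Rightarrow> real ^ 'n"
  assumes T: "orthogonal_transformation T" and f: "continuous_on UNIV f"
  shows "(\<integral>x. f (T x) \<partial>sphere_measure) = (\<integral>x. f x \<partial>sphere_measure)"
proof -
  have "T \<in> borel_measurable borel"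
    using T by (intro borel_measurable_continuous_onI linear_continuous_on)
      (simp add: linear_conv_bounded_linear[symmetric] orthogonal_transformation_linear)
  then have "(\<integral>x. f x \<partial>distr sphere_measure borel T) = (\<integral>x. f (T x) \<partial>sphere_measure)"
    using borel_measurable_continuous_onI[OF f] by (intro integral_distr) auto
  then show ?thesis
    by (simp add: sphere_measure_rotation_invariant[OF T])
qed

lemma form_bounded_on_sphere:
  assumes "f \<in> forms d"
  obtains B where "B \<ge> 0" "\<And>x. norm x = 1 \<Longrightarrow> \<bar>f x\<bar> \<le> B"
proof -
  have "bounded (f ` sphere 0 1)"
    using assms by (intro compact_imp_bounded compact_continuous_image form_continuous) auto
  then obtain B where "\<forall>x\<in>sphere 0 1. norm (f x) \<le> B"
    by (auto simp: bounded_iff)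
  then show ?thesis
    by (intro that[of "\<bar>B\<bar>"]) force+
qed

section \<open>Integration by parts along coordinate-plane rotations\<close>

definition plane_rotation :: "'n \<Rightarrow> 'n \<Rightarrow> real \<Rightarrow> real ^ 'n \<Rightarrow> real ^ 'n" where
  "plane_rotation i j s x = x + (cos s - 1) *\<^sub>R (x $ i *\<^sub>R axis i 1 + x $ j *\<^sub>R axis j 1)
    + sin s *\<^sub>R (x $ i *\<^sub>R axis j 1 - x $ j *\<^sub>R axis i 1)"

lemma plane_rotation_component:
  "i \<noteq> j \<Longrightarrow> plane_rotation i j s x $ l =
    (if l = i then cos s * x $ i - sin s * x $ j else if l = j then sin s * x $ i + cos s * x $ j else x $ l)"
  by (auto simp: plane_rotation_def axis_def algebra_simps)

lemma orthogonal_transformation_plane_rotation: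
  fixes i j :: "'n :: finite"
  assumes "i \<noteq> j"
  shows "orthogonal_transformation (plane_rotation i j s)"
  unfolding orthogonal_transformation
proof
  show "linear (plane_rotation i j s)"
    by (rule linearI) (auto simp: plane_rotation_component[OF assms] vec_eq_iff algebra_simps)
  show "\<forall>x. norm (plane_rotation i j s x) = norm x"
  proof
    fix x :: "real ^ 'n"
    have sp: "(\<Sum>l\<in>UNIV. g l) = g i + (g j + (\<Sum>l\<in>UNIV - {i} - {j}. g l))" for g :: "'n \<Rightarrow> real"
      using assms by (simp add: sum.remove[of UNIV i] sum.remove[of "UNIV - {i}" j])
    have "(q * a - p * b)\<^sup>2 + (p * a + q * b)\<^sup>2 = (p\<^sup>2 + q\<^sup>2) * (a\<^sup>2 + b\<^sup>2)" for a b p q :: real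
      by (simp add: power2_eq_square algebra_simps)
    from this[of "cos s" _ "sin s"] have "(cos s * a - sin s * b)\<^sup>2 + (sin s * a + cos s * b)\<^sup>2 = a\<^sup>2 + b\<^sup>2" for a b
      by simp
    moreover have "(\<Sum>l\<in>UNIV - {i} - {j}. (plane_rotation i j s x $ l)\<^sup>2) = (\<Sum>l\<in>UNIV - {i} - {j}. (x $ l)\<^sup>2)"
      by (rule sum.cong) (auto simp: plane_rotation_component[OF assms])
    ultimately have "(\<Sum>l\<in>UNIV. (plane_rotation i j s x $ l)\<^sup>2) = (\<Sum>l\<in>UNIV. (x $ l)\<^sup>2)"
      using assms by (simp add: sp plane_rotation_component[OF assms] add.assoc[symmetric])
    then show "norm (plane_rotation i j s x) = norm x"
      by (simp add: norm_vec_def L2_set_def)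
  qed
qed

text \<open>The generator of the rotations in the plane of \<open>i\<close> and \<open>j\<close>, a
  vector field tangent to the sphere.\<close>

definition angular_deriv :: "'n \<Rightarrow> 'n \<Rightarrow> (real ^ 'n \<Rightarrow> real) \<Rightarrow> real ^ 'n \<Rightarrow> real" where
  "angular_deriv i j f x = x $ i * partial_deriv j f x - x $ j * partial_deriv i f x"

lemma form_angular_deriv:
  assumes "f \<in> forms d"
  shows "angular_deriv i j f \<in> forms d"
\<comment> \<open>Constants need their own case: with \<open>d - 1\<close> truncated to 0, the
  general degree count would give 1 instead of 0.\<close>
proof (cases "d = 0")
  case True
  have "f = (\<lambda>_. f 0)"
    using assms True form_degree_0[of f] by blast
  then obtain c where "f = (\<lambda>_. c)" ..
  then have "partial_deriv l f = (\<lambda>x. 0)" for l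
    by (intro ext partial_deriv_eqI) simp
  then show ?thesis
    by (simp add: angular_deriv_def[abs_def] form_zero)
next
  case False
  then show ?thesis
    using form_diff[OF form_mult[OF form_coordinate form_partial_deriv[OF assms]]
        form_mult[OF form_coordinate form_partial_deriv[OF assms]]]
    by (simp add: angular_deriv_def[abs_def])
qed

lemma plane_rotation_derivative:
  fixes f :: "real ^ 'n \<Rightarrow> real"
  assumes ij: "i \<noteq> j" and f: "f \<in> forms d"
  shows "((\<lambda>s. f (plane_rotation i j s x)) has_field_derivative
    angular_deriv i j f (plane_rotation i j s x)) (at s)"
proof -
  define y where "y = plane_rotation i j s x"
  have "((\<lambda>s. plane_rotation i j s x $ l) has_field_derivative
      (if l = j then y $ i else if l = i then - y $ j else 0)) (at s)" for l
    unfolding plane_rotation_component[OF ij] y_def using ij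
    by (auto intro!: derivative_eq_intros)
  then have "((\<lambda>s. f (plane_rotation i j s x)) has_field_derivative
      (\<Sum>l\<in>UNIV. (if l = j then y $ i else if l = i then - y $ j else 0) * partial_deriv l f y)) (at s)"
    unfolding y_def by (intro form_chain_rule[OF f]) blast
  also have "(\<Sum>l\<in>UNIV. (if l = j then y $ i else if l = i then - y $ j else 0) * partial_deriv l f y) =
      (\<Sum>l\<in>UNIV. (if l = j then y $ i * partial_deriv l f y else 0) + (if l = i then - y $ j * partial_deriv l f y else 0))"
    using ij by (intro sum.cong) auto
  also have "\<dots> = angular_deriv i j f y"
    by (simp add: sum.distrib angular_deriv_def)
  finally show ?thesis
    by (simp add: y_def)
qed

text \<open>
  Rotations preserve the integral, and the second-order Taylor expansion along them is uniform on the
  sphere, so the first-order term integrates to zero.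
\<close>

lemma sphere_integral_angular_deriv:
  fixes f :: "real ^ 'n \<Rightarrow> real"
  assumes f: "f \<in> forms d"
  shows "(\<integral>x. angular_deriv i j f x \<partial>sphere_measure) = 0"
proof (cases "i = j")
  case False
  define g where "g = angular_deriv i j f"
  have g: "g \<in> forms d"
    unfolding g_def by (rule form_angular_deriv[OF f])
  obtain B where B: "B \<ge> 0" "\<And>x. norm x = 1 \<Longrightarrow> \<bar>angular_deriv i j g x\<bar> \<le> B"
    using form_bounded_on_sphere[OF form_angular_deriv[OF g, of i j]] by blast
  note orth = orthogonal_transformation_plane_rotation[OF False]
  have cont: "continuous_on UNIV (\<lambda>x. f (plane_rotation i j s x))" for s
    by (rule form_continuous[OF form_compose_linear[OF orthogonal_transformation_linear[OF orth] f]])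
  have taylor: "\<bar>f (plane_rotation i j s x) - f x - s * g x\<bar> \<le> s\<^sup>2 * B" if s: "s > 0" and x: "norm x = 1" for s x
  proof -
    have zero: "plane_rotation i j 0 x = x"
      by (simp add: plane_rotation_def)
    obtain u where u: "0 < u" "u < s"
      "f (plane_rotation i j s x) - f (plane_rotation i j 0 x) = (s - 0) * g (plane_rotation i j u x)"
      unfolding g_def using MVT2[OF s plane_rotation_derivative[OF False f]] by blast
    obtain v where v: "0 < v" "v < u"
      "g (plane_rotation i j u x) - g (plane_rotation i j 0 x) = (u - 0) * angular_deriv i j g (plane_rotation i j v x)"
      using MVT2[OF u(1) plane_rotation_derivative[OF False g]] by blast
    have "\<bar>angular_deriv i j g (plane_rotation i j v x)\<bar> \<le> B"
      using x orthogonal_transformation_norm[OF orth] by (intro B(2)) simp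
    then have "\<bar>u * angular_deriv i j g (plane_rotation i j v x)\<bar> \<le> s * B"
      unfolding abs_mult using u B(1) by (intro mult_mono) auto
    moreover have "f (plane_rotation i j s x) - f x - s * g x = s * (u * angular_deriv i j g (plane_rotation i j v x))"
      using u(3) v(3) unfolding zero by (simp add: algebra_simps)
    ultimately show ?thesis
      using s by (simp add: abs_mult power2_eq_square mult_left_mono mult.assoc)
  qed
  have small: "\<bar>\<integral>x. g x \<partial>sphere_measure\<bar> \<le> s * B" if s: "s > 0" for s
  proof -
    have int: "integrable sphere_measure (\<lambda>x. f (plane_rotation i j s x))" "integrable sphere_measure f"
      "integrable sphere_measure g"
      using cont form_continuous[OF f] form_continuous[OF g] by (auto intro: integrable_sphere_measure)
    have "(\<integral>x. f (plane_rotation i j s x) - f x - s * g x \<partial>sphere_measure) = - (s * (\<integral>x. g x \<partial>sphere_measure))"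
      using int sphere_integral_rotation[OF orth form_continuous[OF f]] by simp
    moreover have "\<bar>\<integral>x. f (plane_rotation i j s x) - f x - s * g x \<partial>sphere_measure\<bar> \<le>
        (\<integral>x. \<bar>f (plane_rotation i j s x) - f x - s * g x\<bar> \<partial>sphere_measure)"
      by (rule integral_abs_bound)
    moreover have "\<dots> \<le> (\<integral>x. s\<^sup>2 * B \<partial>(sphere_measure :: (real ^ 'n) measure))"
      using taylor[OF s] cont form_continuous[OF f] form_continuous[OF g]
      by (intro sphere_integral_mono) (auto intro!: continuous_intros)
    ultimately have "\<bar>s * (\<integral>x. g x \<partial>sphere_measure)\<bar> \<le> s * (s * B)"
      unfolding sphere_integral_const power2_eq_square mult.assoc by linarith
    then have "s * \<bar>\<integral>x. g x \<partial>sphere_measure\<bar> \<le> s * (s * B)"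
      using s by (simp only: abs_mult abs_of_pos)
    then show ?thesis
      using s by (simp only: mult_le_cancel_left_pos)
  qed
  have "\<bar>\<integral>x. g x \<partial>sphere_measure\<bar> \<le> 0"
  proof (rule field_le_epsilon)
    fix e :: real
    assume "e > 0"
    then have "e / (B + 1) * B \<le> e"
      using B(1) by (simp add: field_simps)
    moreover have "\<bar>\<integral>x. g x \<partial>sphere_measure\<bar> \<le> e / (B + 1) * B"
      using \<open>e > 0\<close> B(1) by (intro small) auto
    ultimately show "\<bar>\<integral>x. g x \<partial>sphere_measure\<bar> \<le> 0 + e"
      by simp
  qed
  then show ?thesis
    by (simp add: g_def)
qed (simp add: angular_deriv_def[abs_def])

text \<open>Summing \<open>angular_deriv i j\<close> of \<open>x $ j * f x\<close> over
  \<open>j\<close> gives, by Euler's identity,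
  \<open>(n + m - 1) x_i f - |x|^2 \<partial>_i f\<close>. Each summand integrates to zero and
  \<open>|x| = 1\<close> on the sphere. This replaces the divergence theorem.\<close>

lemma sphere_integral_partial_deriv:
  fixes f :: "real ^ 'n \<Rightarrow> real"
  assumes f: "f \<in> forms m"
  shows "(\<integral>x. partial_deriv i f x \<partial>sphere_measure) =
    (real CARD('n) + real m - 1) * (\<integral>x. x $ i * f x \<partial>sphere_measure)"
proof -
  have xf: "(\<lambda>x. x $ j * f x) \<in> forms (1 + m)" for j
    by (rule form_mult[OF form_coordinate f])
  have cont: "continuous_on UNIV (\<lambda>x. x $ i * f x)" "continuous_on UNIV (partial_deriv i f)"
    by (rule form_continuous[OF xf] form_continuous[OF form_partial_deriv[OF f]])+
  have sum: "(\<Sum>j\<in>UNIV. angular_deriv i j (\<lambda>x. x $ j * f x) x) =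
      (real CARD('n) + real m - 1) * (x $ i * f x) - (norm x)\<^sup>2 * partial_deriv i f x" for x
  proof -
    have "(\<Sum>j\<in>UNIV. angular_deriv i j (\<lambda>x. x $ j * f x) x) =
        (\<Sum>j\<in>UNIV. x $ i * f x + x $ i * (x $ j * partial_deriv j f x)
          - (if j = i then x $ j * f x else 0) - (x $ j)\<^sup>2 * partial_deriv i f x)"
      unfolding angular_deriv_def partial_deriv_mult[OF form_coordinate f] partial_deriv_coordinate
      by (rule sum.cong) (auto simp: algebra_simps power2_eq_square)
    also have "\<dots> = real CARD('n) * (x $ i * f x) + x $ i * (\<Sum>j\<in>UNIV. x $ j * partial_deriv j f x)
        - x $ i * f x - (\<Sum>j\<in>UNIV. (x $ j)\<^sup>2) * partial_deriv i f x"
      by (simp add: sum.distrib sum_subtractf sum_distrib_left sum_distrib_right)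
    also have "(\<Sum>j\<in>UNIV. (x $ j)\<^sup>2) = (norm x)\<^sup>2"
      by (simp add: norm_vec_def L2_set_def sum_nonneg)
    finally show ?thesis
      unfolding euler_identity[OF f] by (simp add: algebra_simps)
  qed
  have "0 = (\<Sum>j\<in>UNIV. \<integral>x. angular_deriv i j (\<lambda>x. x $ j * f x) x \<partial>sphere_measure)"
    using sphere_integral_angular_deriv[OF xf] by simp
  also have "\<dots> = (\<integral>x. (\<Sum>j\<in>UNIV. angular_deriv i j (\<lambda>x. x $ j * f x) x) \<partial>sphere_measure)"
    by (rule Bochner_Integration.integral_sum[symmetric])
      (rule integrable_sphere_measure[OF form_continuous[OF form_angular_deriv[OF xf]]])
  also have "\<dots> = (\<integral>x. (real CARD('n) + real m - 1) * (x $ i * f x) - partial_deriv i f x \<partial>sphere_measure)"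
    unfolding sum using cont by (intro sphere_integral_cong) (auto intro!: continuous_intros)
  also have "\<dots> = (real CARD('n) + real m - 1) * (\<integral>x. x $ i * f x \<partial>sphere_measure)
      - (\<integral>x. partial_deriv i f x \<partial>sphere_measure)"
    using cont by (simp add: integrable_sphere_measure)
  finally show ?thesis
    by simp
qed

section \<open>The Poincare inequality for forms\<close>

lemma l2_inner_form_integrable:
  "f \<in> forms d \<Longrightarrow> g \<in> forms e \<Longrightarrow> integrable sphere_measure (\<lambda>x. f x * g x)"
  by (intro integrable_sphere_measure form_continuous[OF form_mult])

text \<open>Apply \<open>sphere_integral_partial_deriv\<close> to
  \<open>u * partial_deriv i v\<close>, of degree \<open>2d - 1\<close>, and sum over
  \<open>i\<close>; Euler's identity evaluates the boundary-like term. In fixed degree the Euclidean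
  and the spherical Laplacian differ by a scalar on the sphere, which is the constant on the
  right.\<close>

lemma green_identity:
  fixes u v :: "real ^ 'n \<Rightarrow> real"
  assumes u: "u \<in> forms d" and v: "v \<in> forms d" and d: "d > 0"
  shows "(\<Sum>i\<in>UNIV. l2_inner (partial_deriv i u) (partial_deriv i v)) + l2_inner u (laplacian v) =
    (real CARD('n) + 2 * real d - 2) * real d * l2_inner u v"
proof -
  note dv = form_partial_deriv[OF v] and du = form_partial_deriv[OF u]
  have "(\<Sum>i\<in>UNIV. l2_inner (partial_deriv i u) (partial_deriv i v)) + l2_inner u (laplacian v) =
      (\<Sum>i\<in>UNIV. \<integral>x. partial_deriv i u x * partial_deriv i v x + u x * partial_deriv i (partial_deriv i v) x \<partial>sphere_measure)"
    unfolding l2_inner_def laplacian_def sum_distrib_left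
    using l2_inner_form_integrable[OF du dv] l2_inner_form_integrable[OF u form_partial_deriv[OF dv]]
    by (simp add: Bochner_Integration.integral_sum sum.distrib)
  also have "\<dots> = (\<Sum>i\<in>UNIV. (real CARD('n) + real (d + (d - 1)) - 1) * (\<integral>x. x $ i * (u x * partial_deriv i v x) \<partial>sphere_measure))"
    using sphere_integral_partial_deriv[OF form_mult[OF u dv]]
    by (simp add: partial_deriv_mult[OF u dv])
  also have "\<dots> = (real CARD('n) + 2 * real d - 2) * (\<integral>x. (\<Sum>i\<in>UNIV. x $ i * (u x * partial_deriv i v x)) \<partial>sphere_measure)"
    using d l2_inner_form_integrable[OF form_coordinate form_mult[OF u dv]]
    by (simp add: sum_distrib_left Bochner_Integration.integral_sum of_nat_diff)
  also have "(\<lambda>x. \<Sum>i\<in>UNIV. x $ i * (u x * partial_deriv i v x)) = (\<lambda>x. real d * (u x * v x))"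
  proof
    fix x
    have "(\<Sum>i\<in>UNIV. x $ i * (u x * partial_deriv i v x)) = u x * (\<Sum>i\<in>UNIV. x $ i * partial_deriv i v x)"
      by (simp add: sum_distrib_left mult_ac)
    then show "(\<Sum>i\<in>UNIV. x $ i * (u x * partial_deriv i v x)) = real d * (u x * v x)"
      by (simp add: euler_identity[OF v])
  qed
  finally show ?thesis
    by (simp add: l2_inner_def)
qed

lemma laplacian_symmetric:
  fixes u v :: "real ^ 'n \<Rightarrow> real"
  assumes "u \<in> forms d" "v \<in> forms d" "d > 0"
  shows "l2_inner u (laplacian v) = l2_inner v (laplacian u)"
  using green_identity[OF assms] green_identity[OF assms(2,1,3)]
  by (simp add: l2_inner_commute[of v u] l2_inner_commute[of "partial_deriv _ v"])

lemma l2_inner_add_right: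
  "f \<in> forms d \<Longrightarrow> g \<in> forms d \<Longrightarrow> h \<in> forms d \<Longrightarrow> l2_inner h (f + g) = l2_inner h f + l2_inner h g"
  using l2_inner_add_left[of f d g h] by (simp add: l2_inner_commute)

lemma l2_inner_scaleR_right: "l2_inner h (c *\<^sub>R f) = c * l2_inner h f"
  using l2_inner_scaleR_left[of c f h] by (simp add: l2_inner_commute)

lemma l2_inner_diff_left:
  assumes "f \<in> forms d" "g \<in> forms d" "h \<in> forms d"
  shows "l2_inner (f - g) h = l2_inner f h - l2_inner g h"
  using l2_inner_add_left[OF assms(1) _ assms(3), of "- 1 *\<^sub>R g"] l2_inner_scaleR_left[of "- 1" g h]
    subspace_scale[OF subspace_forms assms(2), of "- 1"]
  by simp

section \<open>Orthonormal expansion and projection in spaces of forms\<close>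

locale form_space =
  fixes V :: "(real ^ 'n \<Rightarrow> real) set" and d :: nat and b :: "nat \<Rightarrow> real ^ 'n \<Rightarrow> real"
  assumes V: "subspace V" "V \<subseteq> forms d" and onb: "l2_orthonormal_basis V b"
begin

lemma basis_in: "i < dim V \<Longrightarrow> b i \<in> V"
  using onb span_base[of "b i" "b ` {..<dim V}"] by (auto simp: l2_orthonormal_basis_def)

lemma basis_form: "i < dim V \<Longrightarrow> b i \<in> forms d"
  using basis_in V by blast

lemma basis_orthonormal: "i < dim V \<Longrightarrow> j < dim V \<Longrightarrow> l2_inner (b i) (b j) = of_bool (i = j)"
  using onb by (auto simp: l2_orthonormal_basis_def)

lemma comb_in: "(\<Sum>i<dim V. c i *\<^sub>R b i) \<in> V"
  using V by (intro subspace_sum subspace_scale basis_in) auto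

lemma l2_inner_comb: "j < dim V \<Longrightarrow> l2_inner (\<Sum>i<dim V. c i *\<^sub>R b i) (b j) = c j"
proof -
  assume j: "j < dim V"
  have "l2_inner (\<Sum>i<dim V. c i *\<^sub>R b i) (b j) = (\<Sum>i<dim V. c i * l2_inner (b i) (b j))"
    using j by (intro l2_inner_sum_left) (auto intro: basis_form)
  also have "\<dots> = (\<Sum>i<dim V. if i = j then c i else 0)"
    using j by (intro sum.cong) (auto simp: basis_orthonormal)
  finally show ?thesis
    using j by simp
qed

lemma expansion:
  assumes "f \<in> V"
  shows "f = (\<Sum>i<dim V. l2_inner f (b i) *\<^sub>R b i)"
proof -
  have "f \<in> span (b ` {..<dim V})"
    using assms onb by (simp add: l2_orthonormal_basis_def)
  moreover have "inj_on b {..<dim V}"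
    by (rule orthonormal_independent(2)[where d = d]) (auto simp: basis_form basis_orthonormal)
  ultimately obtain c where "f = (\<Sum>i<dim V. c i *\<^sub>R b i)"
    unfolding span_finite[OF finite_imageI[OF finite_lessThan]]
    by (auto simp: sum.reindex)
  then show ?thesis
    by (simp add: l2_inner_comb)
qed

lemma projection:
  assumes f: "f \<in> forms d"
  shows "\<exists>p\<in>V. \<forall>v\<in>V. l2_inner (f - p) v = 0"
proof
  define p where "p = (\<Sum>i<dim V. l2_inner f (b i) *\<^sub>R b i)"
  show pV: "p \<in> V"
    unfolding p_def by (rule comb_in)
  have fp: "f - p \<in> forms d"
    using f pV V by (intro subspace_diff subspace_forms) auto
  show "\<forall>v\<in>V. l2_inner (f - p) v = 0"
  proof
    fix v
    assume v: "v \<in> V"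
    have "l2_inner (f - p) (b j) = 0" if "j < dim V" for j
      using that f pV V basis_form[OF that]
      by (subst l2_inner_diff_left[where d = d]) (auto simp: p_def l2_inner_comb)
    moreover have "l2_inner (f - p) v = l2_inner (\<Sum>i<dim V. l2_inner v (b i) *\<^sub>R b i) (f - p)"
      using expansion[OF v] by (simp add: l2_inner_commute[of _ v])
    moreover have "\<dots> = (\<Sum>i<dim V. l2_inner v (b i) * l2_inner (b i) (f - p))"
      using fp by (intro l2_inner_sum_left) (auto intro: basis_form)
    ultimately show "l2_inner (f - p) v = 0"
      by (simp add: l2_inner_commute[of "b _"])
  qed
qed

end

lemma l2_projection_exists:
  assumes "subspace V" "V \<subseteq> forms d" "f \<in> forms d"
  shows "\<exists>p\<in>V. \<forall>v\<in>V. l2_inner (f - p) v = 0"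
proof -
  obtain b where "l2_orthonormal_basis V b"
    using l2_orthonormal_basis_exists[OF assms(1,2)] by blast
  then interpret form_space V d b
    using assms by unfold_locales
  show ?thesis
    by (rule projection[OF assms(3)])
qed

text \<open>
  The restriction of the Laplacian to the sphere is symmetric, and the part of \<open>f\<close> orthogonal to the
  multiples of the squared norm is harmonic.
\<close>

lemma laplacian_upper_bound:
  fixes f :: "real ^ 'n \<Rightarrow> real"
  assumes "f \<in> forms (2 * Suc k)" "(\<integral>x. f x \<partial>sphere_measure) = 0"
  shows "l2_inner f (laplacian f) \<le> (2 * real k) * (2 * real (Suc k) + real CARD('n)) * l2_inner f f"
  using assms
proof (induction k arbitrary: f)
  case 0
  \<comment> \<open>In degree 2 the Laplacian is constant, so pairing it with a form of mean zero
    gives 0.\<close>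
  have "laplacian f \<in> forms 0"
    using form_laplacian[OF 0(1)] by simp
  then have "laplacian f x = laplacian f 0" for x
    by (rule form_degree_0)
  then have "l2_inner f (laplacian f) = (\<integral>x. f x * laplacian f 0 \<partial>sphere_measure)"
    unfolding l2_inner_def by metis
  then show ?case
    using 0 by simp
next
  case (Suc k)
  define d where "d = 2 * Suc (Suc k)"
  define e where "e = 2 * Suc k"
  have de: "d = Suc (Suc e)" "d > 0" "d - 2 = e"
    by (auto simp: d_def e_def)
  have f: "f \<in> forms d"
    using Suc.prems by (simp add: d_def)
  \<comment> \<open>On the unit sphere \<open>N g\<close> and \<open>g\<close> coincide, so
    \<open>N\<close> raises the degree by 2 and leaves every inner product unchanged.\<close>
  define N where "N g x = (norm x)\<^sup>2 * g x" for g and x :: "real ^ 'n"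
  have N: "N g \<in> forms d" if "g \<in> forms e" for g
    using form_norm_squared_mult[OF that] by (simp add: N_def[abs_def] de)
  have "linear N"
    by (rule linearI) (auto simp: N_def fun_eq_iff algebra_simps)
  then have "subspace (N ` forms e)"
    by (rule linear_subspace_image[OF _ subspace_forms])
  moreover have "N ` forms e \<subseteq> forms d"
    using N by blast
  ultimately obtain g where g: "g \<in> forms e" and orth: "\<And>g'. g' \<in> forms e \<Longrightarrow> l2_inner (f - N g) (N g') = 0"
    using l2_projection_exists[of "N ` forms e" d f] f by blast
  define p where "p = N g"
  define h where "h = f - p"
  have p: "p \<in> forms d"
    unfolding p_def by (rule N[OF g])
  have h: "h \<in> forms d"
    unfolding h_def using f p by (intro subspace_diff subspace_forms)
  have N_inner: "l2_inner u (N g') = l2_inner u g'" if "u \<in> forms d'" "g' \<in> forms e" for u g' d'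
    unfolding l2_inner_def N_def
    using form_continuous[OF that(1), of UNIV] form_continuous[OF that(2), of UNIV]
    by (intro sphere_integral_cong) (auto intro!: continuous_intros)
  have h0: "l2_inner h g' = 0" if "g' \<in> forms e" for g'
    using orth[OF that] N_inner[OF h that] by (simp add: h_def p_def)
  have f_eq: "f = p + h"
    by (simp add: h_def)
  have split: "l2_inner f g' = l2_inner p g'" if "g' \<in> forms e" for g'
  proof -
    have "l2_inner f (N g') = l2_inner p (N g') + l2_inner h (N g')"
      unfolding f_eq by (rule l2_inner_add_left[OF p h N[OF that]])
    then show ?thesis
      using that by (simp add: N_inner[OF f] N_inner[OF p] N_inner[OF h] h0)
  qed
  have lap: "laplacian f \<in> forms e" "laplacian p \<in> forms e"
    using form_laplacian[OF f] form_laplacian[OF p] de by auto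
  \<comment> \<open>Harmonicity of \<open>h\<close> enters only weakly: \<open>h\<close> is
    orthogonal to the forms of degree \<open>e\<close>, which include both Laplacians. Orthogonality
    removes \<open>h\<close> from one factor, symmetry swaps the factors, and orthogonality removes
    it from the other.\<close>
  have "l2_inner f (laplacian f) = l2_inner p (laplacian f)"
    by (rule split[OF lap(1)])
  also have "\<dots> = l2_inner f (laplacian p)"
    by (rule laplacian_symmetric[OF p f de(2)])
  also have "\<dots> = l2_inner p (laplacian p)"
    by (rule split[OF lap(2)])
  also have "\<dots> = l2_inner (laplacian p) g"
    unfolding p_def using N_inner[OF lap(2)[unfolded p_def] g] by (simp add: l2_inner_commute)
  also have "\<dots> = (\<integral>x. (2 * real CARD('n) + 4 * real e) * (g x * g x) + g x * laplacian g x \<partial>sphere_measure)"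
  proof -
    have c: "continuous_on UNIV g" "continuous_on UNIV (laplacian g)" "continuous_on UNIV (laplacian p)"
      by (rule form_continuous[OF g] form_continuous[OF form_laplacian[OF g]] form_continuous[OF lap(2)])+
    have "laplacian p x = (2 * real CARD('n) + 4 * real e) * g x + (norm x)\<^sup>2 * laplacian g x" for x
      unfolding p_def N_def[abs_def] by (rule laplacian_norm_squared_mult[OF g])
    then show ?thesis
      unfolding l2_inner_def using c
      by (intro sphere_integral_cong) (auto intro!: continuous_intros simp: algebra_simps)
  qed
  also have "\<dots> = (2 * real CARD('n) + 4 * real e) * l2_inner g g + l2_inner g (laplacian g)"
    unfolding l2_inner_def
    using l2_inner_form_integrable[OF g g] l2_inner_form_integrable[OF g form_laplacian[OF g]] by simp
  also have "l2_inner g (laplacian g) \<le> (2 * real k) * (2 * real (Suc k) + real CARD('n)) * l2_inner g g"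
  proof (rule Suc.IH)
    show "g \<in> forms (2 * Suc k)"
      using g by (simp add: e_def)
    \<comment> \<open>The mean is the pairing with a power of the norm, which is 1 on the sphere; in
      this shape it passes from \<open>f\<close> to \<open>p\<close> and then to
      \<open>g\<close>.\<close>
    have ne: "(\<lambda>x :: real ^ 'n. norm x ^ e) \<in> forms e"
      unfolding e_def by (rule form_norm_power)
    have "(\<integral>x. u x \<partial>sphere_measure) = l2_inner u (\<lambda>x. norm x ^ e)" if "u \<in> forms d'" for d' and u :: "real ^ 'n \<Rightarrow> real"
      unfolding l2_inner_def using form_continuous[OF that, of UNIV]
      by (intro sphere_integral_cong) (auto intro!: continuous_intros)
    then have "(\<integral>x. g x \<partial>sphere_measure) = l2_inner g (\<lambda>x. norm x ^ e)" "l2_inner f (\<lambda>x. norm x ^ e) = 0"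
      using g f Suc.prems(2) by metis+
    moreover have "l2_inner (\<lambda>x. norm x ^ e) (N g) = l2_inner (\<lambda>x. norm x ^ e) g"
      by (rule N_inner[OF ne g])
    ultimately show "(\<integral>x. g x \<partial>sphere_measure) = 0"
      using split[OF ne] by (simp add: p_def l2_inner_commute)
  qed
  finally have le: "l2_inner f (laplacian f) \<le>
      (2 * real CARD('n) + 4 * real e + (2 * real k) * (2 * real (Suc k) + real CARD('n))) * l2_inner g g"
    by (simp add: algebra_simps)
  have "l2_inner g g \<le> l2_inner f f"
  proof -
    have "l2_inner p p = l2_inner p g"
      unfolding p_def by (rule N_inner[OF N[OF g] g])
    also have "\<dots> = l2_inner g g"
      unfolding p_def using N_inner[OF g g] by (simp add: l2_inner_commute)
    finally have pp: "l2_inner p p = l2_inner g g" .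
    have "l2_inner h p = 0"
      unfolding p_def using h0[OF g] N_inner[OF h g] by simp
    then have "l2_inner f f = l2_inner p p + l2_inner h h"
      unfolding f_eq using p h
      by (simp add: l2_inner_add_left[where d = d] l2_inner_add_right[where d = d] subspace_add[OF subspace_forms]
          l2_inner_commute[of p h])
    then show ?thesis
      using pp l2_inner_nonneg[of h] by simp
  qed
  then have "(2 * real CARD('n) + 4 * real e + (2 * real k) * (2 * real (Suc k) + real CARD('n))) * l2_inner g g \<le>
      (2 * real CARD('n) + 4 * real e + (2 * real k) * (2 * real (Suc k) + real CARD('n))) * l2_inner f f"
    by (intro mult_left_mono) auto
  \<comment> \<open>The constant \<open>2k (2(k+1) + n)\<close> is the factor by which the
    Laplacian, read on the sphere, acts on \<open>|x|^(2k)\<close> times a harmonic quadratic form.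
    The commutator term supplies exactly the increment to the next degree.\<close>
  moreover have "2 * real CARD('n) + 4 * real e + (2 * real k) * (2 * real (Suc k) + real CARD('n)) =
      (2 * real (Suc k)) * (2 * real (Suc (Suc k)) + real CARD('n))"
    by (simp add: e_def algebra_simps)
  ultimately show ?case
    using le by (simp only:)
qed

text \<open>Green's identity converts the upper bound for the Laplacian into a lower bound for the
  full gradient. In the constant, \<open>4k^2\<close> comes from the radial derivative and
  \<open>2n\<close> is the spherical eigenvalue of harmonic quadratic forms; even degree together
  with mean zero excludes the smaller eigenvalues 0 and \<open>n - 1\<close>.\<close>

lemma poincare_inequality:
  fixes f :: "real ^ 'n \<Rightarrow> real"
  assumes k: "k > 0" and f: "f \<in> zero_mean_forms k"
  shows "(4 * (real k)\<^sup>2 + 2 * real CARD('n)) * l2_inner f f \<le>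
    (\<Sum>i\<in>UNIV. l2_inner (partial_deriv i f) (partial_deriv i f))"
proof -
  obtain m where m: "k = Suc m"
    using k by (cases k) auto
  have f': "f \<in> forms (2 * k)" "(\<integral>x. f x \<partial>sphere_measure) = 0"
    using f by (auto simp: zero_mean_forms_def)
  have "l2_inner f (laplacian f) \<le> (2 * real m) * (2 * real k + real CARD('n)) * l2_inner f f"
    using laplacian_upper_bound[of f m] f' by (simp add: m)
  moreover have "(\<Sum>i\<in>UNIV. l2_inner (partial_deriv i f) (partial_deriv i f)) + l2_inner f (laplacian f) =
      (real CARD('n) + 4 * real k - 2) * (2 * real k) * l2_inner f f"
    using green_identity[OF f'(1) f'(1)] k by simp
  moreover have "(real CARD('n) + 4 * real k - 2) * (2 * real k) - (2 * real m) * (2 * real k + real CARD('n)) =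
      4 * (real k)\<^sup>2 + 2 * real CARD('n)"
    by (simp add: m power2_eq_square algebra_simps)
  then have "(4 * (real k)\<^sup>2 + 2 * real CARD('n)) * l2_inner f f =
      (real CARD('n) + 4 * real k - 2) * (2 * real k) * l2_inner f f
      - (2 * real m) * (2 * real k + real CARD('n)) * l2_inner f f"
    by (metis left_diff_distrib)
  ultimately show ?thesis
    by linarith
qed

section \<open>The gradient of a bounded form\<close>

text \<open>Split the gradient at \<open>x\<close> into its radial part, \<open>2k f x\<close> by
  Euler's identity, and a tangential part \<open>w\<close>. On the tangent line in direction
  \<open>w\<close> the squared norm is \<open>1 + t^2\<close>, so \<open>f\<close> restricts to a
  polynomial bounded by \<open>(1 + t^2)^k\<close>, and Szego's inequality at 0 bounds precisely the
  sum of the two squared parts.\<close>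

lemma gradient_bound:
  fixes f :: "real ^ 'n \<Rightarrow> real"
  assumes k: "k > 0" and f: "f \<in> forms (2 * k)"
    and bound: "\<And>x. norm x = 1 \<Longrightarrow> \<bar>f x\<bar> \<le> 1" and x: "norm x = 1"
  shows "(\<Sum>i\<in>UNIV. (partial_deriv i f x)\<^sup>2) \<le> 4 * (real k)\<^sup>2"
proof -
  have bound': "\<bar>f y\<bar> \<le> norm y ^ (2 * k)" for y
  proof (cases "y = 0")
    case True
    then show ?thesis
      using form_homogeneous[OF f, of 0 0] k by (simp add: power_0_left)
  next
    case False
    have "f y = norm y ^ (2 * k) * f (y /\<^sub>R norm y)"
      using form_homogeneous[OF f, of "norm y" "y /\<^sub>R norm y"] False by simp
    then show ?thesis
      using bound[of "y /\<^sub>R norm y"] False by (simp add: abs_mult mult_left_le)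
  qed
  define v where "v = (\<chi> i. partial_deriv i f x)"
  have radial: "x \<bullet> v = 2 * real k * f x"
    using euler_identity[OF f, of x] by (simp add: inner_vec_def v_def)
  define w where "w = v - (x \<bullet> v) *\<^sub>R x"
  have xx: "x \<bullet> x = 1"
    using x by (simp add: norm_eq_1)
  have xw: "x \<bullet> w = 0"
    by (simp add: w_def inner_diff_right xx)
  have vv: "(norm v)\<^sup>2 = (norm w)\<^sup>2 + (x \<bullet> v)\<^sup>2"
  proof -
    have "(w + s *\<^sub>R x) \<bullet> (w + s *\<^sub>R x) = w \<bullet> w + s\<^sup>2" for s
      by (simp add: inner_add_left inner_add_right xx xw inner_commute[of w x] power2_eq_square)
    from this[of "x \<bullet> v"] show ?thesis
      by (simp add: w_def power2_norm_eq_inner)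
  qed
  have "(norm w)\<^sup>2 + 4 * (real k)\<^sup>2 * (f x)\<^sup>2 \<le> 4 * (real k)\<^sup>2"
  proof (cases "w = 0")
    case True
    then show ?thesis
      using bound[OF x] by (simp add: abs_square_le_1 mult_left_le)
  next
    case False
    define u where "u = w /\<^sub>R norm w"
    have uu: "u \<bullet> u = 1" "x \<bullet> u = 0"
      using False xw by (simp_all add: u_def power2_norm_eq_inner[symmetric] power2_eq_square)
    have uv: "u \<bullet> v = norm w"
    proof -
      have "u \<bullet> w = norm w"
        using False by (simp add: u_def power2_norm_eq_inner[symmetric] power2_eq_square)
      then show ?thesis
        using uu by (simp add: w_def inner_diff_right inner_commute[of u x])
    qed
    obtain q where q: "degree q \<le> 2 * k" "\<And>t. poly q t = f (x + t *\<^sub>R u)"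
      using form_line_poly[OF f] by blast
    have "(norm (x + t *\<^sub>R u))\<^sup>2 = 1 + t\<^sup>2" for t
      unfolding power2_norm_eq_inner using uu xx
      by (simp add: inner_simps inner_commute[of u x] power2_eq_square)
    then have "\<bar>poly q t\<bar> \<le> (1 + t\<^sup>2) ^ k" for t
      using bound'[of "x + t *\<^sub>R u"] by (simp add: q(2) power_mult)
    then have "(poly (pderiv q) 0)\<^sup>2 + 4 * (real k)\<^sup>2 * (poly q 0)\<^sup>2 \<le> 4 * (real k)\<^sup>2"
      by (intro szego_inequality k q(1))
    moreover have "poly (pderiv q) 0 = norm w"
    proof -
      have "(poly q has_field_derivative (\<Sum>i\<in>UNIV. u $ i * partial_deriv i f x)) (at 0)"
        using form_directional_derivative[OF f, of x u] by (simp add: q(2)[symmetric])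
      then show ?thesis
        using DERIV_unique[OF poly_DERIV[of q 0]] uv by (simp add: inner_vec_def v_def)
    qed
    ultimately show ?thesis
      by (simp add: q(2))
  qed
  moreover have "(norm v)\<^sup>2 = (\<Sum>i\<in>UNIV. (partial_deriv i f x)\<^sup>2)"
    unfolding power2_norm_eq_inner by (simp add: inner_vec_def v_def power2_eq_square)
  ultimately show ?thesis
    using vv radial by (simp add: power_mult_distrib)
qed

lemma l2_bound_of_bounded_form:
  fixes f :: "real ^ 'n \<Rightarrow> real"
  assumes k: "k > 0" and f: "f \<in> zero_mean_forms k" and bound: "\<And>x. norm x = 1 \<Longrightarrow> \<bar>f x\<bar> \<le> 1"
  shows "(4 * (real k)\<^sup>2 + 2 * real CARD('n)) * l2_inner f f \<le> 4 * (real k)\<^sup>2"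
proof -
  have f': "f \<in> forms (2 * k)"
    using f by (simp add: zero_mean_forms_def)
  note df = form_partial_deriv[OF f']
  have "(\<Sum>i\<in>UNIV. l2_inner (partial_deriv i f) (partial_deriv i f)) =
      (\<integral>x. (\<Sum>i\<in>UNIV. (partial_deriv i f x)\<^sup>2) \<partial>sphere_measure)"
    unfolding l2_inner_def power2_eq_square
    by (rule Bochner_Integration.integral_sum[symmetric]) (rule l2_inner_form_integrable[OF df df])
  also have "\<dots> \<le> (\<integral>x. 4 * (real k)\<^sup>2 \<partial>(sphere_measure :: (real ^ 'n) measure))"
    using form_continuous[OF df] gradient_bound[OF k f' bound]
    by (intro sphere_integral_mono) (auto intro!: continuous_intros)
  finally show ?thesis
    using poincare_inequality[OF k f] by (simp only: sphere_integral_const)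
qed

section \<open>The reproducing kernel\<close>

lemma l2_cauchy_schwarz:
  assumes f: "f \<in> forms d" and g: "g \<in> forms d"
  shows "(l2_inner f g)\<^sup>2 \<le> l2_inner f f * l2_inner g g"
proof (cases "l2_inner g g = 0")
  case True
  then have "g = 0"
    by (rule l2_inner_eq_0[OF g])
  then show ?thesis
    by (simp add: l2_inner_def)
next
  case False
  then have pos: "l2_inner g g > 0"
    using l2_inner_nonneg[of g] by simp
  define t where "t = - l2_inner f g / l2_inner g g"
  have tg: "t *\<^sub>R g \<in> forms d" "f + t *\<^sub>R g \<in> forms d"
    using f g by (auto intro!: subspace_add subspace_scale subspace_forms)
  have "0 \<le> l2_inner (f + t *\<^sub>R g) (f + t *\<^sub>R g)"
    by (rule l2_inner_nonneg)
  also have "\<dots> = l2_inner f f + 2 * t * l2_inner f g + t\<^sup>2 * l2_inner g g"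
    using f tg by (simp add: l2_inner_add_left[OF f tg(1) tg(2)] l2_inner_add_right[OF f tg(1) f] l2_inner_add_right[OF f tg(1) g] l2_inner_scaleR_left
        l2_inner_scaleR_right l2_inner_commute[of g f] power2_eq_square algebra_simps)
  also have "\<dots> = l2_inner f f - (l2_inner f g)\<^sup>2 / l2_inner g g"
    using pos by (simp add: t_def power2_eq_square field_simps)
  finally show ?thesis
    using pos by (simp add: field_simps)
qed

lemma l2_inner_rotation:
  fixes f g :: "real ^ 'n \<Rightarrow> real" and T :: "real ^ 'n \<Rightarrow> real ^ 'n"
  assumes "orthogonal_transformation T" "f \<in> forms d" "g \<in> forms e"
  shows "l2_inner (\<lambda>x. f (T x)) (\<lambda>x. g (T x)) = l2_inner f g"
  unfolding l2_inner_def
  by (rule sphere_integral_rotation[OF assms(1) form_continuous[OF form_mult[OF assms(2,3)]]])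

context form_space
begin

definition kernel :: "real ^ 'n \<Rightarrow> real ^ 'n \<Rightarrow> real" where
  "kernel x = (\<Sum>i<dim V. b i x *\<^sub>R b i)"

lemma kernel_in: "kernel x \<in> V"
  unfolding kernel_def by (rule comb_in)

lemma expansion_apply: "f \<in> V \<Longrightarrow> f x = (\<Sum>i<dim V. l2_inner f (b i) * b i x)"
  using fun_cong[OF expansion[of f], of x] by (simp add: sum_fun_apply)

lemma l2_inner_expansion:
  assumes "f \<in> V" "g \<in> V"
  shows "l2_inner f g = (\<Sum>i<dim V. l2_inner f (b i) * l2_inner g (b i))"
proof -
  have "l2_inner f g = l2_inner (\<Sum>i<dim V. l2_inner f (b i) *\<^sub>R b i) g"
    using expansion[OF assms(1)] by simp
  also have "\<dots> = (\<Sum>i<dim V. l2_inner f (b i) * l2_inner (b i) g)"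
    using assms V by (intro l2_inner_sum_left) (auto intro: basis_form)
  finally show ?thesis
    by (simp add: l2_inner_commute[of "b _" g])
qed

lemma kernel_reproducing:
  assumes "f \<in> V"
  shows "l2_inner f (kernel x) = f x"
proof -
  have "l2_inner (kernel x) (b i) = b i x" if "i < dim V" for i
    using that by (simp add: kernel_def l2_inner_comb)
  then have "(\<Sum>i<dim V. l2_inner f (b i) * l2_inner (kernel x) (b i)) = (\<Sum>i<dim V. l2_inner f (b i) * b i x)"
    by (intro sum.cong) auto
  then show ?thesis
    using l2_inner_expansion[OF assms kernel_in, of x] expansion_apply[OF assms, of x] by (simp only:)
qed

lemma kernel_diagonal: "kernel x x = (\<Sum>i<dim V. (b i x)\<^sup>2)"
  by (simp add: kernel_def sum_fun_apply power2_eq_square)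

end

text \<open>Two instances are needed: all forms of a given degree, to bound powers of
  \<open>f\<close>, and the forms of mean zero.\<close>

locale invariant_form_space = form_space V d b for V :: "(real ^ 'n \<Rightarrow> real) set" and d b +
  assumes rotation_in: "orthogonal_transformation T \<Longrightarrow> f \<in> V \<Longrightarrow> (\<lambda>x. f (T x)) \<in> V"
begin

text \<open>Rotate \<open>kernel x\<close> so that its value at \<open>x\<close> is taken at
  \<open>y\<close>: then \<open>kernel x x\<close> is the inner product of the rotated kernel with
  \<open>kernel y\<close>, and Cauchy-Schwarz applies because rotation keeps the L2 norm.\<close>

lemma kernel_diagonal_le:
  assumes "norm x = norm y"
  shows "kernel x x \<le> kernel y y"
proof -
  obtain T where T: "orthogonal_transformation T" "T y = x"
    using orthogonal_transformation_exists[of y x] assms by metis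
  have kV: "kernel z \<in> forms d" for z
    using kernel_in V by blast
  have rV: "(\<lambda>z. kernel x (T z)) \<in> V"
    by (rule rotation_in[OF T(1) kernel_in])
  then have "kernel x x = l2_inner (\<lambda>z. kernel x (T z)) (kernel y)"
    by (simp add: kernel_reproducing T(2))
  then have "(kernel x x)\<^sup>2 \<le> l2_inner (\<lambda>z. kernel x (T z)) (\<lambda>z. kernel x (T z)) * l2_inner (kernel y) (kernel y)"
    using l2_cauchy_schwarz[of "\<lambda>z. kernel x (T z)" d "kernel y"] rV V kV by (simp add: subset_iff)
  also have "\<dots> = kernel x x * kernel y y"
    by (simp add: l2_inner_rotation[OF T(1) kV kV] kernel_reproducing kernel_in)
  finally have le: "kernel x x * kernel x x \<le> kernel x x * kernel y y"
    by (simp add: power2_eq_square)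
  have "kernel z z \<ge> 0" for z
    by (simp add: kernel_diagonal sum_nonneg)
  then show ?thesis
    using le mult_le_cancel_left_pos[of "kernel x x"] by (cases "kernel x x = 0") (auto simp: less_le)
qed

text \<open>The diagonal is constant on the sphere, and its integral is the sum of the squared norms
  of the basis elements.\<close>

lemma kernel_diagonal_eq_dim:
  assumes "norm x = 1"
  shows "kernel x x = dim V"
proof -
  have const: "kernel y y = kernel x x" if "norm y = 1" for y
    using kernel_diagonal_le[of x y] kernel_diagonal_le[of y x] assms that by simp
  have cont: "continuous_on UNIV (\<lambda>y. kernel y y)"
    unfolding kernel_diagonal using form_continuous[OF basis_form] by (intro continuous_intros) auto
  have "kernel x x = (\<integral>y. kernel y y \<partial>sphere_measure)"
    using sphere_integral_cong[OF cont continuous_on_const const] by (simp only: sphere_integral_const)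
  also have "\<dots> = (\<Sum>i<dim V. l2_inner (b i) (b i))"
    unfolding kernel_diagonal l2_inner_def power2_eq_square
    by (rule Bochner_Integration.integral_sum) (auto intro: l2_inner_form_integrable[OF basis_form basis_form])
  also have "\<dots> = dim V"
    by (simp add: basis_orthonormal)
  finally show ?thesis .
qed

lemma kernel_norm: "norm x = 1 \<Longrightarrow> l2_inner (kernel x) (kernel x) = dim V"
  by (simp add: kernel_reproducing kernel_in kernel_diagonal_eq_dim)

lemma sup_bound:
  assumes "f \<in> V" "norm x = 1"
  shows "(f x)\<^sup>2 \<le> dim V * l2_inner f f"
  using l2_cauchy_schwarz[of f d "kernel x"] assms kernel_in V
  by (simp add: kernel_reproducing kernel_diagonal_eq_dim subset_iff mult.commute)

end

lemma form_sup_bound: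
  fixes f :: "real ^ 'n \<Rightarrow> real"
  assumes "f \<in> forms d" "norm x = 1"
  shows "(f x)\<^sup>2 \<le> dim (forms d :: (real ^ 'n \<Rightarrow> real) set) * l2_inner f f"
proof -
  obtain b :: "nat \<Rightarrow> real ^ 'n \<Rightarrow> real" where "l2_orthonormal_basis (forms d) b"
    using l2_orthonormal_basis_exists[OF subspace_forms order_refl] by blast
  then interpret invariant_form_space "forms d :: (real ^ 'n \<Rightarrow> real) set" d b
    by unfold_locales (auto simp: subspace_forms intro: form_compose_linear orthogonal_transformation_linear)
  show ?thesis
    by (rule sup_bound[OF assms])
qed

section \<open>The dimension of the space of forms\<close>

lemma dim_forms_le: "dim (forms d :: (real ^ 'n \<Rightarrow> real) set) \<le> (d + CARD('n) - 1) choose d"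
proof -
  define X where "X = {\<alpha> :: 'n \<Rightarrow> nat. (\<Sum>i\<in>UNIV. \<alpha> i) = d}"
  obtain xs :: "'n list" where xs: "set xs = UNIV" "distinct xs"
    using finite_distinct_list[of "UNIV :: 'n set"] by auto
  have len: "length xs = CARD('n)"
    using distinct_card[OF xs(2)] xs(1) by simp
  define Y where "Y = {l :: nat list. length l = CARD('n) \<and> sum_list l = d}"
  have "dim (forms d :: (real ^ 'n \<Rightarrow> real) set) \<le> card (monomial ` X)"
    using finite_monomials by (intro dim_le_card) (auto simp: forms_def X_def)
  also have "\<dots> \<le> card X"
    using finite_monomials by (intro card_image_le) (simp add: X_def)
  also have "\<dots> \<le> card Y"
  proof (rule card_inj_on_le[where f = "\<lambda>\<alpha>. map \<alpha> xs"])
    show "inj_on (\<lambda>\<alpha>. map \<alpha> xs) X"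
      using xs(1) by (auto simp: inj_on_def map_eq_conv fun_eq_iff)
    show "(\<lambda>\<alpha>. map \<alpha> xs) ` X \<subseteq> Y"
      using xs len by (auto simp: X_def Y_def sum_list_distinct_conv_sum_set)
    have "Y \<subseteq> {l. set l \<subseteq> {..d} \<and> length l = CARD('n)}"
      by (auto simp: Y_def intro: member_le_sum_list)
    then show "finite Y"
      by (rule finite_subset) (simp add: finite_lists_length_eq)
  qed
  also have "\<dots> = (d + CARD('n) - 1) choose d"
    unfolding Y_def by (rule card_length_sum_list)
  finally show ?thesis .
qed

text \<open>From \<open>binomial (N + n - 1) (n - 1) * (n - 1)! \<le> ((2k+1) n)^(n-1)\<close> with
  \<open>N = 2kn\<close>, multiplied by \<open>(2k+1) n\<close>. The factorial is kept on the left
  because it is to cancel the one in \<open>evaluation_moment\<close>; the factor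
  \<open>2k + 1\<close> is gained because only \<open>n - 1\<close> powers are lost.\<close>

lemma dim_forms_fact_le:
  "dim (forms (2 * k * CARD('n)) :: (real ^ 'n \<Rightarrow> real) set) * fact CARD('n) * (2 * k + 1) \<le>
    ((2 * k + 1) * CARD('n)) ^ CARD('n)"
proof -
  define n where "n = CARD('n)"
  have n: "n > 0"
    by (simp add: n_def)
  define d where "d = 2 * k * n"
  have "(d + n - 1) choose d = (d + n - 1) choose (n - 1)"
    using n by (subst binomial_symmetric) auto
  then have "dim (forms d :: (real ^ 'n \<Rightarrow> real) set) * fact (n - 1) \<le> ((d + n - 1) choose (n - 1)) * fact (n - 1)"
    using dim_forms_le[of d, where 'n = 'n] by (simp add: n_def)
  also have "\<dots> \<le> (d + n - 1) ^ (n - 1)"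
    by (rule binomial_fact_pow)
  also have "\<dots> \<le> ((2 * k + 1) * n) ^ (n - 1)"
    by (intro power_mono) (auto simp: d_def algebra_simps)
  finally have "dim (forms d :: (real ^ 'n \<Rightarrow> real) set) * fact (n - 1) * ((2 * k + 1) * n) \<le>
      ((2 * k + 1) * n) ^ (n - 1) * ((2 * k + 1) * n)"
    by (rule mult_right_mono) simp
  also have "\<dots> = ((2 * k + 1) * n) ^ n"
    using n by (simp add: power_eq_if mult.commute)
  finally show ?thesis
    by (simp only: n_def[symmetric] d_def fact_reduce[OF n] of_nat_id mult_ac)
qed

section \<open>Lebesgue measure on a space of forms\<close>

lemma sets_Collect_preimage:
  assumes "g \<in> M \<rightarrow>\<^sub>M N" "A \<in> sets N"
  shows "{x \<in> space M. g x \<in> A} \<in> sets M"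
proof -
  have "{x \<in> space M. g x \<in> A} = g -` A \<inter> space M"
    by blast
  then show ?thesis
    using measurable_sets[OF assms] by simp
qed

text \<open>A product measure is determined by its values on boxes, and there the claim is
  one-dimensional affine substitution in each coordinate.\<close>

lemma PiM_lborel_affine:
  fixes I :: "'i set" and t :: "'i \<Rightarrow> real"
  assumes I: "finite I" and a: "a \<noteq> 0"
  shows "PiM I (\<lambda>_. lborel) =
    density (distr (PiM I (\<lambda>_. lborel)) (PiM I (\<lambda>_. lborel)) (\<lambda>c. \<lambda>i\<in>I. t i + a * c i)) (\<lambda>_. ennreal (\<bar>a\<bar> ^ card I))"
    (is "_ = ?P")
proof -
  interpret product_sigma_finite "\<lambda>_ :: 'i. lborel :: real measure" ..
  have [measurable]: "(\<lambda>c. \<lambda>i\<in>I. t i + a * c i) \<in> PiM I (\<lambda>_. lborel) \<rightarrow>\<^sub>M PiM I (\<lambda>_. lborel)"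
    by measurable
  have "?P = PiM I (\<lambda>_. lborel)"
  proof (rule PiM_eqI[OF I])
    fix A :: "'i \<Rightarrow> real set"
    assume A: "\<And>i. i \<in> I \<Longrightarrow> A i \<in> sets lborel"
    have comp: "emeasure lborel (A i) = ennreal \<bar>a\<bar> * emeasure lborel {z. t i + a * z \<in> A i}" if "i \<in> I" for i
    proof -
      have [measurable]: "A i \<in> sets borel"
        using A[OF that] by simp
      have "{z. t i + a * z \<in> A i} \<in> sets lborel"
        by measurable
      then have "(\<integral>\<^sup>+z. indicator {z. t i + a * z \<in> A i} z \<partial>lborel) = emeasure lborel {z. t i + a * z \<in> A i}"
        by (rule nn_integral_indicator)
      moreover have "indicator {z. t i + a * z \<in> A i} z = (indicator (A i) (t i + a * z) :: ennreal)" for z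
        by (simp add: indicator_def)
      ultimately have "(\<integral>\<^sup>+z. indicator (A i) (t i + a * z) \<partial>lborel) = emeasure lborel {z. t i + a * z \<in> A i}"
        by (simp only:)
      then show ?thesis
        using nn_integral_real_affine[of "indicator (A i)" a "t i"] a by simp
    qed
    have sets_comp: "{z. t i + a * z \<in> A i} \<in> sets lborel" if "i \<in> I" for i
    proof -
      have [measurable]: "A i \<in> sets borel"
        using A[OF that] by simp
      show ?thesis
        by measurable
    qed
    have PA: "Pi\<^sub>E I A \<in> sets (PiM I (\<lambda>_. lborel))"
      using A by (intro sets_PiM_I_finite I) auto
    have "emeasure ?P (Pi\<^sub>E I A) = ennreal (\<bar>a\<bar> ^ card I) *
        emeasure (PiM I (\<lambda>_. lborel)) ((\<lambda>c. \<lambda>i\<in>I. t i + a * c i) -` Pi\<^sub>E I A \<inter> space (PiM I (\<lambda>_. lborel)))"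
      using PA by (simp add: emeasure_density nn_integral_cmult_indicator emeasure_distr)
    also have "(\<lambda>c. \<lambda>i\<in>I. t i + a * c i) -` Pi\<^sub>E I A \<inter> space (PiM I (\<lambda>_. lborel)) = Pi\<^sub>E I (\<lambda>i. {z. t i + a * z \<in> A i})"
      by (auto simp: space_PiM PiE_def extensional_def Pi_def)
    also have "emeasure (PiM I (\<lambda>_. lborel)) \<dots> = (\<Prod>i\<in>I. emeasure lborel {z. t i + a * z \<in> A i})"
      using sets_comp by (intro emeasure_PiM I) auto
    also have "ennreal (\<bar>a\<bar> ^ card I) * \<dots> = (\<Prod>i\<in>I. ennreal \<bar>a\<bar> * emeasure lborel {z. t i + a * z \<in> A i})"
      by (simp add: prod.distrib ennreal_power)
    also have "\<dots> = (\<Prod>i\<in>I. emeasure lborel (A i))"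
      by (intro prod.cong refl comp[symmetric])
    finally show "emeasure ?P (Pi\<^sub>E I A) = (\<Prod>i\<in>I. emeasure lborel (A i))" .
  qed simp
  then show ?thesis ..
qed

section \<open>Volume on a space of forms and its behaviour under affine maps\<close>

context form_space
begin

definition coordinates :: "(real ^ 'n \<Rightarrow> real) \<Rightarrow> nat \<Rightarrow> real" where
  "coordinates f = (\<lambda>i\<in>{..<dim V}. l2_inner f (b i))"

definition combination :: "(nat \<Rightarrow> real) \<Rightarrow> real ^ 'n \<Rightarrow> real" where
  "combination c = (\<Sum>i<dim V. c i *\<^sub>R b i)"

abbreviation L :: "(nat \<Rightarrow> real) measure" where
  "L \<equiv> PiM {..<dim V} (\<lambda>_. lborel)"

text \<open>Turning the coordinate volume into a measure on functions makes Fubini and substitution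
  available without coordinates. The sigma-algebra is pulled back along the coordinate map, so a map
  into \<open>V\<close> is measurable as soon as its coordinates are.\<close>

definition vol :: "(real ^ 'n \<Rightarrow> real) measure" where
  "vol = distr L (vimage_algebra V coordinates L) combination"

lemma space_vol [simp]: "space vol = V"
  by (simp add: vol_def)

lemma combination_in: "combination c \<in> V"
  unfolding combination_def by (rule comb_in)

lemma coordinates_space: "coordinates f \<in> space L"
  by (simp add: coordinates_def space_PiM)

lemma measurable_into_vol:
  assumes "\<And>y. y \<in> space Y \<Longrightarrow> g y \<in> V"
    and "\<And>i. i < dim V \<Longrightarrow> (\<lambda>y. l2_inner (g y) (b i)) \<in> borel_measurable Y"
  shows "g \<in> Y \<rightarrow>\<^sub>M vol"
proof -
  have "(\<lambda>y. coordinates (g y)) \<in> Y \<rightarrow>\<^sub>M L"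
    unfolding coordinates_def using assms(2) by (intro measurable_restrict) auto
  then have "g \<in> Y \<rightarrow>\<^sub>M vimage_algebra V coordinates L"
    using assms(1) by (intro measurable_vimage_algebra2) auto
  then show ?thesis
    by (simp add: vol_def)
qed

lemma combination_measurable [measurable]: "combination \<in> L \<rightarrow>\<^sub>M vol"
proof (rule measurable_into_vol)
  fix i
  assume i: "i < dim V"
  then have "(\<lambda>c. c i) \<in> borel_measurable L"
    using measurable_component_singleton[of i "{..<dim V}" "\<lambda>_. lborel :: real measure"] by simp
  then show "(\<lambda>c. l2_inner (combination c) (b i)) \<in> borel_measurable L"
    using i by (simp add: combination_def l2_inner_comb)
qed (rule combination_in)

lemma coordinate_measurable [measurable]:
  assumes "i < dim V"
  shows "(\<lambda>f. l2_inner f (b i)) \<in> borel_measurable vol"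
proof -
  have "coordinates \<in> vimage_algebra V coordinates L \<rightarrow>\<^sub>M L"
    using coordinates_space by (intro measurable_vimage_algebra1) auto
  moreover have "(\<lambda>c. c i) \<in> borel_measurable L"
    using measurable_component_singleton[of i "{..<dim V}" "\<lambda>_. lborel :: real measure"] assms by simp
  ultimately have "(\<lambda>f. coordinates f i) \<in> borel_measurable (vimage_algebra V coordinates L)"
    by (rule measurable_compose)
  then show ?thesis
    using assms by (simp add: coordinates_def vol_def)
qed

lemma l2_inner_measurable:
  assumes "g \<in> V"
  shows "(\<lambda>f. l2_inner f g) \<in> borel_measurable vol"
proof -
  have "(\<lambda>f. \<Sum>i<dim V. l2_inner f (b i) * l2_inner g (b i)) \<in> borel_measurable vol"
    by measurable
  then show ?thesis
    using assms by (subst measurable_cong[OF l2_inner_expansion]) auto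
qed

lemma l2_norm_measurable [measurable]: "(\<lambda>f. l2_inner f f) \<in> borel_measurable vol"
proof -
  have "(\<lambda>f. \<Sum>i<dim V. l2_inner f (b i) * l2_inner f (b i)) \<in> borel_measurable vol"
    by measurable
  then show ?thesis
    by (subst measurable_cong[OF l2_inner_expansion]) auto
qed

lemma evaluation_measurable_pair: "(\<lambda>(f, x). f x) \<in> borel_measurable (vol \<Otimes>\<^sub>M borel)"
proof -
  have [measurable]: "b i \<in> borel_measurable borel" if "i < dim V" for i
    by (rule borel_measurable_continuous_onI[OF form_continuous[OF basis_form[OF that]]])
  have "(\<lambda>p. \<Sum>i<dim V. l2_inner (fst p) (b i) * b i (snd p)) \<in> borel_measurable (vol \<Otimes>\<^sub>M borel)"
    by measurable
  moreover have "fst p (snd p) = (\<Sum>i<dim V. l2_inner (fst p) (b i) * b i (snd p))"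
    if "p \<in> space (vol \<Otimes>\<^sub>M borel)" for p
    using that by (intro expansion_apply) (auto simp: space_pair_measure)
  ultimately show ?thesis
    by (subst measurable_cong[of _ _ "\<lambda>p. \<Sum>i<dim V. l2_inner (fst p) (b i) * b i (snd p)"])
      (auto simp: split_beta)
qed

lemma evaluation_measurable [measurable]: "(\<lambda>f. f x) \<in> borel_measurable vol"
proof -
  have "(\<lambda>f. \<Sum>i<dim V. l2_inner f (b i) * b i x) \<in> borel_measurable vol"
    by measurable
  then show ?thesis
    by (subst measurable_cong[OF expansion_apply]) auto
qed

lemma form_in_V: "f \<in> V \<Longrightarrow> f \<in> forms d"
  using V by blast

lemma l2_inner_affine:
  assumes "v \<in> V" "f \<in> V" "g \<in> V"
  shows "l2_inner (v + a *\<^sub>R f) g = l2_inner v g + a * l2_inner f g"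
  using assms by (subst l2_inner_add_left[where d = d])
    (auto intro: form_in_V subspace_scale[OF V(1)] simp: l2_inner_scaleR_left)

lemma affine_in: "v \<in> V \<Longrightarrow> f \<in> V \<Longrightarrow> v + a *\<^sub>R f \<in> V"
  using V by (intro subspace_add subspace_scale) auto

lemma affine_measurable [measurable]:
  assumes [measurable]: "p \<in> Y \<rightarrow>\<^sub>M vol" "q \<in> Y \<rightarrow>\<^sub>M vol"
  shows "(\<lambda>y. p y + a *\<^sub>R q y) \<in> Y \<rightarrow>\<^sub>M vol"
proof (rule measurable_into_vol)
  have in_V: "p y \<in> V" "q y \<in> V" if "y \<in> space Y" for y
    using measurable_space[OF assms(1) that] measurable_space[OF assms(2) that] by simp_all
  show "p y + a *\<^sub>R q y \<in> V" if "y \<in> space Y" for y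
    using in_V[OF that] by (rule affine_in)
  fix i
  assume i: "i < dim V"
  have "l2_inner (p y + a *\<^sub>R q y) (b i) = l2_inner (p y) (b i) + a * l2_inner (q y) (b i)" if "y \<in> space Y" for y
    using in_V[OF that] basis_in[OF i] by (rule l2_inner_affine)
  moreover have "(\<lambda>y. l2_inner (p y) (b i) + a * l2_inner (q y) (b i)) \<in> borel_measurable Y"
    using measurable_compose[OF assms(1) coordinate_measurable[OF i]]
      measurable_compose[OF assms(2) coordinate_measurable[OF i]] by measurable
  ultimately show "(\<lambda>y. l2_inner (p y + a *\<^sub>R q y) (b i)) \<in> borel_measurable Y"
    by (subst measurable_cong) auto
qed

lemma nn_integral_vol:
  "g \<in> borel_measurable vol \<Longrightarrow> (\<integral>\<^sup>+f. g f \<partial>vol) = (\<integral>\<^sup>+c. g (combination c) \<partial>L)"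
  using combination_measurable by (simp add: vol_def nn_integral_distr)

lemma emeasure_vol:
  "A \<in> sets vol \<Longrightarrow> emeasure vol A = emeasure L {c \<in> space L. combination c \<in> A}"
  using combination_measurable
  by (simp add: vol_def emeasure_distr) (simp add: vimage_def Int_def conj_commute)

lemma nn_integral_vol_affine:
  assumes g [measurable]: "g \<in> borel_measurable vol" and v: "v \<in> V" and a: "a \<noteq> 0"
  shows "(\<integral>\<^sup>+f. g f \<partial>vol) = ennreal (\<bar>a\<bar> ^ dim V) * (\<integral>\<^sup>+f. g (v + a *\<^sub>R f) \<partial>vol)"
proof -
  define t where "t i = l2_inner v (b i)" for i
  have [measurable]: "(\<lambda>c. \<lambda>i\<in>{..<dim V}. t i + a * c i) \<in> L \<rightarrow>\<^sub>M L"
    by measurable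
  have g': "(\<lambda>c. g (combination c)) \<in> borel_measurable L"
    by measurable
  have comb: "combination (\<lambda>i\<in>{..<dim V}. t i + a * c i) = v + a *\<^sub>R combination c" for c
  proof -
    have "combination (\<lambda>i\<in>{..<dim V}. t i + a * c i) = (\<Sum>i<dim V. t i *\<^sub>R b i) + a *\<^sub>R combination c"
      by (simp add: combination_def scaleR_add_left sum.distrib scaleR_sum_right)
    then show ?thesis
      using expansion[OF v] by (simp add: t_def)
  qed
  have [measurable]: "(\<lambda>f. g (v + a *\<^sub>R f)) \<in> borel_measurable vol"
    using v by (intro measurable_compose[OF affine_measurable g]) auto
  have "(\<integral>\<^sup>+f. g f \<partial>vol) = (\<integral>\<^sup>+c. g (combination c) \<partial>density
      (distr L L (\<lambda>c. \<lambda>i\<in>{..<dim V}. t i + a * c i)) (\<lambda>_. ennreal (\<bar>a\<bar> ^ card {..<dim V})))"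
    by (subst PiM_lborel_affine[OF finite_lessThan a, of "dim V" t, symmetric]) (rule nn_integral_vol[OF g])
  also have "\<dots> = ennreal (\<bar>a\<bar> ^ dim V) * (\<integral>\<^sup>+c. g (combination (\<lambda>i\<in>{..<dim V}. t i + a * c i)) \<partial>L)"
    using g' by (simp add: nn_integral_density nn_integral_cmult nn_integral_distr)
  also have "\<dots> = ennreal (\<bar>a\<bar> ^ dim V) * (\<integral>\<^sup>+f. g (v + a *\<^sub>R f) \<partial>vol)"
    unfolding comb by (simp add: nn_integral_vol)
  finally show ?thesis .
qed

lemma emeasure_vol_affine:
  assumes A [measurable]: "A \<in> sets vol" and v: "v \<in> V" and a: "a \<noteq> 0"
  shows "emeasure vol A = ennreal (\<bar>a\<bar> ^ dim V) * emeasure vol {f \<in> V. v + a *\<^sub>R f \<in> A}"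
proof -
  have "{f \<in> space vol. v + a *\<^sub>R f \<in> A} \<in> sets vol"
    by (rule sets_Collect_preimage[OF affine_measurable A]) (use v in simp_all)
  then have "(\<integral>\<^sup>+f. indicator {f \<in> V. v + a *\<^sub>R f \<in> A} f \<partial>vol) = emeasure vol {f \<in> V. v + a *\<^sub>R f \<in> A}"
    by (intro nn_integral_indicator) simp
  moreover have "(\<integral>\<^sup>+f. indicator A (v + a *\<^sub>R f) \<partial>vol) =
      (\<integral>\<^sup>+f. indicator {f \<in> V. v + a *\<^sub>R f \<in> A} f \<partial>vol)"
    by (intro nn_integral_cong) (simp add: indicator_def)
  moreover have "emeasure vol A = (\<integral>\<^sup>+f. indicator A f \<partial>vol)"
    by simp
  moreover have "(\<integral>\<^sup>+f. indicator A f \<partial>vol) = ennreal (\<bar>a\<bar> ^ dim V) * (\<integral>\<^sup>+f. indicator A (v + a *\<^sub>R f) \<partial>vol)"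
    by (rule nn_integral_vol_affine[OF _ v a]) measurable
  ultimately show ?thesis
    by (simp only:)
qed

lemma emeasure_vol_box:
  assumes "r \<ge> 0"
  shows "emeasure vol {f \<in> V. \<forall>i<dim V. \<bar>l2_inner f (b i)\<bar> \<le> r} = ennreal ((2 * r) ^ dim V)"
    and "{f \<in> V. \<forall>i<dim V. \<bar>l2_inner f (b i)\<bar> \<le> r} \<in> sets vol"
proof -
  interpret product_sigma_finite "\<lambda>_ :: nat. lborel :: real measure" ..
  have "{f \<in> space vol. \<forall>i\<in>{..<dim V}. \<bar>l2_inner f (b i)\<bar> \<le> r} \<in> sets vol"
    by measurable
  then show S: "{f \<in> V. \<forall>i<dim V. \<bar>l2_inner f (b i)\<bar> \<le> r} \<in> sets vol"
    unfolding space_vol Ball_def lessThan_iff .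
  have "{c \<in> space L. combination c \<in> {f \<in> V. \<forall>i<dim V. \<bar>l2_inner f (b i)\<bar> \<le> r}} = Pi\<^sub>E {..<dim V} (\<lambda>_. {-r..r})"
    using combination_in
    by (auto simp: combination_def l2_inner_comb space_PiM PiE_def Pi_def abs_le_iff minus_le_iff)
  then have "emeasure vol {f \<in> V. \<forall>i<dim V. \<bar>l2_inner f (b i)\<bar> \<le> r} = (\<Prod>i<dim V. emeasure lborel {-r..r})"
    unfolding emeasure_vol[OF S] by (simp add: emeasure_PiM)
  then show "emeasure vol {f \<in> V. \<forall>i<dim V. \<bar>l2_inner f (b i)\<bar> \<le> r} = ennreal ((2 * r) ^ dim V)"
    using assms by (simp add: ennreal_power)
qed

lemma sigma_finite_vol: "sigma_finite_measure vol"
proof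
  define A where "A m = {f \<in> V. \<forall>i<dim V. \<bar>l2_inner f (b i)\<bar> \<le> real m}" for m
  have "V \<subseteq> (\<Union>m. A m)"
  proof
    fix f
    assume "f \<in> V"
    obtain m where m: "(\<Sum>i<dim V. \<bar>l2_inner f (b i)\<bar>) \<le> real m"
      using real_arch_simple by blast
    have "\<bar>l2_inner f (b i)\<bar> \<le> real m" if "i < dim V" for i
      using member_le_sum[of i "{..<dim V}" "\<lambda>i. \<bar>l2_inner f (b i)\<bar>"] that m by simp
    then show "f \<in> (\<Union>m. A m)"
      using \<open>f \<in> V\<close> by (auto simp: A_def)
  qed
  moreover have "A m \<subseteq> V" for m
    by (auto simp: A_def)
  moreover have "A m \<in> sets vol" "emeasure vol (A m) \<noteq> \<infinity>" for m
    unfolding A_def emeasure_vol_box(1)[OF of_nat_0_le_iff] by (rule emeasure_vol_box(2)) simp_all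
  ultimately show "\<exists>A. countable A \<and> A \<subseteq> sets vol \<and> \<Union> A = space vol \<and> (\<forall>a\<in>A. emeasure vol a \<noteq> \<infinity>)"
    unfolding space_vol by (intro exI[of _ "range A"]) blast
qed

definition l2_ball :: "(real ^ 'n \<Rightarrow> real) set" where
  "l2_ball = {f \<in> V. l2_inner f f \<le> 1}"

lemma l2_ball_sets [measurable]: "l2_ball \<in> sets vol"
proof -
  have "{f \<in> space vol. l2_inner f f \<le> 1} \<in> sets vol"
    by measurable
  then show ?thesis
    by (simp add: l2_ball_def)
qed

lemma coordinate_square_le: "f \<in> V \<Longrightarrow> i < dim V \<Longrightarrow> (l2_inner f (b i))\<^sup>2 \<le> l2_inner f f"
  using l2_cauchy_schwarz[of f d "b i"] by (simp add: form_in_V basis_form basis_orthonormal)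

lemma l2_ball_finite: "emeasure vol l2_ball < \<infinity>"
proof -
  have "l2_ball \<subseteq> {f \<in> V. \<forall>i<dim V. \<bar>l2_inner f (b i)\<bar> \<le> 1}"
    using coordinate_square_le by (fastforce simp: l2_ball_def abs_square_le_1[symmetric] intro: order_trans)
  then have "emeasure vol l2_ball \<le> emeasure vol {f \<in> V. \<forall>i<dim V. \<bar>l2_inner f (b i)\<bar> \<le> 1}"
    by (intro emeasure_mono emeasure_vol_box(2)) simp_all
  also have "\<dots> < \<infinity>"
    by (subst emeasure_vol_box(1)) simp_all
  finally show ?thesis .
qed

lemma l2_ball_pos: "emeasure vol l2_ball > 0"
proof -
  \<comment> \<open>The cube of half-width \<open>r\<close> lies in the ball because
    \<open>dim V * r^2 \<le> dim V * r \<le> 1\<close>; the added 1 covers dimension 0.\<close>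
  define r where "r = 1 / (real (dim V) + 1)"
  have r: "r > 0" "r \<le> 1" "real (dim V) * r \<le> 1"
    by (auto simp: r_def field_simps)
  have "l2_inner f f \<le> 1" if f: "f \<in> V" "\<And>i. i < dim V \<Longrightarrow> \<bar>l2_inner f (b i)\<bar> \<le> r" for f
  proof -
    have "l2_inner f f = (\<Sum>i<dim V. (l2_inner f (b i))\<^sup>2)"
      using f by (simp add: l2_inner_expansion power2_eq_square)
    also have "\<dots> \<le> (\<Sum>i<dim V. r)"
    proof (rule sum_mono)
      fix i
      assume "i \<in> {..<dim V}"
      then have "\<bar>l2_inner f (b i)\<bar> * \<bar>l2_inner f (b i)\<bar> \<le> r * 1"
        using f(2)[of i] r by (intro mult_mono) auto
      then show "(l2_inner f (b i))\<^sup>2 \<le> r"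
        by (simp add: power2_eq_square)
    qed
    finally show ?thesis
      using r by simp
  qed
  then have "{f \<in> V. \<forall>i<dim V. \<bar>l2_inner f (b i)\<bar> \<le> r} \<subseteq> l2_ball"
    by (auto simp: l2_ball_def)
  then have "emeasure vol {f \<in> V. \<forall>i<dim V. \<bar>l2_inner f (b i)\<bar> \<le> r} \<le> emeasure vol l2_ball"
    by (intro emeasure_mono l2_ball_sets)
  moreover have "0 < emeasure vol {f \<in> V. \<forall>i<dim V. \<bar>l2_inner f (b i)\<bar> \<le> r}"
    using r by (subst emeasure_vol_box(1)) simp_all
  ultimately show ?thesis
    by (rule less_le_trans[rotated])
qed

lemma emeasure_l2_ball_affine:
  assumes v: "v \<in> V" and r: "r > 0"
  shows "emeasure vol {f \<in> V. l2_inner (f - v) (f - v) \<le> r\<^sup>2} = ennreal (r ^ dim V) * emeasure vol l2_ball"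
    and "{f \<in> V. l2_inner (f - v) (f - v) \<le> r\<^sup>2} \<in> sets vol"
proof -
  have "(\<lambda>f. f + - 1 *\<^sub>R v) \<in> vol \<rightarrow>\<^sub>M vol"
    using v by (intro affine_measurable) auto
  then have "(\<lambda>f. f - v) \<in> vol \<rightarrow>\<^sub>M vol"
    by simp
  then have "{f \<in> space vol. l2_inner (f - v) (f - v) \<le> r\<^sup>2} \<in> sets vol"
    using measurable_compose[OF _ l2_norm_measurable] by measurable
  then show S: "{f \<in> V. l2_inner (f - v) (f - v) \<le> r\<^sup>2} \<in> sets vol"
    by simp
  have "{f \<in> V. v + r *\<^sub>R f \<in> {f \<in> V. l2_inner (f - v) (f - v) \<le> r\<^sup>2}} = l2_ball"
    using r affine_in[OF v]
    by (auto simp: l2_ball_def l2_inner_scaleR_left l2_inner_scaleR_right power2_eq_square mult_le_cancel_left_pos)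
  then show "emeasure vol {f \<in> V. l2_inner (f - v) (f - v) \<le> r\<^sup>2} = ennreal (r ^ dim V) * emeasure vol l2_ball"
    using emeasure_vol_affine[OF S v, of r] r by simp
qed

text \<open>Prekopa-Leindler for indicator functions in coordinates. The multiplicative form is free
  of the dimension and also holds for empty sets.\<close>

lemma brunn_minkowski:
  assumes [measurable]: "A \<in> sets vol" "B \<in> sets vol" "C \<in> sets vol"
    and mid: "\<And>f g. f \<in> A \<Longrightarrow> g \<in> B \<Longrightarrow> (1 / 2) *\<^sub>R (f + g) \<in> C"
  shows "emeasure vol A * emeasure vol B \<le> (emeasure vol C)\<^sup>2"
proof -
  have ind: "emeasure vol X = (\<integral>\<^sup>+c. indicator X (combination c) \<partial>L)" if "X \<in> sets vol" for X
    using that nn_integral_vol[of "indicator X"] by simp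
  have "(\<integral>\<^sup>+c. indicator A (combination c) \<partial>L) * (\<integral>\<^sup>+c. indicator B (combination c) \<partial>L) \<le>
      (\<integral>\<^sup>+c. indicator C (combination c) \<partial>L)\<^sup>2"
  proof (rule prekopa_leindler_PiM[of "{..<dim V}" "\<lambda>c. indicator A (combination c)"
        "\<lambda>c. indicator B (combination c)" "\<lambda>c. indicator C (combination c)"])
    fix x y
    have "combination (\<lambda>i\<in>{..<dim V}. (x i + y i) / 2) = (\<Sum>i<dim V. (1 / 2) *\<^sub>R (x i *\<^sub>R b i + y i *\<^sub>R b i))"
      unfolding combination_def
      by (intro sum.cong refl) (simp only: scaleR_add_left[symmetric], simp)
    also have "\<dots> = (1 / 2) *\<^sub>R (combination x + combination y)"
      by (simp add: combination_def scaleR_sum_right[symmetric] sum.distrib)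
    finally show "indicator A (combination x) * indicator B (combination y) \<le>
        (indicator C (combination (\<lambda>i\<in>{..<dim V}. (x i + y i) / 2)) :: ennreal)\<^sup>2"
      using mid by (auto simp: indicator_def)
  qed measurable
  then show ?thesis
    by (simp only: ind[OF assms(1)] ind[OF assms(2)] ind[OF assms(3)])
qed

end

section \<open>Rotation invariance of the volume\<close>

context invariant_form_space
begin

text \<open>Evaluating \<open>\<integral>\<integral> 1\<^sub>B(f) 1\<^sub>A(f + g \<circ> T) df dg\<close> in both orders, with \<open>B\<close> the unit ball.\<close>

lemma emeasure_vol_rotation:
  assumes T: "orthogonal_transformation T" and A [measurable]: "A \<in> sets vol"
  shows "emeasure vol {f \<in> V. (\<lambda>x. f (T x)) \<in> A} = emeasure vol A"
proof -
  interpret sigma_finite_measure vol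
    by (rule sigma_finite_vol)
  interpret pair_sigma_finite vol vol ..
  define R where "R f = (\<lambda>x. f (T x))" for f :: "real ^ 'n \<Rightarrow> real"
  define S where "S f = (\<lambda>x. f (inv T x))" for f :: "real ^ 'n \<Rightarrow> real"
  have invT: "orthogonal_transformation (inv T)"
    by (rule orthogonal_transformation_inv[OF T])
  have RV: "R f \<in> V" if "f \<in> V" for f
    unfolding R_def by (rule rotation_in[OF T that])
  have SV: "S f \<in> V" if "f \<in> V" for f
    unfolding S_def by (rule rotation_in[OF invT that])
  have RS: "R (S f) = f" for f
    using orthogonal_transformation_inj[OF T] by (simp add: R_def S_def inv_f_f)
  have R_inner: "l2_inner (R f) (R g) = l2_inner f g" if "f \<in> V" "g \<in> V" for f g
    unfolding R_def using that by (intro l2_inner_rotation[OF T form_in_V form_in_V])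
  have R_lin: "R (f + g) = R f + R g" "R (f - g) = R f - R g" "R (c *\<^sub>R f) = c *\<^sub>R R f" for f g c
    by (auto simp: R_def fun_eq_iff)
  have R_meas [measurable]: "R \<in> vol \<rightarrow>\<^sub>M vol"
  proof (rule measurable_into_vol)
    fix i
    assume i: "i < dim V"
    have "l2_inner (R f) (b i) = l2_inner f (S (b i))" if "f \<in> V" for f
      using R_inner[OF that SV[OF basis_in[OF i]]] by (simp add: RS)
    then show "(\<lambda>f. l2_inner (R f) (b i)) \<in> borel_measurable vol"
      using l2_inner_measurable[OF SV[OF basis_in[OF i]]] by (subst measurable_cong) auto
  qed (use RV in simp)
  define B where "B = l2_ball"
  have B [measurable]: "B \<in> sets vol"
    by (simp add: B_def)
  have plus [measurable]: "(\<lambda>p. fst p + a *\<^sub>R R (snd p)) \<in> vol \<Otimes>\<^sub>M vol \<rightarrow>\<^sub>M vol" for a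
    by (intro affine_measurable) measurable
  have plus' [measurable]: "(\<lambda>f. f + a *\<^sub>R R g) \<in> vol \<rightarrow>\<^sub>M vol" if "g \<in> V" for a g
    using RV[OF that] by (intro affine_measurable) auto
  have RA: "{f \<in> V. R f \<in> A} \<in> sets vol"
    using sets_Collect_preimage[OF R_meas A] by simp
  have shift: "(\<integral>\<^sup>+g. indicator A (f + 1 *\<^sub>R R g) \<partial>vol) = emeasure vol {f \<in> V. R f \<in> A}" if f: "f \<in> V" for f
  proof -
    have meas: "(\<lambda>g. indicator A (R g) :: ennreal) \<in> borel_measurable vol"
      by measurable
    have "(\<integral>\<^sup>+g. indicator A (R g) \<partial>vol) = (\<integral>\<^sup>+g. indicator A (R (S f + 1 *\<^sub>R g)) \<partial>vol)"
      using nn_integral_vol_affine[OF meas SV[OF f], of 1] by simp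
    moreover have "(\<integral>\<^sup>+g. indicator A (R g) \<partial>vol) = (\<integral>\<^sup>+g. indicator {f \<in> V. R f \<in> A} g \<partial>vol)"
      by (intro nn_integral_cong) (auto simp: indicator_def)
    ultimately show ?thesis
      using RA by (simp add: R_lin RS)
  qed
  have ball: "(\<integral>\<^sup>+g. indicator B (f + - 1 *\<^sub>R R g) \<partial>vol) = emeasure vol B" if f: "f \<in> V" for f
  proof -
    have "indicator B (f + - 1 *\<^sub>R R g) = (indicator B (S f + - 1 *\<^sub>R g) :: ennreal)" if g: "g \<in> V" for g
    proof -
      have eq: "f + - 1 *\<^sub>R R g = R (S f + - 1 *\<^sub>R g)"
        unfolding R_lin RS ..
      have "S f + - 1 *\<^sub>R g \<in> V"
        by (rule affine_in[OF SV[OF f] g])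
      then show ?thesis
        unfolding eq by (simp add: B_def l2_ball_def indicator_def R_inner RV)
    qed
    then have "(\<integral>\<^sup>+g. indicator B (f + - 1 *\<^sub>R R g) \<partial>vol) = (\<integral>\<^sup>+g. indicator B (S f + - 1 *\<^sub>R g) \<partial>vol)"
      by (intro nn_integral_cong) simp
    then show ?thesis
      using nn_integral_vol_affine[of "indicator B" "S f" "-1"] SV[OF f] by simp
  qed
  have "emeasure vol B * emeasure vol {f \<in> V. R f \<in> A} =
      (\<integral>\<^sup>+f. indicator B f * (\<integral>\<^sup>+g. indicator A (f + 1 *\<^sub>R R g) \<partial>vol) \<partial>vol)"
  proof -
    have "(\<integral>\<^sup>+f. indicator B f * (\<integral>\<^sup>+g. indicator A (f + 1 *\<^sub>R R g) \<partial>vol) \<partial>vol) =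
        (\<integral>\<^sup>+f. indicator B f * emeasure vol {f \<in> V. R f \<in> A} \<partial>vol)"
      using shift by (intro nn_integral_cong) simp
    then show ?thesis
      by (simp add: nn_integral_multc)
  qed
  also have "\<dots> = (\<integral>\<^sup>+f. \<integral>\<^sup>+g. indicator B f * indicator A (f + 1 *\<^sub>R R g) \<partial>vol \<partial>vol)"
  proof (rule nn_integral_cong)
    fix f
    assume "f \<in> space vol"
    then have "(\<lambda>g. f + 1 *\<^sub>R R g) \<in> vol \<rightarrow>\<^sub>M vol"
      by (intro affine_measurable) auto
    then have "(\<lambda>g. indicator A (f + 1 *\<^sub>R R g) :: ennreal) \<in> borel_measurable vol"
      by (rule measurable_compose) simp
    then show "indicator B f * (\<integral>\<^sup>+g. indicator A (f + 1 *\<^sub>R R g) \<partial>vol) =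
        (\<integral>\<^sup>+g. indicator B f * indicator A (f + 1 *\<^sub>R R g) \<partial>vol)"
      by (rule nn_integral_cmult[symmetric])
  qed
  also have "\<dots> = (\<integral>\<^sup>+g. \<integral>\<^sup>+f. indicator B f * indicator A (f + 1 *\<^sub>R R g) \<partial>vol \<partial>vol)"
  proof (rule Fubini'[symmetric])
    have "(\<lambda>p. indicator B (fst p) * indicator A (fst p + 1 *\<^sub>R R (snd p)) :: ennreal) \<in> borel_measurable (vol \<Otimes>\<^sub>M vol)"
      using measurable_compose[OF plus[of 1], of "indicator A :: _ \<Rightarrow> ennreal"] by measurable
    then show "(\<lambda>(f, g). indicator B f * indicator A (f + 1 *\<^sub>R R g) :: ennreal) \<in> borel_measurable (vol \<Otimes>\<^sub>M vol)"
      by (simp add: split_beta)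
  qed
  also have "\<dots> = (\<integral>\<^sup>+g. \<integral>\<^sup>+f. indicator B (f + - 1 *\<^sub>R R g) * indicator A f \<partial>vol \<partial>vol)"
  proof (rule nn_integral_cong)
    fix g
    assume g: "g \<in> space vol"
    then have "(\<lambda>f. indicator B (f + - 1 *\<^sub>R R g) * indicator A f :: ennreal) \<in> borel_measurable vol"
      using measurable_compose[OF plus'[of g "- 1"], of "indicator B :: _ \<Rightarrow> ennreal"] by measurable
    from nn_integral_vol_affine[OF this RV, of g 1] g
    have "(\<integral>\<^sup>+f. indicator B (f + - 1 *\<^sub>R R g) * indicator A f \<partial>vol) =
        (\<integral>\<^sup>+f. indicator B (R g + f + - 1 *\<^sub>R R g) * indicator A (R g + f) \<partial>vol)"
      by simp
    then show "(\<integral>\<^sup>+f. indicator B f * indicator A (f + 1 *\<^sub>R R g) \<partial>vol) =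
        (\<integral>\<^sup>+f. indicator B (f + - 1 *\<^sub>R R g) * indicator A f \<partial>vol)"
      by (simp add: add.commute)
  qed
  also have "\<dots> = (\<integral>\<^sup>+f. \<integral>\<^sup>+g. indicator B (f + - 1 *\<^sub>R R g) * indicator A f \<partial>vol \<partial>vol)"
  proof (rule Fubini')
    have "(\<lambda>p. indicator B (fst p + - 1 *\<^sub>R R (snd p)) * indicator A (fst p) :: ennreal) \<in> borel_measurable (vol \<Otimes>\<^sub>M vol)"
      using measurable_compose[OF plus[of "-1"], of "indicator B :: _ \<Rightarrow> ennreal"] by measurable
    then show "(\<lambda>(f, g). indicator B (f + - 1 *\<^sub>R R g) * indicator A f :: ennreal) \<in> borel_measurable (vol \<Otimes>\<^sub>M vol)"
      by (simp add: split_beta)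
  qed
  also have "\<dots> = (\<integral>\<^sup>+f. emeasure vol B * indicator A f \<partial>vol)"
  proof (rule nn_integral_cong)
    fix f
    assume f: "f \<in> space vol"
    then have "(\<lambda>g. f + - 1 *\<^sub>R R g) \<in> vol \<rightarrow>\<^sub>M vol"
      by (intro affine_measurable) auto
    then have "(\<lambda>g. indicator B (f + - 1 *\<^sub>R R g) :: ennreal) \<in> borel_measurable vol"
      by (rule measurable_compose) simp
    then show "(\<integral>\<^sup>+g. indicator B (f + - 1 *\<^sub>R R g) * indicator A f \<partial>vol) = emeasure vol B * indicator A f"
      using ball f by (simp add: nn_integral_multc)
  qed
  also have "\<dots> = emeasure vol B * emeasure vol A"
    by (simp add: nn_integral_cmult)
  finally show ?thesis
    using l2_ball_pos l2_ball_finite by (auto simp: B_def R_def ennreal_mult_cancel_left)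
qed

end

section \<open>The section of the cone of nonnegative forms\<close>

lemma radial_form_eq: "radial_form k x = norm x ^ (2 * k)"
  by (simp add: radial_form_def norm_vec_def L2_set_def power_mult sum_nonneg)

lemma nonneg_section_iff_everywhere:
  fixes f :: "real ^ 'n \<Rightarrow> real"
  assumes "f \<in> zero_mean_forms k"
  shows "f \<in> nonneg_section k \<longleftrightarrow> (\<forall>x. 0 \<le> f x + norm x ^ (2 * k))"
proof -
  have f: "f \<in> forms (2 * k)"
    using assms by (simp add: zero_mean_forms_def)
  have rad: "radial_form k = (\<lambda>x :: real ^ 'n. norm x ^ (2 * k))"
    by (rule ext) (rule radial_form_eq)
  have "f + radial_form k \<in> forms (2 * k)"
    unfolding rad by (rule subspace_add[OF subspace_forms f form_norm_power])
  then show ?thesis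
    using assms by (simp add: nonneg_section_def nonneg_forms_def rad)
qed

lemma nonneg_section_iff:
  fixes f :: "real ^ 'n \<Rightarrow> real"
  shows "f \<in> nonneg_section k \<longleftrightarrow> f \<in> zero_mean_forms k \<and> (\<forall>x. norm x = 1 \<longrightarrow> -1 \<le> f x)"
proof (cases "f \<in> zero_mean_forms k")
  case True
  then have f: "f \<in> forms (2 * k)"
    by (simp add: zero_mean_forms_def)
  have "f \<in> nonneg_section k \<longleftrightarrow> (\<forall>x. 0 \<le> f x + norm x ^ (2 * k))"
    by (rule nonneg_section_iff_everywhere[OF True])
  also have "\<dots> \<longleftrightarrow> (\<forall>x. norm x = 1 \<longrightarrow> -1 \<le> f x)"
  proof
    assume *: "\<forall>x. 0 \<le> f x + norm x ^ (2 * k)"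
    show "\<forall>x. norm x = 1 \<longrightarrow> -1 \<le> f x"
    proof (intro allI impI)
      fix x :: "real ^ 'n"
      assume "norm x = 1"
      then show "-1 \<le> f x"
        using *[rule_format, of x] by simp
    qed
  next
    assume *: "\<forall>x. norm x = 1 \<longrightarrow> -1 \<le> f x"
    show "\<forall>x. 0 \<le> f x + norm x ^ (2 * k)"
    proof
      fix x :: "real ^ 'n"
      \<comment> \<open>The origin has no direction, so an arbitrary unit vector stands in for
        \<open>x /\<^sub>R norm x\<close> there.\<close>
      obtain e :: "real ^ 'n" where e: "norm e = 1"
        using vector_choose_size[of 1] by auto
      define u where "u = (if x = 0 then e else x /\<^sub>R norm x)"
      have u: "x = norm x *\<^sub>R u" "norm u = 1"
        using e by (auto simp: u_def)
      have "f x + norm x ^ (2 * k) = norm x ^ (2 * k) * (f u + 1)"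
        using form_homogeneous[OF f, of "norm x" u] u(1) by (simp add: algebra_simps)
      then show "0 \<le> f x + norm x ^ (2 * k)"
        using *[rule_format, OF u(2)] by simp
    qed
  qed
  finally show ?thesis
    using True by simp
qed (simp add: nonneg_section_def)

section \<open>The section as a bounded measurable set\<close>

locale mean_zero_space =
  fixes k :: nat and b :: "nat \<Rightarrow> real ^ 'n \<Rightarrow> real"
  assumes k: "k > 0" and basis: "l2_orthonormal_basis (zero_mean_forms k) b"
begin

sublocale invariant_form_space "zero_mean_forms k :: (real ^ 'n \<Rightarrow> real) set" "2 * k" b
proof unfold_locales
  show "subspace (zero_mean_forms k :: (real ^ 'n \<Rightarrow> real) set)"
    by (rule subspace_zero_mean_forms)
  show "zero_mean_forms k \<subseteq> forms (2 * k)"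
    by (auto simp: zero_mean_forms_def)
  show "l2_orthonormal_basis (zero_mean_forms k) b"
    by (rule basis)
  show "(\<lambda>x. f (T x)) \<in> zero_mean_forms k"
    if "orthogonal_transformation T" "f \<in> zero_mean_forms k" for T :: "real ^ 'n \<Rightarrow> real ^ 'n" and f
    using that sphere_integral_rotation[OF that(1) form_continuous, of f "2 * k"]
      form_compose_linear[OF orthogonal_transformation_linear[OF that(1)], of f "2 * k"]
    by (simp add: zero_mean_forms_def)
qed

abbreviation M :: "(real ^ 'n \<Rightarrow> real) set" where
  "M \<equiv> zero_mean_forms k"

abbreviation K :: "(real ^ 'n \<Rightarrow> real) set" where
  "K \<equiv> nonneg_section k"

lemma K_subset: "K \<subseteq> M"
  by (auto simp: nonneg_section_def)

lemma K_lower: "f \<in> K \<Longrightarrow> norm x = 1 \<Longrightarrow> -1 \<le> f x"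
  by (simp add: nonneg_section_iff)

text \<open>By continuity, nonnegativity on a countable dense set suffices, so \<open>K\<close> is
  cut out by countably many measurable conditions.\<close>

lemma K_sets [measurable]: "K \<in> sets vol"
proof -
  obtain Q :: "(real ^ 'n) set" where Q: "countable Q" "\<And>X. open X \<Longrightarrow> X \<noteq> {} \<Longrightarrow> \<exists>d\<in>Q. d \<in> X"
    using countable_dense_setE by metis
  have "f \<in> K \<longleftrightarrow> (\<forall>x\<in>Q. 0 \<le> f x + norm x ^ (2 * k))" if f: "f \<in> M" for f
  proof -
    have f': "f \<in> forms (2 * k)"
      by (rule form_in_V[OF f])
    have "f \<in> K \<longleftrightarrow> (\<forall>x. 0 \<le> f x + norm x ^ (2 * k))"
      by (rule nonneg_section_iff_everywhere[OF f])
    also have "\<dots> \<longleftrightarrow> (\<forall>x\<in>Q. 0 \<le> f x + norm x ^ (2 * k))"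
    proof
      assume *: "\<forall>x\<in>Q. 0 \<le> f x + norm x ^ (2 * k)"
      have "open {x. f x + norm x ^ (2 * k) < 0}"
        using form_continuous[OF f', of UNIV] by (intro open_Collect_less continuous_intros) auto
      then have "{x. f x + norm x ^ (2 * k) < 0} = {}"
        using Q(2)[of "{x. f x + norm x ^ (2 * k) < 0}"] * by fastforce
      then show "\<forall>x. 0 \<le> f x + norm x ^ (2 * k)"
        by (auto simp: not_less)
    qed simp
    finally show ?thesis .
  qed
  then have "K = {f \<in> space vol. \<forall>x\<in>Q. 0 \<le> f x + norm x ^ (2 * k)}"
    using K_subset by auto
  also have "\<dots> \<in> sets vol"
  proof -
    have "{f \<in> space vol. f x + norm x ^ (2 * k) < 0} \<in> sets vol" for x :: "real ^ 'n"
      by measurable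
    then have "space vol - (\<Union>x\<in>Q. {f \<in> space vol. f x + norm x ^ (2 * k) < 0}) \<in> sets vol"
      using Q(1) by (intro sets.compl_sets sets.countable_UN') auto
    moreover have "{f \<in> space vol. \<forall>x\<in>Q. 0 \<le> f x + norm x ^ (2 * k)} =
        space vol - (\<Union>x\<in>Q. {f \<in> space vol. f x + norm x ^ (2 * k) < 0})"
      by (auto simp: not_less)
    ultimately show ?thesis
      by simp
  qed
  finally show ?thesis .
qed

text \<open>Integrating \<open>f + 1 \<ge> 0\<close> against the reproducing kernel at \<open>x\<close>, which is at most \<open>dim M\<close> on the sphere.\<close>

lemma K_bounded:
  assumes f: "f \<in> K" and x: "norm x = 1"
  shows "f x \<le> dim M"
proof -
  have fM: "f \<in> M"
    using f K_subset by blast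
  have kc: "continuous_on UNIV (kernel x)" and fc: "continuous_on UNIV f"
    using form_in_V[OF kernel_in] form_in_V[OF fM] by (auto intro: form_continuous)
  have kb: "kernel x y \<le> dim M" if "norm y = 1" for y
  proof -
    have "(kernel x y)\<^sup>2 \<le> (real (dim M))\<^sup>2"
      using sup_bound[OF kernel_in that, of x] x by (simp add: kernel_norm power2_eq_square)
    then show ?thesis
      by (rule power2_le_imp_le) simp
  qed
  have mean: "(\<integral>y. kernel x y \<partial>sphere_measure) = 0" "(\<integral>y. f y \<partial>sphere_measure) = 0"
    using kernel_in[of x] fM by (auto simp: zero_mean_forms_def)
  have "f x = (\<integral>y. f y * kernel x y \<partial>sphere_measure)"
    using kernel_reproducing[OF fM, of x] by (simp add: l2_inner_def)
  also have "\<dots> = (\<integral>y. f y * kernel x y + kernel x y \<partial>sphere_measure)"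
    using kc fc mean by (simp add: integrable_sphere_measure continuous_on_mult)
  also have "\<dots> \<le> (\<integral>y. (f y + 1) * dim M \<partial>sphere_measure)"
  proof (rule sphere_integral_mono)
    fix y :: "real ^ 'n"
    assume y: "norm y = 1"
    have "(f y + 1) * kernel x y \<le> (f y + 1) * dim M"
      using K_lower[OF f y] kb[OF y] by (intro mult_left_mono) auto
    then show "f y * kernel x y + kernel x y \<le> (f y + 1) * dim M"
      by (simp add: algebra_simps)
  qed (use kc fc in \<open>auto intro!: continuous_intros\<close>)
  also have "\<dots> = (\<integral>y. f y + 1 \<partial>sphere_measure) * dim M"
    by simp
  also have "(\<integral>y. f y + 1 \<partial>sphere_measure) = (\<integral>y. f y \<partial>sphere_measure) + (\<integral>y. 1 \<partial>(sphere_measure :: (real ^ 'n) measure))"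
    by (intro Bochner_Integration.integral_add integrable_sphere_measure fc continuous_intros)
  finally show ?thesis
    unfolding mean sphere_integral_const by simp
qed

lemma K_finite: "emeasure vol K < \<infinity>"
proof -
  define r where "r = real (dim M) + 1"
  have r: "r > 0"
    by (simp add: r_def)
  have "K \<subseteq> {f \<in> M. l2_inner (f - 0) (f - 0) \<le> r\<^sup>2}"
  proof
    fix f
    assume f: "f \<in> K"
    then have fM: "f \<in> M"
      using K_subset by blast
    have fc: "continuous_on UNIV f"
      by (rule form_continuous[OF form_in_V[OF fM]])
    have "(\<integral>y. f y * f y \<partial>sphere_measure) \<le> (\<integral>y. r\<^sup>2 \<partial>(sphere_measure :: (real ^ 'n) measure))"
    proof (rule sphere_integral_mono)
      fix y :: "real ^ 'n"
      assume y: "norm y = 1"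
      have "\<bar>f y\<bar> \<le> r"
        using K_lower[OF f y] K_bounded[OF f y] by (simp add: r_def)
      then have "\<bar>f y\<bar>\<^sup>2 \<le> r\<^sup>2"
        by (intro power_mono) auto
      then show "f y * f y \<le> r\<^sup>2"
        by (simp add: power2_eq_square)
    qed (use fc in \<open>auto intro!: continuous_intros\<close>)
    then show "f \<in> {f \<in> M. l2_inner (f - 0) (f - 0) \<le> r\<^sup>2}"
      using fM by (simp add: sphere_integral_const l2_inner_def del: Bochner_Integration.lebesgue_integral_const)
  qed
  from emeasure_mono[OF this emeasure_l2_ball_affine(2)[OF subspace_0[OF V(1)] r]]
  have "emeasure vol K \<le> ennreal (r ^ dim M) * emeasure vol l2_ball"
    unfolding emeasure_l2_ball_affine(1)[OF subspace_0[OF V(1)] r] .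
  also have "\<dots> < \<infinity>"
    using l2_ball_finite by (simp add: ennreal_mult_less_top)
  finally show ?thesis .
qed

section \<open>The self-convolution of the section and its symmetric part\<close>

definition sup_ball :: "(real ^ 'n \<Rightarrow> real) set" where
  "sup_ball = {f \<in> M. \<forall>x. norm x = 1 \<longrightarrow> \<bar>f x\<bar> \<le> 1}"

definition K_reflected :: "(real ^ 'n \<Rightarrow> real) \<Rightarrow> (real ^ 'n \<Rightarrow> real) set" where
  "K_reflected y = {f \<in> K. y - f \<in> K}"

lemma K_reflected_subset: "K_reflected y \<subseteq> K"
  by (auto simp: K_reflected_def)

lemma K_reflected_0: "K_reflected 0 = sup_ball"
  using subspace_neg[OF V(1)] by (auto simp: K_reflected_def sup_ball_def nonneg_section_iff abs_le_iff; force)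

lemma K_reflected_sets [measurable]: "y \<in> M \<Longrightarrow> K_reflected y \<in> sets vol"
proof -
  assume y: "y \<in> M"
  have "(\<lambda>f. y + - 1 *\<^sub>R f) \<in> vol \<rightarrow>\<^sub>M vol"
    using y by (intro affine_measurable) auto
  then have "{f \<in> space vol. y + - 1 *\<^sub>R f \<in> K} \<in> sets vol"
    by (rule sets_Collect_preimage) simp
  then have "K \<inter> {f \<in> space vol. y + - 1 *\<^sub>R f \<in> K} \<in> sets vol"
    by simp
  also have "K \<inter> {f \<in> space vol. y + - 1 *\<^sub>R f \<in> K} = K_reflected y"
    using K_subset by (auto simp: K_reflected_def)
  finally show ?thesis .
qed

lemma K_reflected_finite: "y \<in> M \<Longrightarrow> emeasure vol (K_reflected y) < \<infinity>"
  using emeasure_mono[OF K_reflected_subset K_sets, of y] K_finite by (rule le_less_trans)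

lemma K_midpoint:
  assumes "f \<in> K" "g \<in> K"
  shows "(1 / 2) *\<^sub>R (f + g) \<in> K"
proof -
  have "(1 / 2) *\<^sub>R (f + g) \<in> M"
    using assms K_subset by (intro subspace_scale subspace_add V(1)) auto
  moreover have "-1 \<le> ((1 / 2) *\<^sub>R (f + g)) x" if "norm x = 1" for x
    using K_lower[OF assms(1) that] K_lower[OF assms(2) that] by simp
  ultimately show ?thesis
    by (simp add: nonneg_section_iff)
qed

lemma K_rotation:
  assumes T: "orthogonal_transformation T" and f: "f \<in> M"
  shows "(\<lambda>x. f (T x)) \<in> K \<longleftrightarrow> f \<in> K"
proof
  assume "f \<in> K"
  then show "(\<lambda>x. f (T x)) \<in> K"
    using rotation_in[OF T f] orthogonal_transformation_norm[OF T] by (auto simp: nonneg_section_iff)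
next
  assume *: "(\<lambda>x. f (T x)) \<in> K"
  have "-1 \<le> f x" if x: "norm x = 1" for x
  proof -
    obtain y where y: "x = T y"
      using orthogonal_transformation_surj[OF T] by blast
    then have "norm y = 1"
      using x orthogonal_transformation_norm[OF T] by metis
    then show ?thesis
      using K_lower[OF *] y by simp
  qed
  then show "f \<in> K"
    using f by (simp add: nonneg_section_iff)
qed

text \<open>The convolution of the indicator function of \<open>K\<close> with itself, evaluated at
  \<open>y\<close>.\<close>

definition overlap :: "(real ^ 'n \<Rightarrow> real) \<Rightarrow> real" where
  "overlap y = measure vol (K_reflected y)"

lemma overlap_ennreal: "y \<in> M \<Longrightarrow> emeasure vol (K_reflected y) = ennreal (overlap y)"
  unfolding overlap_def by (rule emeasure_eq_ennreal_measure) (use K_reflected_finite[of y] in auto)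

lemma overlap_nonneg: "overlap y \<ge> 0"
  by (simp add: overlap_def)

text \<open>Midpoint log-concavity: \<open>K\<close> is convex, so midpoints of points of
  \<open>K_reflected y\<close> and \<open>K_reflected z\<close> lie in the reflected set of the
  midpoint, and Brunn-Minkowski compares the volumes.\<close>

lemma overlap_midpoint:
  assumes "y \<in> M" "z \<in> M"
  shows "overlap y * overlap z \<le> (overlap ((1 / 2) *\<^sub>R (y + z)))\<^sup>2"
proof -
  have mid: "(1 / 2) *\<^sub>R (y + z) \<in> M"
    using assms by (intro subspace_scale subspace_add V(1))
  have "emeasure vol (K_reflected y) * emeasure vol (K_reflected z) \<le>
      (emeasure vol (K_reflected ((1 / 2) *\<^sub>R (y + z))))\<^sup>2"
  proof (rule brunn_minkowski)
    fix f g
    assume fg: "f \<in> K_reflected y" "g \<in> K_reflected z"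
    have "(1 / 2) *\<^sub>R (y + z) - (1 / 2) *\<^sub>R (f + g) = (1 / 2) *\<^sub>R ((y - f) + (z - g))"
      by (simp add: fun_eq_iff field_simps)
    then show "(1 / 2) *\<^sub>R (f + g) \<in> K_reflected ((1 / 2) *\<^sub>R (y + z))"
      using fg K_midpoint[of f g] K_midpoint[of "y - f" "z - g"] by (simp only: K_reflected_def mem_Collect_eq)
  qed (use assms mid in auto)
  then show ?thesis
    using assms mid by (simp add: overlap_ennreal overlap_nonneg ennreal_mult[symmetric] ennreal_power)
qed

lemma overlap_rotation:
  assumes T: "orthogonal_transformation T" and y: "y \<in> M"
  shows "overlap (\<lambda>x. y (T x)) = overlap y"
proof -
  have yT: "(\<lambda>x. y (T x)) \<in> M"
    by (rule rotation_in[OF T y])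
  have "{f \<in> M. (\<lambda>x. f (T x)) \<in> K_reflected (\<lambda>x. y (T x))} = K_reflected y"
  proof -
    have "(\<lambda>x. f (T x)) \<in> K_reflected (\<lambda>x. y (T x)) \<longleftrightarrow> f \<in> K_reflected y" if f: "f \<in> M" for f
    proof -
      have "(\<lambda>x. y (T x)) - (\<lambda>x. f (T x)) = (\<lambda>x. (y - f) (T x))"
        by (simp add: fun_eq_iff)
      then show ?thesis
        using K_rotation[OF T f] K_rotation[OF T subspace_diff[OF V(1) y f]]
        by (simp only: K_reflected_def mem_Collect_eq)
    qed
    then show ?thesis
      using K_reflected_subset K_subset by auto
  qed
  then show ?thesis
    using emeasure_vol_rotation[OF T K_reflected_sets[OF yT]] by (simp add: overlap_def measure_def)
qed

text \<open>This takes the place of continuity of \<open>overlap\<close> at 0. Substituting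
  \<open>z / 2 + (1 + e) f\<close>, the two memberships give
  \<open>(1 + e) |f x| \<le> 1 + e / 2\<close> on the sphere, so \<open>f\<close> lies in the
  symmetric part; the power of \<open>1 + e\<close> is the Jacobian.\<close>

lemma overlap_small:
  assumes z: "z \<in> M" and e: "e \<ge> 0" and small: "\<And>x. norm x = 1 \<Longrightarrow> \<bar>z x\<bar> \<le> e"
  shows "overlap z \<le> (1 + e) ^ dim M * overlap 0"
proof -
  define v where "v = (1 / 2) *\<^sub>R z"
  have v: "v \<in> M"
    unfolding v_def using z by (intro subspace_scale V(1))
  have "{f \<in> M. v + (1 + e) *\<^sub>R f \<in> K_reflected z} \<subseteq> K_reflected 0"
  proof
    fix f
    assume f: "f \<in> {f \<in> M. v + (1 + e) *\<^sub>R f \<in> K_reflected z}"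
    have "\<bar>f x\<bar> \<le> 1" if x: "norm x = 1" for x
    proof -
      have "v + (1 + e) *\<^sub>R f \<in> K" "z - (v + (1 + e) *\<^sub>R f) \<in> K"
        using f by (auto simp: K_reflected_def)
      then have "-1 \<le> z x / 2 + (1 + e) * f x" "-1 \<le> z x / 2 - (1 + e) * f x"
        using K_lower[OF _ x] by (force simp: v_def)+
      moreover have "z x \<le> e" "- z x \<le> e"
        using small[OF x] by auto
      ultimately have "\<bar>(1 + e) * f x\<bar> \<le> (1 + e) * 1"
        unfolding abs_le_iff mult_1_right using e by (intro conjI) linarith+
      then show ?thesis
        using e by (simp add: abs_mult mult_le_cancel_left_pos)
    qed
    then show "f \<in> K_reflected 0"
      using f unfolding K_reflected_0 by (simp add: sup_ball_def)
  qed
  then have "emeasure vol {f \<in> M. v + (1 + e) *\<^sub>R f \<in> K_reflected z} \<le> emeasure vol (K_reflected 0)"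
    by (intro emeasure_mono K_reflected_sets subspace_0 V(1))
  then have "emeasure vol (K_reflected z) \<le> ennreal ((1 + e) ^ dim M) * emeasure vol (K_reflected 0)"
    using emeasure_vol_affine[OF K_reflected_sets[OF z] v, of "1 + e"] e by (simp add: mult_left_mono)
  then show ?thesis
    using z subspace_0[OF V(1)] e by (simp add: overlap_ennreal overlap_nonneg ennreal_mult[symmetric])
qed

text \<open>
  A superlevel set of \<open>overlap\<close> is invariant under rotations and midpoint convex.  An element \<open>z\<close> whose norm
  is close to the infimum is therefore close to each of its rotations, hence nearly constant on the
  sphere, hence uniformly small.
\<close>

lemma overlap_superlevel_small:
  assumes y: "y \<in> M" and e: "e > 0"
  shows "\<exists>z\<in>M. overlap y \<le> overlap z \<and> (\<forall>x. norm x = 1 \<longrightarrow> \<bar>z x\<bar> \<le> e)"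
proof -
  define S where "S = {z \<in> M. overlap y \<le> overlap z}"
  define \<rho> where "\<rho> = Inf ((\<lambda>z. l2_inner z z) ` S)"
  have bdd: "bdd_below ((\<lambda>z. l2_inner z z) ` S)"
    by (rule bdd_belowI2[of _ 0]) (rule l2_inner_nonneg)
  have \<rho>_le: "\<rho> \<le> l2_inner z z" if "z \<in> S" for z
    unfolding \<rho>_def using that bdd by (intro cInf_lower) auto
  \<comment> \<open>The parallelogram law below bounds the squared L2 distance from \<open>z\<close>
    to a rotated copy by \<open>4 \<eta>\<close>, and \<open>sup_bound\<close> costs a factor
    \<open>dim M\<close>; the added 1 covers dimension 0.\<close>
  define \<eta> where "\<eta> = e\<^sup>2 / (4 * (real (dim M) + 1))"
  have \<eta>: "\<eta> > 0"
    using e by (simp add: \<eta>_def)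
  have "Inf ((\<lambda>z. l2_inner z z) ` S) < \<rho> + \<eta>" "(\<lambda>z. l2_inner z z) ` S \<noteq> {}"
    using \<eta> y by (auto simp: \<rho>_def S_def)
  from cInf_lessD[OF this(2,1)] obtain z where z: "z \<in> S" "l2_inner z z < \<rho> + \<eta>"
    by blast
  have zM: "z \<in> M" "overlap y \<le> overlap z"
    using z by (auto simp: S_def)
  have z_form: "z \<in> forms (2 * k)"
    by (rule form_in_V[OF zM(1)])
  have close: "\<bar>z x - z x'\<bar> \<le> e" if x: "norm x = 1" "norm x' = 1" for x x'
  proof -
    obtain T where T: "orthogonal_transformation T" "T x = x'"
      using orthogonal_transformation_exists[of x x'] x by metis
    define w where "w = (\<lambda>x. z (T x))"
    have wM: "w \<in> M"
      unfolding w_def by (rule rotation_in[OF T(1) zM(1)])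
    have w_form: "w \<in> forms (2 * k)"
      by (rule form_in_V[OF wM])
    have ww: "l2_inner w w = l2_inner z z"
      unfolding w_def by (rule l2_inner_rotation[OF T(1) z_form z_form])
    have "(overlap y)\<^sup>2 \<le> overlap z * overlap w"
      using zM(2) overlap_nonneg[of y] overlap_rotation[OF T(1) zM(1)]
      by (auto simp: w_def power2_eq_square intro: mult_mono)
    also have "\<dots> \<le> (overlap ((1 / 2) *\<^sub>R (z + w)))\<^sup>2"
      by (rule overlap_midpoint[OF zM(1) wM])
    finally have "overlap y \<le> overlap ((1 / 2) *\<^sub>R (z + w))"
      by (rule power2_le_imp_le) (rule overlap_nonneg)
    then have "(1 / 2) *\<^sub>R (z + w) \<in> S"
      using zM wM by (auto simp: S_def intro!: subspace_scale subspace_add V(1))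
    then have "\<rho> \<le> l2_inner ((1 / 2) *\<^sub>R (z + w)) ((1 / 2) *\<^sub>R (z + w))"
      by (rule \<rho>_le)
    also have "\<dots> = (l2_inner z z + 2 * l2_inner z w + l2_inner w w) / 4"
      using z_form w_form subspace_add[OF subspace_forms z_form w_form]
      by (simp add: l2_inner_scaleR_left l2_inner_scaleR_right l2_inner_add_left[where d = "2 * k"]
          l2_inner_add_right[where d = "2 * k"] l2_inner_commute[of w z])
    finally have "4 * \<rho> \<le> 2 * l2_inner z z + 2 * l2_inner z w"
      by (simp add: ww)
    moreover have "l2_inner (z - w) (z - w) = l2_inner z z - 2 * l2_inner z w + l2_inner w w"
    proof -
      have d: "z - w \<in> forms (2 * k)"
        by (rule subspace_diff[OF subspace_forms z_form w_form])
      show ?thesis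
        using l2_inner_diff_left[OF z_form w_form d] l2_inner_diff_left[OF z_form w_form z_form]
          l2_inner_diff_left[OF z_form w_form w_form]
        by (simp add: l2_inner_commute[of z "z - w"] l2_inner_commute[of w "z - w"] l2_inner_commute[of w z])
    qed
    ultimately have "l2_inner (z - w) (z - w) \<le> 4 * \<eta>"
      using z(2) ww by simp
    then have "((z - w) x)\<^sup>2 \<le> dim M * (4 * \<eta>)"
      using sup_bound[OF subspace_diff[OF V(1) zM(1) wM] x(1)]
      by (meson mult_left_mono of_nat_0_le_iff order_trans)
    also have "\<dots> \<le> e\<^sup>2"
      using e by (simp add: \<eta>_def field_simps)
    finally have "\<bar>(z - w) x\<bar>\<^sup>2 \<le> e\<^sup>2"
      by simp
    then have "\<bar>(z - w) x\<bar> \<le> e"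
      by (rule power2_le_imp_le) (use e in simp)
    then show ?thesis
      by (simp add: w_def T(2))
  qed
  have "\<bar>z x\<bar> \<le> e" if x: "norm x = 1" for x
  proof -
    have zc: "continuous_on UNIV z"
      by (rule form_continuous[OF z_form])
    have int: "(\<integral>x'. z x' + c \<partial>sphere_measure) = c" for c
    proof -
      have "(\<integral>x'. z x' + c \<partial>sphere_measure) = (\<integral>x'. z x' \<partial>sphere_measure) + (\<integral>x'. c \<partial>(sphere_measure :: (real ^ 'n) measure))"
        by (intro Bochner_Integration.integral_add integrable_sphere_measure zc continuous_intros)
      then show ?thesis
        using zM(1) by (simp only: sphere_integral_const) (simp add: zero_mean_forms_def)
    qed
    \<comment> \<open>Averaging these inequalities over \<open>x'\<close> eliminates
      \<open>z x'\<close>, whose mean is zero.\<close>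
    have bounds: "z x \<le> z x' + e" "z x' + - e \<le> z x" if "norm x' = 1" for x'
      using close[OF x that] by linarith+
    have "(\<integral>x'. z x \<partial>(sphere_measure :: (real ^ 'n) measure)) \<le> (\<integral>x'. z x' + e \<partial>sphere_measure)"
      using bounds zc by (intro sphere_integral_mono continuous_intros) auto
    moreover have "(\<integral>x'. z x' + - e \<partial>sphere_measure) \<le> (\<integral>x'. z x \<partial>(sphere_measure :: (real ^ 'n) measure))"
      using bounds zc by (intro sphere_integral_mono continuous_intros) auto
    ultimately show ?thesis
      unfolding int sphere_integral_const by (simp add: abs_le_iff)
  qed
  then show ?thesis
    using zM by blast
qed

text \<open>By \<open>overlap_superlevel_small\<close> some uniformly small \<open>z\<close> has at
  least the same overlap; \<open>overlap_small\<close> compares it with 0, and the factor tends to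
  1.\<close>

lemma overlap_le:
  assumes y: "y \<in> M"
  shows "overlap y \<le> overlap 0"
proof -
  have "overlap y \<le> (1 + inverse (real (Suc m))) ^ dim M * overlap 0" for m
  proof -
    obtain z where z: "z \<in> M" "overlap y \<le> overlap z" "\<And>x. norm x = 1 \<Longrightarrow> \<bar>z x\<bar> \<le> inverse (real (Suc m))"
      using overlap_superlevel_small[OF y, of "inverse (real (Suc m))"] by auto
    note z(2)
    also have "overlap z \<le> (1 + inverse (real (Suc m))) ^ dim M * overlap 0"
      by (rule overlap_small[OF z(1) _ z(3)]) simp_all
    finally show ?thesis .
  qed
  moreover have "(\<lambda>m. (1 + inverse (real (Suc m))) ^ dim M * overlap 0) \<longlonglongrightarrow> (1 + 0) ^ dim M * overlap 0"
    by (intro tendsto_intros LIMSEQ_inverse_real_of_nat)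
  ultimately show ?thesis
    using LIMSEQ_le_const[of _ "(1 + 0) ^ dim M * overlap 0" "overlap y"] by auto
qed

text \<open>The function \<open>y \<mapsto> vol (K \<inter> (y - K))\<close> is supported in \<open>2K\<close> and has integral \<open>vol K\<^sup>2\<close>.\<close>

lemma volume_K_le_symmetric_part: "measure vol K \<le> 2 ^ dim M * measure vol sup_ball"
proof -
  interpret sigma_finite_measure vol
    by (rule sigma_finite_vol)
  interpret pair_sigma_finite vol vol ..
  define X where "X = {y \<in> M. (1 / 2) *\<^sub>R y \<in> K}"
  have "(\<lambda>f. 0 + (1 / 2) *\<^sub>R f) \<in> vol \<rightarrow>\<^sub>M vol"
    using subspace_0[OF V(1)] by (intro affine_measurable) auto
  from sets_Collect_preimage[OF this K_sets] have X [measurable]: "X \<in> sets vol"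
    by (simp add: X_def)
  have KX: "emeasure vol X = ennreal (2 ^ dim M) * emeasure vol K"
  proof -
    have "emeasure vol X = ennreal (\<bar>2\<bar> ^ dim M) * emeasure vol {f \<in> M. 0 + 2 *\<^sub>R f \<in> X}"
      using X subspace_0[OF V(1)] by (intro emeasure_vol_affine) auto
    moreover have "{f \<in> M. 0 + 2 *\<^sub>R f \<in> X} = K"
      using K_subset subspace_scale[OF V(1)] by (auto simp: X_def)
    ultimately show ?thesis
      by simp
  qed
  have inner: "(\<integral>\<^sup>+y. indicator K (y + - 1 *\<^sub>R f) \<partial>vol) = emeasure vol K" if f: "f \<in> M" for f
  proof -
    have "(\<integral>\<^sup>+y. indicator K (y + - 1 *\<^sub>R f) \<partial>vol) = (\<integral>\<^sup>+y. indicator K (f + 1 *\<^sub>R y + - 1 *\<^sub>R f) \<partial>vol)"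
    proof -
      have "(\<lambda>y. y + - 1 *\<^sub>R f) \<in> vol \<rightarrow>\<^sub>M vol"
        using f by (intro affine_measurable) auto
      then have "(\<lambda>y. indicator K (y + - 1 *\<^sub>R f) :: ennreal) \<in> borel_measurable vol"
        by (rule measurable_compose) simp
      from nn_integral_vol_affine[OF this f, of 1] show ?thesis
        by simp
    qed
    then show ?thesis
      by simp
  qed
  have meas: "(\<lambda>p. indicator K (snd p) * indicator K (fst p + - 1 *\<^sub>R snd p) :: ennreal) \<in> borel_measurable (vol \<Otimes>\<^sub>M vol)"
  proof -
    have "(\<lambda>p. fst p + - 1 *\<^sub>R snd p) \<in> vol \<Otimes>\<^sub>M vol \<rightarrow>\<^sub>M vol"
      by (intro affine_measurable) measurable
    then have "(\<lambda>p. indicator K (fst p + - 1 *\<^sub>R snd p) :: ennreal) \<in> borel_measurable (vol \<Otimes>\<^sub>M vol)"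
      by (rule measurable_compose) simp
    then show ?thesis
      by measurable
  qed
  have "emeasure vol K * emeasure vol K = (\<integral>\<^sup>+f. indicator K f * emeasure vol K \<partial>vol)"
    by (simp add: nn_integral_multc)
  also have "\<dots> = (\<integral>\<^sup>+f. \<integral>\<^sup>+y. indicator K f * indicator K (y + - 1 *\<^sub>R f) \<partial>vol \<partial>vol)"
  proof (rule nn_integral_cong)
    fix f
    assume f: "f \<in> space vol"
    then have "(\<lambda>y. y + - 1 *\<^sub>R f) \<in> vol \<rightarrow>\<^sub>M vol"
      by (intro affine_measurable) auto
    then have "(\<lambda>y. indicator K (y + - 1 *\<^sub>R f) :: ennreal) \<in> borel_measurable vol"
      by (rule measurable_compose) simp
    then show "indicator K f * emeasure vol K = (\<integral>\<^sup>+y. indicator K f * indicator K (y + - 1 *\<^sub>R f) \<partial>vol)"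
      using inner[of f] f by (simp only: nn_integral_cmult space_vol)
  qed
  also have "\<dots> = (\<integral>\<^sup>+y. \<integral>\<^sup>+f. indicator K f * indicator K (y + - 1 *\<^sub>R f) \<partial>vol \<partial>vol)"
    by (rule Fubini') (use meas in \<open>simp add: split_beta\<close>)
  also have "\<dots> \<le> (\<integral>\<^sup>+y. ennreal (overlap 0) * indicator X y \<partial>vol)"
  proof (rule nn_integral_mono)
    fix y
    assume "y \<in> space vol"
    then have y: "y \<in> M" by simp
    have "(\<integral>\<^sup>+f. indicator K f * indicator K (y + - 1 *\<^sub>R f) \<partial>vol) = (\<integral>\<^sup>+f. indicator (K_reflected y) f \<partial>vol)"
      by (intro nn_integral_cong) (auto simp: K_reflected_def indicator_def)
    also have "\<dots> = ennreal (overlap y)"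
      using K_reflected_sets[OF y] by (simp add: overlap_ennreal[OF y])
    also have "\<dots> \<le> ennreal (overlap 0) * indicator X y"
    proof (cases "K_reflected y = {}")
      \<comment> \<open>Where the reflected set is empty the integrand vanishes; otherwise
        \<open>y / 2\<close> is the midpoint of two points of \<open>K\<close>, so \<open>y\<close>
        lies in \<open>X\<close>.\<close>
      case True
      then show ?thesis
        by (simp add: overlap_def)
    next
      case False
      then obtain f where "f \<in> K" "y - f \<in> K"
        by (auto simp: K_reflected_def)
      then have "y \<in> X"
        using K_midpoint[of f "y - f"] y by (simp add: X_def)
      then show ?thesis
        using overlap_le[OF y] by (simp add: ennreal_leI)
    qed
    finally show "(\<integral>\<^sup>+f. indicator K f * indicator K (y + - 1 *\<^sub>R f) \<partial>vol) \<le> ennreal (overlap 0) * indicator X y" .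
  qed
  also have "\<dots> = ennreal (overlap 0) * (ennreal (2 ^ dim M) * emeasure vol K)"
    using X by (simp add: nn_integral_cmult_indicator KX)
  finally have le: "emeasure vol K * emeasure vol K \<le> ennreal (overlap 0) * (ennreal (2 ^ dim M) * emeasure vol K)" .
  define a where "a = measure vol K"
  have a: "emeasure vol K = ennreal a" "a \<ge> 0"
    unfolding a_def using K_finite by (auto intro: emeasure_eq_ennreal_measure)
  have "a * a \<le> overlap 0 * (2 ^ dim M * a)"
    using le a overlap_nonneg[of 0] by (simp add: ennreal_mult[symmetric])
  then have "a * a \<le> (2 ^ dim M * overlap 0) * a"
    by (simp only: mult_ac)
  then have "a \<le> 2 ^ dim M * overlap 0" if "a > 0"
    using that by (rule mult_right_le_imp_le)
  moreover have "0 \<le> 2 ^ dim M * overlap 0"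
    using overlap_nonneg[of 0] by simp
  ultimately have "a \<le> 2 ^ dim M * overlap 0"
    using a(2) by linarith
  then show ?thesis
    by (simp add: a_def overlap_def K_reflected_0)
qed

lemma volume_sup_ball_le:
  "measure vol sup_ball \<le> sqrt (4 * (real k)\<^sup>2 / (4 * (real k)\<^sup>2 + 2 * real CARD('n))) ^ dim M * measure vol l2_ball"
proof -
  define r where "r = sqrt (4 * (real k)\<^sup>2 / (4 * (real k)\<^sup>2 + 2 * real CARD('n)))"
  have pos: "4 * (real k)\<^sup>2 + 2 * real CARD('n) > 0"
    by (intro add_nonneg_pos) auto
  have r: "r > 0"
    using k pos by (simp add: r_def)
  have "sup_ball \<subseteq> {f \<in> M. l2_inner (f - 0) (f - 0) \<le> r\<^sup>2}"
  proof
    fix f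
    assume f: "f \<in> sup_ball"
    then have "(4 * (real k)\<^sup>2 + 2 * real CARD('n)) * l2_inner f f \<le> 4 * (real k)\<^sup>2"
      by (intro l2_bound_of_bounded_form k) (auto simp: sup_ball_def)
    then have "l2_inner f f \<le> r\<^sup>2"
      using pos by (simp add: r_def field_simps)
    then show "f \<in> {f \<in> M. l2_inner (f - 0) (f - 0) \<le> r\<^sup>2}"
      using f by (simp add: sup_ball_def)
  qed
  from emeasure_mono[OF this emeasure_l2_ball_affine(2)[OF subspace_0[OF V(1)] r]]
  have "emeasure vol sup_ball \<le> ennreal (r ^ dim M) * emeasure vol l2_ball"
    unfolding emeasure_l2_ball_affine(1)[OF subspace_0[OF V(1)] r] .
  moreover have "emeasure vol sup_ball = ennreal (measure vol sup_ball)"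
    using overlap_ennreal[OF subspace_0[OF V(1)]] by (simp add: overlap_def K_reflected_0)
  moreover have "emeasure vol l2_ball = ennreal (measure vol l2_ball)"
    using l2_ball_finite by (intro emeasure_eq_ennreal_measure) auto
  ultimately show ?thesis
    using r by (simp add: ennreal_mult[symmetric] r_def[symmetric])
qed

end

section \<open>The lower bound\<close>

text \<open>A positive dimension is needed for the exponent \<open>1 / dim M\<close> to undo the
  power \<open>dim M\<close>; in one variable the space would be zero.\<close>

lemma zero_mean_forms_nontrivial:
  assumes k: "k > 0" and n: "CARD('n :: finite) \<ge> 2"
  shows "dim (zero_mean_forms k :: (real ^ 'n \<Rightarrow> real) set) > 0"
proof -
  obtain i j :: 'n where ij: "i \<noteq> j"
  proof -
    obtain i :: 'n where True by simp
    have "UNIV \<noteq> {i}"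
      using n by (metis One_nat_def Suc_1 card.empty card_insert_disjoint empty_iff finite.emptyI not_less_eq_eq order_refl)
    then show ?thesis
      using that by blast
  qed
  \<comment> \<open>Odd in \<open>x $ i\<close> and of even total degree, so the reflection
    \<open>R\<close> below negates it and its mean is zero.\<close>
  define f where "f x = (x $ i) ^ (2 * k - 1) * x $ j" for x :: "real ^ 'n"
  have f_form: "f \<in> forms (2 * k)"
    using form_mult[OF form_power[OF form_coordinate, of i "2 * k - 1"] form_coordinate[of j]] k
    by (simp add: f_def[abs_def])
  define R where "R x = (\<chi> l. if l = i then - x $ i else x $ l)" for x :: "real ^ 'n"
  have R: "orthogonal_transformation R"
    unfolding orthogonal_transformation_def
  proof
    show "linear R"
      by (rule linearI) (auto simp: R_def vec_eq_iff)
    show "\<forall>v w. R v \<bullet> R w = v \<bullet> w"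
      unfolding inner_vec_def by (intro allI sum.cong) (auto simp: R_def)
  qed
  have "f (R x) = - f x" for x
    using ij k by (simp add: f_def R_def)
  then have "(\<integral>x. - f x \<partial>sphere_measure) = (\<integral>x. f x \<partial>sphere_measure)"
    using sphere_integral_rotation[OF R form_continuous[OF f_form]] by simp
  then have "f \<in> zero_mean_forms k"
    using f_form by (simp add: zero_mean_forms_def)
  moreover have "f (axis i 1 + axis j 1) = 1"
    using ij by (simp add: f_def axis_def)
  then have "f \<noteq> 0"
    by auto
  ultimately have "\<not> zero_mean_forms k \<subseteq> {0 :: real ^ 'n \<Rightarrow> real}"
    by blast
  moreover obtain b :: "nat \<Rightarrow> real ^ 'n \<Rightarrow> real" where "l2_orthonormal_basis (zero_mean_forms k) b"
    using zero_mean_forms_orthonormal_basis by blast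
  ultimately show ?thesis
    by (cases "dim (zero_mean_forms k :: (real ^ 'n \<Rightarrow> real) set)") (auto simp: l2_orthonormal_basis_def)
qed

lemma nn_integral_cmult_power_times_exp:
  "(\<integral>\<^sup>+s. C * (ennreal (s ^ j * exp (- s)) * indicator {0..} s) \<partial>lborel) = C * ennreal (fact j)"
  by (subst nn_integral_cmult) (simp_all add: nn_intergal_power_times_exp_Ici)

section \<open>Moments of point evaluations on the unit ball\<close>

context mean_zero_space
begin

text \<open>
  If \<open>u\<close> is a unit vector, then \<open>f\<close> in the unit ball and \<open>\<langle>f, u\<rangle> \<ge> c\<close> imply
  \<open>\<parallel>f - c u\<parallel>\<^sup>2 \<le> 1 - c\<^sup>2\<close>, so this cap of the ball lies in a smaller ball.
\<close>

lemma evaluation_tail: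
  assumes x: "norm x = 1" and D: "dim M > 0" and s: "s \<ge> 0"
  shows "emeasure vol {f \<in> l2_ball. 2 * s \<le> (f x)\<^sup>2} \<le> ennreal (2 * exp (- s)) * emeasure vol l2_ball"
proof -
  define D where "D = real (dim M)"
  have D0: "D > 0"
    using D by (simp add: D_def)
  \<comment> \<open>The unit vector \<open>u\<close> below satisfies
    \<open>l2_inner f u = f x / sqrt D\<close>, so the tail condition says that its square is at
    least \<open>\<tau>\<close>. The cap radius is \<open>r = exp (- \<tau> / 2)\<close>, because
    \<open>1 - \<tau> \<le> r^2\<close> and \<open>r^D = exp (- s)\<close>.\<close>
  define \<tau> where "\<tau> = 2 * s / D"
  have \<tau>: "\<tau> \<ge> 0" "D * \<tau> = 2 * s"
    using s D0 by (auto simp: \<tau>_def)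
  define u where "u = (1 / sqrt D) *\<^sub>R kernel x"
  have u: "u \<in> M"
    unfolding u_def by (intro subspace_scale V(1) kernel_in)
  have uu: "l2_inner u u = 1"
    using D0 kernel_norm[OF x] by (simp add: u_def l2_inner_scaleR_left l2_inner_scaleR_right D_def)
  have fu: "l2_inner f u = f x / sqrt D" if "f \<in> M" for f
    using kernel_reproducing[OF that] by (simp add: u_def l2_inner_scaleR_right)
  define r where "r = exp (- \<tau> / 2)"
  have r: "r > 0" "r\<^sup>2 = exp (- \<tau>)"
    by (auto simp: r_def power2_eq_square simp flip: exp_add)
  define cap where "cap c = {f \<in> M. l2_inner (f - c *\<^sub>R u) (f - c *\<^sub>R u) \<le> r\<^sup>2}" for c
  have cu: "c *\<^sub>R u \<in> M" for c
    using u by (intro subspace_scale V(1))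
  have cap: "emeasure vol (cap c) = ennreal (exp (- s)) * emeasure vol l2_ball" "cap c \<in> sets vol" for c
  proof -
    have "r ^ dim M = exp (- s)"
      using \<tau>(2) by (simp add: r_def D_def flip: exp_of_nat_mult)
    then show "emeasure vol (cap c) = ennreal (exp (- s)) * emeasure vol l2_ball" "cap c \<in> sets vol"
      unfolding cap_def using emeasure_l2_ball_affine[OF cu r(1), of c] by simp_all
  qed
  have in_cap: "f \<in> cap c" if f: "f \<in> l2_ball" and c: "c\<^sup>2 = \<tau>" "\<tau> \<le> c * l2_inner f u" for f c
  proof -
    have fM: "f \<in> M"
      using f by (simp add: l2_ball_def)
    define g where "g = f - c *\<^sub>R u"
    note ff = form_in_V[OF fM] and cf = form_in_V[OF cu[of c]]
    have gf: "g \<in> forms (2 * k)"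
      unfolding g_def by (rule subspace_diff[OF subspace_forms ff cf])
    have "l2_inner g g = l2_inner g f - l2_inner g (c *\<^sub>R u)"
      using l2_inner_diff_left[OF ff cf gf] unfolding g_def[symmetric] l2_inner_commute[of f g] l2_inner_commute[of "c *\<^sub>R u" g] .
    moreover have "l2_inner g f = l2_inner f f - c * l2_inner f u"
      using l2_inner_diff_left[OF ff cf ff] by (simp add: g_def l2_inner_scaleR_left l2_inner_commute[of u f])
    moreover have "l2_inner g (c *\<^sub>R u) = c * l2_inner f u - c\<^sup>2"
      using l2_inner_diff_left[OF ff cf cf]
      by (simp add: g_def l2_inner_scaleR_left l2_inner_scaleR_right uu power2_eq_square)
    ultimately have "l2_inner g g = l2_inner f f - 2 * (c * l2_inner f u) + c\<^sup>2"
      by linarith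
    also have "\<dots> \<le> 1 - \<tau>"
      using f c by (simp add: l2_ball_def)
    also have "\<dots> \<le> r\<^sup>2"
      using exp_ge_add_one_self[of "- \<tau>"] r by simp
    finally show ?thesis
      using fM by (simp add: cap_def g_def)
  qed
  \<comment> \<open>The condition bounds only the square of the evaluation, so two opposite caps are
    needed; they cause the factor 2 in the tail bound.\<close>
  have "{f \<in> l2_ball. 2 * s \<le> (f x)\<^sup>2} \<subseteq> cap (sqrt \<tau>) \<union> cap (- sqrt \<tau>)"
  proof
    fix f
    assume f: "f \<in> {f \<in> l2_ball. 2 * s \<le> (f x)\<^sup>2}"
    then have fM: "f \<in> M"
      by (simp add: l2_ball_def)
    have "(l2_inner f u)\<^sup>2 = (f x)\<^sup>2 / D"
      using fu[OF fM] D0 by (simp add: power_divide)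
    moreover have "\<tau> \<le> (f x)\<^sup>2 / D"
      using f D0 unfolding \<tau>_def by (intro divide_right_mono) auto
    ultimately have "(sqrt \<tau>)\<^sup>2 \<le> \<bar>l2_inner f u\<bar>\<^sup>2"
      using \<tau> by simp
    then have "sqrt \<tau> \<le> \<bar>l2_inner f u\<bar>"
      by (rule power2_le_imp_le) simp
    then have "sqrt \<tau> * sqrt \<tau> \<le> sqrt \<tau> * \<bar>l2_inner f u\<bar>"
      using \<tau> by (intro mult_left_mono) auto
    then have "\<tau> \<le> sqrt \<tau> * \<bar>l2_inner f u\<bar>"
      using \<tau> by simp
    then have "\<tau> \<le> sqrt \<tau> * l2_inner f u \<or> \<tau> \<le> - sqrt \<tau> * l2_inner f u"
      by (cases "l2_inner f u \<ge> 0") auto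
    then show "f \<in> cap (sqrt \<tau>) \<union> cap (- sqrt \<tau>)"
      using in_cap[of f "sqrt \<tau>"] in_cap[of f "- sqrt \<tau>"] f \<tau> by auto
  qed
  then have "emeasure vol {f \<in> l2_ball. 2 * s \<le> (f x)\<^sup>2} \<le> emeasure vol (cap (sqrt \<tau>) \<union> cap (- sqrt \<tau>))"
    using cap(2) by (intro emeasure_mono) auto
  also have "\<dots> \<le> emeasure vol (cap (sqrt \<tau>)) + emeasure vol (cap (- sqrt \<tau>))"
    using cap(2) by (intro emeasure_subadditive) auto
  also have "\<dots> = ennreal (2 * exp (- s)) * emeasure vol l2_ball"
  proof -
    have "ennreal (2 * exp (- s)) = ennreal (exp (- s)) + ennreal (exp (- s))"
      by (subst ennreal_plus[symmetric]) simp_all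
    then show ?thesis
      unfolding cap(1) by (simp only: distrib_right)
  qed
  finally show ?thesis .
qed

text \<open>Since \<open>g\<close> is the derivative of \<open>(2s)^m\<close>, the power
  \<open>y^(2m)\<close> is the integral of \<open>g\<close> over
  \<open>0 \<le> s \<le> y^2 / 2\<close>. Exchanging integrals and inserting the tail bound leaves
  the Gamma integral of \<open>s^(m-1) exp (- s)\<close>, and
  \<open>m * (m-1)! = m!\<close>.\<close>

lemma evaluation_moment:
  assumes x: "norm x = 1" and D: "dim M > 0" and m: "m > 0"
  shows "(\<integral>\<^sup>+f. indicator l2_ball f * ennreal ((f x) ^ (2 * m)) \<partial>vol) \<le>
    ennreal (2 * fact m * 2 ^ m) * emeasure vol l2_ball"
proof -
  interpret sigma_finite_measure vol
    by (rule sigma_finite_vol)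
  interpret pair_sigma_finite vol "lborel :: real measure" ..
  define g where "g s = ennreal (2 ^ m * (real m * s ^ (m - 1))) * indicator {0..} s" for s
  have g [measurable]: "g \<in> borel_measurable borel"
    unfolding g_def by measurable
  have pow: "ennreal (y ^ (2 * m)) = (\<integral>\<^sup>+s. g s * indicator {s. 2 * s \<le> y\<^sup>2} s \<partial>lborel)" for y
  proof -
    have "(\<integral>\<^sup>+s. ennreal (2 ^ m * (real m * s ^ (m - 1))) * indicator {0..y\<^sup>2 / 2} s \<partial>lborel) =
        ennreal (2 ^ m * (y\<^sup>2 / 2) ^ m - 2 ^ m * 0 ^ m)"
      by (rule nn_integral_FTC_Icc) (auto intro!: derivative_eq_intros)
    moreover have "2 ^ m * (y\<^sup>2 / 2) ^ m - 2 ^ m * 0 ^ m = y ^ (2 * m)"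
      using m by (simp add: power_divide power_mult)
    moreover have "(\<integral>\<^sup>+s. g s * indicator {s. 2 * s \<le> y\<^sup>2} s \<partial>lborel) =
        (\<integral>\<^sup>+s. ennreal (2 ^ m * (real m * s ^ (m - 1))) * indicator {0..y\<^sup>2 / 2} s \<partial>lborel)"
      by (rule nn_integral_cong) (auto simp: g_def indicator_def)
    ultimately show ?thesis
      by simp
  qed
  have "(\<integral>\<^sup>+f. indicator l2_ball f * ennreal ((f x) ^ (2 * m)) \<partial>vol) =
      (\<integral>\<^sup>+f. \<integral>\<^sup>+s. g s * (indicator l2_ball f * indicator {s. 2 * s \<le> (f x)\<^sup>2} s) \<partial>lborel \<partial>vol)"
    unfolding pow by (intro nn_integral_cong) (simp add: nn_integral_cmult[symmetric] mult_ac)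
  also have "\<dots> = (\<integral>\<^sup>+s. \<integral>\<^sup>+f. g s * (indicator l2_ball f * indicator {s. 2 * s \<le> (f x)\<^sup>2} s) \<partial>vol \<partial>lborel)"
    by (rule Fubini'[symmetric]) (simp add: indicator_def)
  also have "\<dots> \<le> (\<integral>\<^sup>+s. ennreal (2 * 2 ^ m * real m) * emeasure vol l2_ball *
      (ennreal (s ^ (m - 1) * exp (- s)) * indicator {0..} s) \<partial>lborel)"
  proof (rule nn_integral_mono)
    fix s :: real
    have S: "{f \<in> l2_ball. 2 * s \<le> (f x)\<^sup>2} \<in> sets vol"
    proof -
      have "{f \<in> space vol. 2 * s \<le> (f x)\<^sup>2} \<in> sets vol"
        by measurable
      then have "l2_ball \<inter> {f \<in> space vol. 2 * s \<le> (f x)\<^sup>2} \<in> sets vol"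
        by simp
      also have "l2_ball \<inter> {f \<in> space vol. 2 * s \<le> (f x)\<^sup>2} = {f \<in> l2_ball. 2 * s \<le> (f x)\<^sup>2}"
        by (auto simp: l2_ball_def)
      finally show ?thesis .
    qed
    have "(\<integral>\<^sup>+f. g s * (indicator l2_ball f * indicator {s. 2 * s \<le> (f x)\<^sup>2} s) \<partial>vol) =
        (\<integral>\<^sup>+f. g s * indicator {f \<in> l2_ball. 2 * s \<le> (f x)\<^sup>2} f \<partial>vol)"
      by (intro nn_integral_cong) (simp add: indicator_def)
    also have "\<dots> = g s * emeasure vol {f \<in> l2_ball. 2 * s \<le> (f x)\<^sup>2}"
      by (rule nn_integral_cmult_indicator[OF S])
    also have "\<dots> \<le> ennreal (2 * 2 ^ m * real m) * emeasure vol l2_ball *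
        (ennreal (s ^ (m - 1) * exp (- s)) * indicator {0..} s)"
    proof (cases "s \<ge> 0")
      case True
      have "g s * emeasure vol {f \<in> l2_ball. 2 * s \<le> (f x)\<^sup>2} \<le> g s * (ennreal (2 * exp (- s)) * emeasure vol l2_ball)"
        by (intro mult_left_mono evaluation_tail x D True) simp
      also have "\<dots> = ennreal (2 ^ m * (real m * s ^ (m - 1)) * (2 * exp (- s))) * emeasure vol l2_ball"
        using True by (simp add: g_def ennreal_mult mult.assoc)
      also have "2 ^ m * (real m * s ^ (m - 1)) * (2 * exp (- s)) = (2 * 2 ^ m * real m) * (s ^ (m - 1) * exp (- s))"
        by simp
      also have "ennreal \<dots> = ennreal (2 * 2 ^ m * real m) * ennreal (s ^ (m - 1) * exp (- s))"
        using True by (intro ennreal_mult) auto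
      finally show ?thesis
        using True by (simp add: mult_ac)
    qed (simp add: g_def)
    finally show "(\<integral>\<^sup>+f. g s * (indicator l2_ball f * indicator {s. 2 * s \<le> (f x)\<^sup>2} s) \<partial>vol) \<le>
      ennreal (2 * 2 ^ m * real m) * emeasure vol l2_ball * (ennreal (s ^ (m - 1) * exp (- s)) * indicator {0..} s)" .
  qed
  also have "\<dots> = ennreal (2 * 2 ^ m * real m) * emeasure vol l2_ball * ennreal (fact (m - 1))"
    by (rule nn_integral_cmult_power_times_exp)
  also have "\<dots> =
      ennreal (2 * 2 ^ m * real m * fact (m - 1)) * emeasure vol l2_ball"
    by (simp add: ennreal_mult mult_ac)
  also have "2 * 2 ^ m * real m * fact (m - 1) = 2 * fact m * 2 ^ m"
    using m by (simp add: fact_reduce)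
  finally show ?thesis .
qed

lemma form_nn_integral:
  "f \<in> M \<Longrightarrow> (\<integral>\<^sup>+x. ennreal ((f x) ^ (2 * m)) \<partial>sphere_measure) = ennreal (\<integral>x. (f x) ^ (2 * m) \<partial>sphere_measure)"
  by (intro nn_integral_eq_integral integrable_sphere_measure continuous_intros form_continuous[OF form_in_V]) auto

lemma evaluation_power_measurable:
  "(\<lambda>p. ennreal ((case p of (f, x) \<Rightarrow> f x) ^ (2 * m)))
    \<in> borel_measurable (vol \<Otimes>\<^sub>M (sphere_measure :: (real ^ 'n) measure))"
proof -
  have "(\<lambda>p. ennreal ((case p of (f, x) \<Rightarrow> f x) ^ (2 * m))) \<in> borel_measurable (vol \<Otimes>\<^sub>M borel)"
    using evaluation_measurable_pair by measurable
  then show ?thesis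
    by (simp cong: measurable_cong_sets sets_pair_measure_cong)
qed

lemma moment_measurable: "(\<lambda>f. \<integral>\<^sup>+x. ennreal ((f x) ^ (2 * m)) \<partial>sphere_measure) \<in> borel_measurable vol"
proof -
  interpret finite_measure "sphere_measure :: (real ^ 'n) measure"
    by (rule finite_measure_sphere_measure)
  show ?thesis
    using borel_measurable_nn_integral_fst[OF evaluation_power_measurable] by simp
qed

lemma average_moment:
  assumes D: "dim M > 0" and m: "m > 0"
  shows "(\<integral>\<^sup>+f. indicator l2_ball f * (\<integral>\<^sup>+x. ennreal ((f x) ^ (2 * m)) \<partial>sphere_measure) \<partial>vol) \<le>
    ennreal (2 * fact m * 2 ^ m) * emeasure vol l2_ball"
proof -
  interpret sphere: finite_measure "sphere_measure :: (real ^ 'n) measure"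
    by (rule finite_measure_sphere_measure)
  interpret vol: sigma_finite_measure vol
    by (rule sigma_finite_vol)
  interpret pair_sigma_finite vol "sphere_measure :: (real ^ 'n) measure" ..
  have "(\<integral>\<^sup>+f. indicator l2_ball f * (\<integral>\<^sup>+x. ennreal ((f x) ^ (2 * m)) \<partial>sphere_measure) \<partial>vol) =
      (\<integral>\<^sup>+f. \<integral>\<^sup>+x. indicator l2_ball f * ennreal ((f x) ^ (2 * m)) \<partial>sphere_measure \<partial>vol)"
  proof (rule nn_integral_cong)
    fix f
    assume "f \<in> space vol"
    then have "continuous_on UNIV f"
      by (intro form_continuous[OF form_in_V]) simp
    then have [measurable]: "f \<in> borel_measurable borel"
      by (rule borel_measurable_continuous_onI)
    show "indicator l2_ball f * (\<integral>\<^sup>+x. ennreal ((f x) ^ (2 * m)) \<partial>sphere_measure) =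
        (\<integral>\<^sup>+x. indicator l2_ball f * ennreal ((f x) ^ (2 * m)) \<partial>sphere_measure)"
      by (rule nn_integral_cmult[symmetric]) measurable
  qed
  also have "\<dots> = (\<integral>\<^sup>+x. \<integral>\<^sup>+f. indicator l2_ball f * ennreal ((f x) ^ (2 * m)) \<partial>vol \<partial>sphere_measure)"
  proof (rule Fubini'[symmetric])
    have "(\<lambda>p. indicator l2_ball (fst p) * ennreal ((case p of (f, x) \<Rightarrow> f x) ^ (2 * m)))
        \<in> borel_measurable (vol \<Otimes>\<^sub>M (sphere_measure :: (real ^ 'n) measure))"
      using evaluation_power_measurable[of m] by measurable
    then show "(\<lambda>(f, x). indicator l2_ball f * ennreal ((f x) ^ (2 * m)))
        \<in> borel_measurable (vol \<Otimes>\<^sub>M (sphere_measure :: (real ^ 'n) measure))"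
      by (simp add: split_beta)
  qed
  also have "\<dots> \<le> (\<integral>\<^sup>+x. ennreal (2 * fact m * 2 ^ m) * emeasure vol l2_ball \<partial>(sphere_measure :: (real ^ 'n) measure))"
  proof (rule nn_integral_mono_AE)
    show "AE x in sphere_measure. (\<integral>\<^sup>+f. indicator l2_ball f * ennreal ((f x) ^ (2 * m)) \<partial>vol) \<le>
        ennreal (2 * fact m * 2 ^ m) * emeasure vol l2_ball"
      using AE_sphere_measure by eventually_elim (rule evaluation_moment[OF _ D m], simp)
  qed
  also have "\<dots> = ennreal (2 * fact m * 2 ^ m) * emeasure vol l2_ball"
    by (simp add: emeasure_sphere_measure_UNIV)
  finally show ?thesis .
qed

text \<open>Apply the sup bound for forms of degree \<open>2km\<close> to \<open>f\<^sup>m\<close>.\<close>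

lemma sup_le_moment:
  assumes f: "f \<in> M" and x: "norm x = 1"
  shows "(f x) ^ (2 * m) \<le> dim (forms (2 * k * m) :: (real ^ 'n \<Rightarrow> real) set) * (\<integral>x. (f x) ^ (2 * m) \<partial>sphere_measure)"
proof -
  have "((f x) ^ m)\<^sup>2 \<le> dim (forms (2 * k * m) :: (real ^ 'n \<Rightarrow> real) set) * l2_inner (\<lambda>x. f x ^ m) (\<lambda>x. f x ^ m)"
    by (rule form_sup_bound[OF form_power[OF form_in_V[OF f]] x])
  then show ?thesis
    by (simp add: l2_inner_def power_mult[symmetric] power_add[symmetric] mult_2[symmetric] mult.commute)
qed

text \<open>Discarding from the unit ball the elements with a large moment of order
  \<open>2n\<close> loses at most a sixth of its volume; for the others the sup bound for
  \<open>f^n\<close> gives \<open>|t f| < 1\<close> on the sphere, so \<open>t f\<close> lies in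
  \<open>K\<close>.\<close>

lemma volume_K_lower:
  fixes t :: real
  assumes n: "CARD('n) \<ge> 2" and D: "dim M > 0"
  defines "t \<equiv> 1 / sqrt (4 * (2 * real k + 1) * real CARD('n))"
  shows "5 / 6 * t ^ dim M * measure vol l2_ball \<le> measure vol K"
proof -
  define N where "N = CARD('n)"
  have N: "N > 0" "N \<ge> 2"
    using n by (auto simp: N_def)
  define P where "P = real (dim (forms (2 * k * N) :: (real ^ 'n \<Rightarrow> real) set))"
  define u where "u f = (\<integral>\<^sup>+x. ennreal ((f x) ^ (2 * N)) \<partial>sphere_measure)" for f :: "real ^ 'n \<Rightarrow> real"
  have u [measurable]: "u \<in> borel_measurable vol"
    unfolding u_def by (rule moment_measurable)
  define a where "a = 4 * (2 * real k + 1) * real N"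
  have a: "a > 0"
    using N by (simp add: a_def)
  have t: "t > 0" "t\<^sup>2 = 1 / a"
    using a by (simp_all add: t_def a_def N_def power_divide)
  define c where "c = P * (1 / a) ^ N"
  have c: "c \<ge> 0"
    using a by (simp add: c_def P_def)
  \<comment> \<open>Markov's inequality bounds this set. Outside it \<open>c * u f < 1\<close>, and
    since \<open>c = P * t^(2N)\<close>, \<open>sup_le_moment\<close> yields
    \<open>(t * f x)^(2N) < 1\<close>.\<close>
  define bad where "bad = {f \<in> l2_ball. 1 \<le> ennreal c * u f}"
  define good where "good = l2_ball - bad"
  have "{f \<in> space vol. 1 \<le> ennreal c * u f} \<in> sets vol"
    by measurable
  then have "l2_ball \<inter> {f \<in> space vol. 1 \<le> ennreal c * u f} \<in> sets vol"
    by simp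
  also have "l2_ball \<inter> {f \<in> space vol. 1 \<le> ennreal c * u f} = bad"
    by (auto simp: bad_def l2_ball_def)
  finally have bad [measurable]: "bad \<in> sets vol" .
  have good [measurable]: "good \<in> sets vol"
    by (simp add: good_def)
  \<comment> \<open>As \<open>P * fact N\<close> is at most \<open>(a / 4)^N / (2k + 1)\<close>, the
    left side is at most \<open>2 (1/2)^N / (2k + 1)\<close>; \<open>N \<ge> 2\<close> and
    \<open>k \<ge> 1\<close> give 1/6.\<close>
  have c_bound: "c * (2 * fact N * 2 ^ N) \<le> 1 / 6"
  proof -
    have "P * fact N * (2 * real k + 1) \<le> ((2 * real k + 1) * real N) ^ N"
    proof -
      have "real (dim (forms (2 * k * CARD('n)) :: (real ^ 'n \<Rightarrow> real) set) * fact CARD('n) * (2 * k + 1)) \<le>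
          real (((2 * k + 1) * CARD('n)) ^ CARD('n))"
        using dim_forms_fact_le[of k, where 'n = 'n] by (simp only: of_nat_le_iff)
      then show ?thesis
        by (simp add: P_def N_def algebra_simps)
    qed
    also have "(2 * real k + 1) * real N = a / 4"
      unfolding a_def by linarith
    finally have "P * fact N * (2 * real k + 1) * (2 * 2 ^ N * (1 / a) ^ N) \<le> (a / 4) ^ N * (2 * 2 ^ N * (1 / a) ^ N)"
      using a by (intro mult_right_mono) auto
    also have "\<dots> = 2 * (1 / 2) ^ N"
    proof -
      have "(a / 4) ^ N * 2 ^ N * (1 / a) ^ N = (1 / 2) ^ N"
        using a by (simp add: power_mult_distrib[symmetric])
      then show ?thesis
        by (simp add: mult_ac)
    qed
    also have "\<dots> \<le> 2 * (1 / 2) ^ 2"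
      using N by (intro mult_left_mono power_decreasing) auto
    finally have "(2 * real k + 1) * (c * (2 * fact N * 2 ^ N)) \<le> 1 / 2"
      by (simp add: c_def mult_ac power2_eq_square)
    moreover have "3 * (c * (2 * fact N * 2 ^ N)) \<le> (2 * real k + 1) * (c * (2 * fact N * 2 ^ N))"
      using k c by (intro mult_right_mono) auto
    ultimately show ?thesis
      by linarith
  qed
  have ball_fin: "emeasure vol l2_ball = ennreal (measure vol l2_ball)"
    using l2_ball_finite by (intro emeasure_eq_ennreal_measure) auto
  have "emeasure vol bad \<le> ennreal c * (\<integral>\<^sup>+f. u f * indicator l2_ball f \<partial>vol)"
  proof -
    have "emeasure vol bad = (\<integral>\<^sup>+f. indicator bad f \<partial>vol)"
      by simp
    also have "\<dots> \<le> (\<integral>\<^sup>+f. ennreal c * (u f * indicator l2_ball f) \<partial>vol)"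
      by (intro nn_integral_mono) (auto simp: bad_def indicator_def)
    also have "\<dots> = ennreal c * (\<integral>\<^sup>+f. u f * indicator l2_ball f \<partial>vol)"
      by (rule nn_integral_cmult) measurable
    finally show ?thesis .
  qed
  also have "\<dots> \<le> ennreal c * (ennreal (2 * fact N * 2 ^ N) * emeasure vol l2_ball)"
    using average_moment[OF D N(1)] by (intro mult_left_mono) (simp_all add: u_def mult.commute)
  also have "\<dots> = ennreal (c * (2 * fact N * 2 ^ N)) * emeasure vol l2_ball"
    using c by (simp add: ennreal_mult mult.assoc)
  also have "\<dots> \<le> ennreal (1 / 6) * emeasure vol l2_ball"
    by (intro mult_right_mono ennreal_leI c_bound) simp
  also have "\<dots> = ennreal (1 / 6 * measure vol l2_ball)"
    unfolding ball_fin by (rule ennreal_mult[symmetric]) simp_all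
  finally have bad_le: "measure vol bad \<le> 1 / 6 * measure vol l2_ball"
    unfolding measure_def[of vol bad] by (intro enn2real_leI) simp_all
  have "measure vol good = measure vol l2_ball - measure vol bad"
    unfolding good_def by (rule measure_Diff) (use l2_ball_finite in \<open>auto simp: bad_def less_top\<close>)
  then have good_ge: "5 / 6 * measure vol l2_ball \<le> measure vol good"
    using bad_le by simp
  have good_K: "good \<subseteq> {f \<in> M. 0 + t *\<^sub>R f \<in> K}"
  proof
    fix f
    assume f: "f \<in> good"
    then have fM: "f \<in> M"
      by (simp add: good_def l2_ball_def)
    define I where "I = (\<integral>x. (f x) ^ (2 * N) \<partial>sphere_measure)"
    have I: "I \<ge> 0"
      unfolding I_def by (intro integral_nonneg_AE) simp
    have "ennreal (c * I) < 1"
      using f c I form_nn_integral[OF fM, of N]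
      by (auto simp: good_def bad_def u_def I_def ennreal_mult not_le)
    then have cI: "c * I < 1"
      by (simp add: ennreal_less_one_iff)
    have "-1 \<le> (t *\<^sub>R f) x" if x: "norm x = 1" for x
    proof -
      have "(t * f x) ^ (2 * N) = (1 / a) ^ N * (f x) ^ (2 * N)"
        by (simp only: power_mult power_mult_distrib t(2))
      also have "\<dots> \<le> (1 / a) ^ N * (P * I)"
        using sup_le_moment[OF fM x, of N] a by (intro mult_left_mono) (auto simp: P_def I_def)
      also have "\<dots> < 1"
        using cI by (simp add: c_def mult_ac)
      finally have "\<bar>t * f x\<bar> ^ (2 * N) < 1 ^ (2 * N)"
        by (simp add: power_even_abs)
      then have "\<bar>t * f x\<bar> < 1"
        by (rule power_less_imp_less_base) simp
      then show ?thesis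
        by simp
    qed
    then show "f \<in> {f \<in> M. 0 + t *\<^sub>R f \<in> K}"
      using fM subspace_scale[OF V(1) fM] by (simp add: nonneg_section_iff)
  qed
  have "(\<lambda>f. 0 + t *\<^sub>R f) \<in> vol \<rightarrow>\<^sub>M vol"
    using subspace_0[OF V(1)] by (intro affine_measurable) auto
  from sets_Collect_preimage[OF this K_sets] have "{f \<in> M. 0 + t *\<^sub>R f \<in> K} \<in> sets vol"
    by simp
  with good_K have "emeasure vol good \<le> emeasure vol {f \<in> M. 0 + t *\<^sub>R f \<in> K}"
    by (rule emeasure_mono)
  then have "ennreal (t ^ dim M) * emeasure vol good \<le> ennreal (\<bar>t\<bar> ^ dim M) * emeasure vol {f \<in> M. 0 + t *\<^sub>R f \<in> K}"
    using t by (intro mult_mono) auto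
  also have "\<dots> = emeasure vol K"
    using t by (intro emeasure_vol_affine[symmetric] K_sets subspace_0 V(1)) simp
  finally have le: "ennreal (t ^ dim M) * emeasure vol good \<le> emeasure vol K" .
  have "emeasure vol good \<le> emeasure vol l2_ball"
    by (intro emeasure_mono) (auto simp: good_def)
  then have "emeasure vol good = ennreal (measure vol good)"
    using l2_ball_finite by (intro emeasure_eq_ennreal_measure) (auto simp: top_unique)
  moreover have "emeasure vol K = ennreal (measure vol K)"
    using K_finite by (intro emeasure_eq_ennreal_measure) auto
  ultimately have "t ^ dim M * measure vol good \<le> measure vol K"
    using le t by (simp add: ennreal_mult[symmetric])
  moreover have "t ^ dim M * (5 / 6 * measure vol l2_ball) \<le> t ^ dim M * measure vol good"
    using good_ge t by (intro mult_left_mono) auto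
  ultimately show ?thesis
    by (simp add: mult_ac)
qed

lemma l2_volume_eq:
  assumes "b = (SOME b. l2_orthonormal_basis M b)" "A \<in> sets vol"
  shows "l2_volume M A = measure vol A"
  unfolding l2_volume_def Let_def assms(1)[symmetric] measure_def emeasure_vol[OF assms(2)] combination_def ..

end

theorem theorem5p1:
  fixes k :: nat
  assumes "k \<ge> 1" and "CARD('n :: finite) \<ge> 2"
  shows "let n = real CARD('n);
             M = (zero_mean_forms k :: (real ^ 'n \<Rightarrow> real) set);
             r = (l2_volume M (nonneg_section k) / l2_volume M (zero_mean_ball k)) powr (1 / real (dim M))
         in 1 / (2 * sqrt (4 * real k + 2)) * n powr (- 1 / 2) \<le> r \<and>
            r \<le> 4 * sqrt (2 * (real k)\<^sup>2 / (4 * (real k)\<^sup>2 + n - 2))"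
proof -
  define b :: "nat \<Rightarrow> real ^ 'n \<Rightarrow> real" where "b = (SOME b. l2_orthonormal_basis (zero_mean_forms k) b)"
  have "l2_orthonormal_basis (zero_mean_forms k) b"
    unfolding b_def by (rule someI_ex[OF zero_mean_forms_orthonormal_basis])
  then interpret mean_zero_space k b
    using assms by unfold_locales auto
  define n where "n = real CARD('n)"
  have n: "n \<ge> 2"
    using assms by (simp add: n_def)
  define D where "D = dim M"
  have D: "D > 0"
    unfolding D_def using zero_mean_forms_nontrivial[OF k assms(2)] .
  have ball: "zero_mean_ball k = l2_ball"
    by (simp add: zero_mean_ball_def l2_ball_def)
  define B where "B = measure vol l2_ball"
  have B: "B > 0"
    using l2_ball_pos l2_ball_finite by (simp add: B_def measure_def enn2real_positive_iff)
  define q where "q = l2_volume M (nonneg_section k) / l2_volume M (zero_mean_ball k)"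
  have q: "q = measure vol K / B"
    by (simp add: q_def ball B_def l2_volume_eq[OF b_def])
  have root: "(x ^ D) powr (1 / real D) = x" if "x > 0" for x
    using that D by (simp add: powr_realpow[symmetric] powr_powr)
  have "1 / (2 * sqrt (4 * real k + 2)) * n powr (- 1 / 2) \<le> q powr (1 / real D)"
  proof -
    define t where "t = 1 / sqrt (4 * (2 * real k + 1) * n)"
    have t: "t > 0"
      using n by (simp add: t_def)
    \<comment> \<open>The claimed lower bound is smaller than \<open>t\<close> by
      \<open>sqrt 2\<close>, a spare factor in each dimension.\<close>
    have s: "1 / (2 * sqrt (4 * real k + 2)) * n powr (- 1 / 2) = t / sqrt 2"
    proof -
      have "n powr (- 1 / 2) = 1 / sqrt n"
        using n by (simp add: powr_minus_divide powr_half_sqrt)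
      moreover have "sqrt (4 * (2 * real k + 1) * n) * sqrt 2 = 2 * sqrt (4 * real k + 2) * sqrt n"
      proof -
        have "4 * (2 * real k + 1) * n * 2 = 2\<^sup>2 * ((4 * real k + 2) * n)"
          by (simp add: algebra_simps)
        then have "sqrt (4 * (2 * real k + 1) * n * 2) = sqrt (2\<^sup>2 * ((4 * real k + 2) * n))"
          by (rule arg_cong)
        then show ?thesis
          unfolding real_sqrt_mult real_sqrt_abs by simp
      qed
      ultimately show ?thesis
        by (simp only: t_def divide_divide_eq_left) simp
    qed
    \<comment> \<open>A single spare \<open>sqrt 2\<close>, available because
      \<open>D \<ge> 1\<close>, outweighs the 5/6 lost to the bad set.\<close>
    have "1 \<le> 5 / 6 * sqrt 2"
      by (rule power2_le_imp_le) (simp_all add: power_mult_distrib power2_eq_square)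
    also have "\<dots> \<le> 5 / 6 * sqrt 2 ^ D"
      using D self_le_power[of "sqrt 2" D] by simp
    finally have "(t / sqrt 2) ^ D \<le> 5 / 6 * t ^ D"
      using t by (simp add: power_divide field_simps)
    also have "\<dots> \<le> q"
      using volume_K_lower[OF assms(2)] D B unfolding q D_def n_def t_def B_def by (simp add: le_divide_eq)
    finally have "((t / sqrt 2) ^ D) powr (1 / real D) \<le> q powr (1 / real D)"
      using t by (intro powr_mono2) auto
    then show ?thesis
      using t unfolding s by (subst (asm) root) auto
  qed
  moreover have "q powr (1 / real D) \<le> 4 * sqrt (2 * (real k)\<^sup>2 / (4 * (real k)\<^sup>2 + n - 2))"
  proof -
    define \<rho> where "\<rho> = sqrt (4 * (real k)\<^sup>2 / (4 * (real k)\<^sup>2 + 2 * n))"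
    have \<rho>: "\<rho> > 0"
      using n k unfolding \<rho>_def by (intro real_sqrt_gt_zero divide_pos_pos add_nonneg_pos) auto
    have "measure vol K \<le> 2 ^ D * (\<rho> ^ D * B)"
      unfolding D_def \<rho>_def n_def B_def
      by (rule order_trans[OF volume_K_le_symmetric_part mult_left_mono[OF volume_sup_ball_le]]) simp
    then have "q \<le> (2 * \<rho>) ^ D"
      using B by (simp add: q divide_le_eq power_mult_distrib mult_ac)
    moreover have "q \<ge> 0"
      using B by (simp add: q)
    ultimately have "q powr (1 / real D) \<le> ((2 * \<rho>) ^ D) powr (1 / real D)"
      by (intro powr_mono2) auto
    also have "\<dots> = 2 * \<rho>"
      using \<rho> by (intro root) simp
    \<comment> \<open>The bound already reached is stronger: passing to the claimed one doubles the
      numerator under the root, after a factor 4 is taken out, and replaces \<open>2n\<close> by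
      \<open>n - 2\<close> in the denominator.\<close>
    also have "\<dots> \<le> 4 * sqrt (2 * (real k)\<^sup>2 / (4 * (real k)\<^sup>2 + n - 2))"
    proof -
      have "4 * (real k)\<^sup>2 / (4 * (real k)\<^sup>2 + 2 * n) \<le> 4 * (2 * (real k)\<^sup>2 / (4 * (real k)\<^sup>2 + n - 2))"
      proof -
        have "(real k)\<^sup>2 > 0"
          using k by simp
        then have "4 * (real k)\<^sup>2 / (4 * (real k)\<^sup>2 + 2 * n) \<le> 8 * (real k)\<^sup>2 / (4 * (real k)\<^sup>2 + n - 2)"
          using n by (intro frac_le) linarith+
        then show ?thesis
          by simp
      qed
      then have "\<rho> \<le> sqrt (4 * (2 * (real k)\<^sup>2 / (4 * (real k)\<^sup>2 + n - 2)))"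
        unfolding \<rho>_def by (rule real_sqrt_le_mono)
      also have "\<dots> = 2 * sqrt (2 * (real k)\<^sup>2 / (4 * (real k)\<^sup>2 + n - 2))"
        unfolding real_sqrt_mult[of 4] by simp
      finally show ?thesis
        by simp
    qed
    finally show ?thesis .
  qed
  ultimately show ?thesis
    unfolding Let_def q_def D_def n_def by blast
qed

end
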